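(* Let $N\ge 1$ and let $\mathcal{H}$ be either the Hardy space $H^2(B_N)$ or a weighted Bergman space $A^2_s(B_N)$ with $s>-1$. Let $\varphi,\psi$ be analytic self-maps of $B_N$ such that $C_\varphi$ and $C_\psi$ are bounded on $\mathcal{H}$. If $C_\varphi-C_\psi$ is compact on $\mathcal{H}$, then $\varphi(\zeta)=\psi(\zeta)$ (as radial limits) and $d_\varphi(\zeta)=d_\psi(\zeta)$ at every point $\zeta\in\partial B_N$ at which $\varphi$ has finite angular derivative.
   Context: $B_N$ is the open unit ball of $\mathbb{C}^N$, $\partial B_N$ the unit sphere, $\langle\cdot,\cdot\rangle$ the standard Hermitian inner product, $\sigma$ normalized Lebesgue measure on $\partial B_N$, $\nu$ normalized Lebesgue volume measure on $B_N$. $H^2(B_N)$ is the Hilbert space of holomorphic $f$ on $B_N$ with $\|f\|_2^2=\sup_{0<r<1}\int_{\partial B_N}|f(r\zeta)|^2\,d\sigma(\zeta)<\infty$. For $s>-1$, $A^2_s(B_N)$ is the Hilbert space of holomorphic $f$ on $B_N$ with $\|f\|_{2,s}^2=\int_{B_N}|f(z)|^2 w_s(z)\,d\nu(z)<\infty$, where $w_s(z)=\frac{\Gamma(N+s+1)}{\Gamma(N+1)\Gamma(s+1)}(1-|z|^2)^s$. For an analytic map $\varphi:B_N\to B_N$, $C_\varphi f=f\circ\varphi$. For $\zeta\in\partial B_N$, $\varphi(\zeta):=\lim_{r\to1^-}\varphi(r\zeta)$ denotes the radial limit when it exists (the assertion $\varphi(\zeta)=\psi(\zeta)$ includes existence of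 both radial limits), and $$d_\varphi(\zeta)=\liminf_{z\to\zeta}\frac{1-|\varphi(z)|}{1-|z|}\in(0,\infty],$$ where $z$ tends to $\zeta$ unrestrictedly in $B_N$. Finite angular derivative: a function $f:B_N\to\mathbb{C}$ has restricted limit $L$ at $\zeta\in\partial B_N$ if $\lim_{t\to1}f(\Gamma(t))=L$ for every curve $\Gamma:[0,1)\to B_N$ with $\Gamma(t)\to\zeta$ such that, writing $\gamma(t)=\langle\Gamma(t),\zeta\rangle\zeta$, one has $\lim_{t\to1}\frac{|\Gamma(t)-\gamma(t)|^2}{1-|\gamma(t)|^2}=0$ and $\frac{|\gamma(t)-\zeta|}{1-|\gamma(t)|}\le M<\infty$ for all $0\le t<1$ and some $M$. The map $\varphi$ has finite angular derivative at $\zeta$ if there is $\eta\in\partial B_N$ such that $\frac{\langle\eta-\varphi(z),\eta\rangle}{\langle\zeta-z,\zeta\rangle}$ has a (finite) restricted limit at $\zeta$. By the Julia–Carathéodory theorem in $B_N$ this is equivalent to $d_\varphi(\zeta)<\infty$, and in that case $\varphi$ has restricted limit (in particular radial limit) $\eta$ at $\zeta$. *)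

theory Defs
  imports "HOL-Analysis.Analysis"
begin

abbreviation unit_ball :: "(complex ^ 'n::finite) set" where
  "unit_ball \<equiv> ball 0 1"

abbreviation unit_sphere :: "(complex ^ 'n::finite) set" where
  "unit_sphere \<equiv> sphere 0 1"

definition cinner :: "complex ^ 'n::finite \<Rightarrow> complex ^ 'n \<Rightarrow> complex" where
  "cinner z w = (\<Sum>i\<in>UNIV. z $ i * cnj (w $ i))"

text \<open>Holomorphy in several variables on an open set: Frechet differentiability with a
  complex-linear derivative \<open>h \<mapsto> \<Sum>i. a i * h i\<close>.\<close>

definition several_holomorphic_on ::
    "(complex ^ 'n::finite \<Rightarrow> complex) \<Rightarrow> (complex ^ 'n) set \<Rightarrow> bool" where
  "several_holomorphic_on f S \<longleftrightarrow>
     (\<forall>z\<in>S. \<exists>a :: complex ^ 'n. (f has_derivative (\<lambda>h. \<Sum>i\<in>UNIV. a $ i * h $ i)) (at z))"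

definition analytic_self_map :: "(complex ^ 'n::finite \<Rightarrow> complex ^ 'n) \<Rightarrow> bool" where
  "analytic_self_map \<phi> \<longleftrightarrow>
     (\<forall>i. several_holomorphic_on (\<lambda>z. \<phi> z $ i) unit_ball) \<and> \<phi> ` unit_ball \<subseteq> unit_ball"

definition ball_measure :: "(complex ^ 'n::finite) measure" where
  "ball_measure = uniform_measure lborel unit_ball"

text \<open>Normalized surface measure: the measure of a Borel subset \<open>E\<close> of the sphere is the normalized
  volume of the cone of all \<open>r *\<^sub>R \<zeta>\<close> with \<open>0 < r < 1\<close> and \<open>\<zeta> \<in> E\<close>.  It is obtained by pushing
  the volume measure forward along the radial projection (the origin, which this sends to itself,
  is a null set), so it is a measure on the whole space concentrated on the sphere.\<close>

definition sphere_measure :: "(complex ^ 'n::finite) measure" where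
  "sphere_measure = distr ball_measure borel (\<lambda>z. z /\<^sub>R norm z)"

definition bergman_weight :: "real \<Rightarrow> complex ^ 'n::finite \<Rightarrow> real" where
  "bergman_weight s z =
     Gamma (real CARD('n) + s + 1) / (Gamma (real CARD('n) + 1) * Gamma (s + 1))
       * (1 - (norm z)\<^sup>2) powr s"

text \<open>\<open>Hardy\<close> stands for the Hardy space and \<open>Bergman s\<close> for the Bergman space with weight
  \<open>bergman_weight s\<close>, which is meaningful for \<open>s > -1\<close> only.\<close>

datatype space_kind = Hardy | Bergman real

fun sq_norm :: "space_kind \<Rightarrow> (complex ^ 'n::finite \<Rightarrow> complex) \<Rightarrow> ennreal" where
  "sq_norm Hardy f =
     (SUP r\<in>{0<..<1::real}.
        \<integral>\<^sup>+\<zeta>\<in>unit_sphere. ennreal ((cmod (f (r *\<^sub>R \<zeta>)))\<^sup>2) \<partial>sphere_measure)"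
| "sq_norm (Bergman s) f =
     (\<integral>\<^sup>+z\<in>unit_ball. ennreal ((cmod (f z))\<^sup>2 * bergman_weight s z) \<partial>ball_measure)"

text \<open>A function on the ball is represented by its extension by zero to the whole space, so that
  distinct members of \<open>fun_space\<close> are distinct functions on the ball.\<close>

definition fun_space :: "space_kind \<Rightarrow> (complex ^ 'n::finite \<Rightarrow> complex) set" where
  "fun_space H =
     {f. several_holomorphic_on f unit_ball \<and> (\<forall>z. z \<notin> unit_ball \<longrightarrow> f z = 0) \<and> sq_norm H f < \<infinity>}"

definition space_norm :: "space_kind \<Rightarrow> (complex ^ 'n::finite \<Rightarrow> complex) \<Rightarrow> real" where
  "space_norm H f = sqrt (enn2real (sq_norm H f))"

definition comp_op ::
    "(complex ^ 'n::finite \<Rightarrow> complex ^ 'n) \<Rightarrow> (complex ^ 'n \<Rightarrow> complex) \<Rightarrow> complex ^ 'n \<Rightarrow> complex" where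
  "comp_op \<phi> f = (\<lambda>z. if z \<in> unit_ball then f (\<phi> z) else 0)"

definition bounded_op ::
    "space_kind \<Rightarrow> ((complex ^ 'n::finite \<Rightarrow> complex) \<Rightarrow> complex ^ 'n \<Rightarrow> complex) \<Rightarrow> bool" where
  "bounded_op H T \<longleftrightarrow>
     T ` fun_space H \<subseteq> fun_space H \<and>
     (\<exists>K. \<forall>f\<in>fun_space H. space_norm H (T f) \<le> K * space_norm H f)"

definition compact_op ::
    "space_kind \<Rightarrow> ((complex ^ 'n::finite \<Rightarrow> complex) \<Rightarrow> complex ^ 'n \<Rightarrow> complex) \<Rightarrow> bool" where
  "compact_op H T \<longleftrightarrow>
     T ` fun_space H \<subseteq> fun_space H \<and>
     (\<forall>f :: nat \<Rightarrow> complex ^ 'n \<Rightarrow> complex.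
        (\<forall>k. f k \<in> fun_space H) \<and> (\<exists>K. \<forall>k. space_norm H (f k) \<le> K) \<longrightarrow>
        (\<exists>g\<in>fun_space H. \<exists>u :: nat \<Rightarrow> nat. strict_mono u \<and>
           (\<lambda>k. space_norm H (\<lambda>z. T (f (u k)) z - g z)) \<longlonglongrightarrow> 0))"

definition has_radial_limit ::
    "(complex ^ 'n::finite \<Rightarrow> complex ^ 'n) \<Rightarrow> complex ^ 'n \<Rightarrow> complex ^ 'n \<Rightarrow> bool" where
  "has_radial_limit \<phi> \<zeta> w \<longleftrightarrow> ((\<lambda>r::real. \<phi> (r *\<^sub>R \<zeta>)) \<longlongrightarrow> w) (at_left 1)"

definition dilation_coeff ::
    "(complex ^ 'n::finite \<Rightarrow> complex ^ 'n) \<Rightarrow> complex ^ 'n \<Rightarrow> ereal" where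
  "dilation_coeff \<phi> \<zeta> =
     Liminf (at \<zeta> within unit_ball) (\<lambda>z. ereal ((1 - norm (\<phi> z)) / (1 - norm z)))"

definition restricted_curve :: "(real \<Rightarrow> complex ^ 'n::finite) \<Rightarrow> complex ^ 'n \<Rightarrow> bool" where
  "restricted_curve \<Gamma> \<zeta> \<longleftrightarrow>
     (let \<gamma> = (\<lambda>t. cinner (\<Gamma> t) \<zeta> *s \<zeta>) in
        continuous_on {0..<1} \<Gamma> \<and> \<Gamma> ` {0..<1} \<subseteq> unit_ball \<and> (\<Gamma> \<longlongrightarrow> \<zeta>) (at_left 1) \<and>
        ((\<lambda>t. (norm (\<Gamma> t - \<gamma> t))\<^sup>2 / (1 - (norm (\<gamma> t))\<^sup>2)) \<longlongrightarrow> 0) (at_left 1) \<and>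
        (\<exists>M. \<forall>t\<in>{0..<1}. norm (\<gamma> t - \<zeta>) / (1 - norm (\<gamma> t)) \<le> M))"

definition has_restricted_limit ::
    "(complex ^ 'n::finite \<Rightarrow> complex) \<Rightarrow> complex ^ 'n \<Rightarrow> complex \<Rightarrow> bool" where
  "has_restricted_limit f \<zeta> L \<longleftrightarrow>
     (\<forall>\<Gamma>. restricted_curve \<Gamma> \<zeta> \<longrightarrow> ((\<lambda>t. f (\<Gamma> t)) \<longlongrightarrow> L) (at_left 1))"

definition finite_angular_derivative ::
    "(complex ^ 'n::finite \<Rightarrow> complex ^ 'n) \<Rightarrow> complex ^ 'n \<Rightarrow> bool" where
  "finite_angular_derivative \<phi> \<zeta> \<longleftrightarrow>
     (\<exists>\<eta>\<in>unit_sphere. \<exists>L.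
        has_restricted_limit (\<lambda>z. cinner (\<eta> - \<phi> z) \<eta> / cinner (\<zeta> - z) \<zeta>) \<zeta> L)"

end

theory Submission
  imports Defs "HOL-Complex_Analysis.Cauchy_Integral_Formula"
begin

text \<open>
  Let \<open>\<alpha>\<close> be \<open>N\<close> for the Hardy space and \<open>N + s + 1\<close> for the Bergman space.  Point
  evaluation at \<open>z\<close> has norm at most a multiple of \<open>(1 - |z|)\<^bsup>-\<alpha>/2\<^esup>\<close>, and the functions
  \<open>f\<^sub>w(z) = (1 - |w|\<^sup>2)\<^bsup>m-\<alpha>/2\<^esup> / (1 - \<langle>z,w\<rangle>)\<^bsup>m\<^esup>\<close> are bounded in the space uniformly in
  \<open>w\<close> for every large integer \<open>m\<close> and tend to \<open>0\<close> pointwise as \<open>|w| \<rightarrow> 1\<close>.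

  Let \<open>z\<^sub>k\<close> tend to the sphere with \<open>1 - |\<phi>(z\<^sub>k)| \<le> K (1 - |z\<^sub>k|)\<close>, and apply the compact
  difference \<open>T\<close> to \<open>f\<^sub>w\<close> with \<open>w = \<phi>(z\<^sub>k)\<close>.  Along a subsequence the images converge in norm,
  necessarily to \<open>0\<close> because they do so pointwise.  Evaluation at \<open>z\<^sub>k\<close> then gives
  \<open>x\<^sub>k\<^bsup>m\<^esup> \<rightarrow> 1\<close> for \<open>x\<^sub>k = (1 - |\<phi>(z\<^sub>k)|\<^sup>2) / (1 - \<langle>\<psi>(z\<^sub>k),\<phi>(z\<^sub>k)\<rangle>)\<close>; using \<open>m\<close> and
  \<open>m + 1\<close> one gets \<open>x\<^sub>k \<rightarrow> 1\<close>.  This forces \<open>\<psi>(z\<^sub>k) - \<phi>(z\<^sub>k) \<rightarrow> 0\<close> and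
  \<open>limsup (1 - |\<psi>(z\<^sub>k)|) / (1 - |\<phi>(z\<^sub>k)|) \<le> 1\<close>.  Radial sequences yield the equality of the
  radial limits.  Sequences along which the quotient defining \<open>d\<^sub>\<phi>\<close> approaches its lower limit
  yield \<open>d\<^sub>\<psi> \<le> d\<^sub>\<phi>\<close>, and the situation is symmetric, so the Julia--Caratheodory theorem is not
  needed.
\<close>

section \<open>The Hermitian inner product and invariance of Lebesgue measure\<close>

lemma cinner_add_left: "cinner (x + y) z = cinner x z + cinner y z"
  by (simp add: cinner_def algebra_simps sum.distrib)

lemma cinner_diff_left: "cinner (x - y) z = cinner x z - cinner y z"
  by (simp add: cinner_def algebra_simps sum_subtractf)

lemma cinner_vector_mult_left: "cinner (c *s x) y = c * cinner x y"
  by (simp add: cinner_def sum_distrib_left mult.assoc)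

lemma cinner_scaleR_left: "cinner (r *\<^sub>R x) y = of_real r * cinner x y"
  unfolding cinner_def vector_scaleR_component
  by (simp add: scaleR_conv_of_real sum_distrib_left mult.assoc)

lemma cinner_scaleR_right: "cinner x (r *\<^sub>R y) = of_real r * cinner x y"
  unfolding cinner_def vector_scaleR_component
  by (simp add: scaleR_conv_of_real sum_distrib_left mult_ac)

lemma cinner_zero_right [simp]: "cinner x 0 = 0"
  by (simp add: cinner_def)

lemma Re_cinner: "Re (cinner x y) = x \<bullet> y"
  by (simp add: cinner_def inner_vec_def inner_complex_def)

lemma cinner_self: "cinner x x = of_real ((norm x)\<^sup>2)"
  by (simp add: cinner_def norm_vec_def L2_set_def complex_norm_square sum_nonneg
      del: of_real_power)

lemma norm_vector_mult: "norm (c *s x) = cmod c * norm (x :: complex ^ 'n)"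
  by (simp add: norm_vec_def L2_set_def norm_mult power_mult_distrib real_sqrt_mult
      flip: sum_distrib_left)

text \<open>Multiplying \<open>x\<close> by a unimodular \<open>c\<close> makes the Hermitian
  product real and nonnegative without changing \<open>norm x\<close>. It then equals the real inner
  product, for which Cauchy--Schwarz is known.\<close>

lemma norm_cinner_le: "cmod (cinner x y) \<le> norm x * norm y"
proof (cases "cinner x y = 0")
  case False
  define c where "c = cnj (cinner x y) / of_real (cmod (cinner x y))"
  have "cmod c = 1"
    using False by (simp add: c_def norm_divide)
  have "c * cinner x y = of_real (cmod (cinner x y))"
    using False by (simp add: c_def complex_norm_square [symmetric] power2_eq_square
        mult.commute [of "cnj _"] field_simps flip: of_real_mult)
  then have "cmod (cinner x y) = Re (cinner (c *s x) y)"
    by (simp add: cinner_vector_mult_left)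
  also have "\<dots> \<le> norm (c *s x) * norm y"
    by (simp add: Re_cinner norm_cauchy_schwarz)
  finally show ?thesis
    by (simp add: norm_vector_mult \<open>cmod c = 1\<close>)
qed simp

lemma norm_one_minus_cinner_ge: "1 - norm x * norm y \<le> cmod (1 - cinner x y)"
  using norm_triangle_ineq2 [of 1 "cinner x y"] norm_cinner_le [of x y] by simp

lemma bounded_linear_cinner_left: "bounded_linear (\<lambda>x. cinner x y)"
  by (rule bounded_linear_intro [where K = "norm y"])
    (simp_all add: cinner_add_left cinner_scaleR_left scaleR_conv_of_real [where 'a = complex] norm_cinner_le)

lemma continuous_on_cinner_left [continuous_intros]:
  "continuous_on S f \<Longrightarrow> continuous_on S (\<lambda>x. cinner (f x) y)"
  by (rule bounded_linear.continuous_on [OF bounded_linear_cinner_left])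

lemma borel_measurable_cinner_left [measurable]: "(\<lambda>x. cinner x y) \<in> borel_measurable borel"
  by (intro borel_measurable_continuous_onI continuous_on_cinner_left continuous_on_id)

lemma continuous_on_vector_mult_left [continuous_intros]:
  fixes f :: "'a::topological_space \<Rightarrow> complex"
  shows "continuous_on S f \<Longrightarrow> continuous_on S g \<Longrightarrow> continuous_on S (\<lambda>x. f x *s (g x :: complex ^ 'n))"
  unfolding vector_scalar_mult_def by (intro continuous_intros)

lemma ball_in_sets_borel [measurable]: "ball (x :: 'a::metric_space) r \<in> sets borel"
  by (rule borel_open [OF open_ball])

text \<open>Moves a positive finite factor across an inequality between integrals that may be
  infinite. Multiplying by the inverse of \<open>c\<close> replaces division of extended
  reals.\<close>

lemma ennreal_mult_le_cancel:
  assumes "ennreal c * x \<le> ennreal d * y" and "0 < c" and "0 \<le> d"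
  shows "x \<le> ennreal (d / c) * y"
proof -
  have "x = ennreal (1 / c) * (ennreal c * x)"
    using assms(2) by (simp flip: mult.assoc ennreal_mult)
  also have "\<dots> \<le> ennreal (1 / c) * (ennreal d * y)"
    using assms(1) by (rule mult_left_mono) simp
  also have "\<dots> = ennreal (d / c) * y"
    using assms(2,3) by (simp flip: mult.assoc ennreal_mult)
  finally show ?thesis .
qed

section \<open>Affine and orthogonal changes of variables for Lebesgue measure\<close>

lemma nn_integral_lborel_translate:
  fixes F :: "'a::euclidean_space \<Rightarrow> ennreal"
  assumes [measurable]: "F \<in> borel_measurable borel"
  shows "(\<integral>\<^sup>+x. F (t + x) \<partial>lborel) = (\<integral>\<^sup>+x. F x \<partial>lborel)"
  by (subst (2) lborel_affine [of 1 t]) (simp_all add: nn_integral_density nn_integral_distr)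

lemma nn_integral_lborel_scale:
  fixes F :: "'a::euclidean_space \<Rightarrow> ennreal"
  assumes [measurable]: "F \<in> borel_measurable borel" and "c \<noteq> 0"
  shows "(\<integral>\<^sup>+x. F x \<partial>lborel) = ennreal (\<bar>c\<bar> ^ DIM('a)) * (\<integral>\<^sup>+x. F (c *\<^sub>R x) \<partial>lborel)"
  by (subst lborel_affine [OF \<open>c \<noteq> 0\<close>, of 0])
    (simp add: nn_integral_density nn_integral_distr nn_integral_cmult)

lemma nn_integral_lborel_reflect:
  fixes F :: "'a::euclidean_space \<Rightarrow> ennreal"
  assumes [measurable]: "F \<in> borel_measurable borel"
  shows "(\<integral>\<^sup>+x. F (t - x) \<partial>lborel) = (\<integral>\<^sup>+x. F x \<partial>lborel)"
  by (subst (2) lborel_affine [of "-1" t]) (simp_all add: nn_integral_density nn_integral_distr)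

lemma emeasure_ball_scale:
  assumes "0 < c"
  shows "emeasure lborel (ball (0::'a::euclidean_space) (c * r))
    = ennreal (c ^ DIM('a)) * emeasure lborel (ball (0::'a) r)"
proof -
  have "emeasure lborel (ball (0::'a) (c * r)) = (\<integral>\<^sup>+x. indicator (ball (0::'a) (c * r)) x \<partial>lborel)"
    by simp
  also have "\<dots> = ennreal (c ^ DIM('a)) * (\<integral>\<^sup>+x. indicator (ball (0::'a) (c * r)) (c *\<^sub>R x) \<partial>lborel)"
    using assms by (subst nn_integral_lborel_scale [of _ c]) (auto intro: borel_measurable_indicator)
  also have "(\<lambda>x. indicator (ball (0::'a) (c * r)) (c *\<^sub>R x)) = (indicator (ball (0::'a) r) :: _ \<Rightarrow> ennreal)"
    using assms by (auto simp: fun_eq_iff indicator_def)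
  finally show ?thesis by simp
qed

lemma emeasure_lborel_ball_finite: "emeasure lborel (ball (x::'a::euclidean_space) r) < \<infinity>"
  using emeasure_bounded_finite [OF bounded_ball] by blast

text \<open>Uniqueness of translation-invariant measures: the integrals of \<open>F(x) g(y)\<close> against the
  rotated and the original measure are exchanged by \<open>(x, y) \<mapsto> (x - y, x)\<close>, where \<open>g\<close> is the
  indicator of a ball, whose volume \<open>T\<close> does not change.\<close>

lemma nn_integral_lborel_orthogonal:
  fixes F :: "'a::euclidean_space \<Rightarrow> ennreal" and T :: "'a \<Rightarrow> 'a"
  assumes [measurable]: "F \<in> borel_measurable borel" and T: "orthogonal_transformation T"
  shows "(\<integral>\<^sup>+x. F (T x) \<partial>lborel) = (\<integral>\<^sup>+x. F x \<partial>lborel)"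
proof -
  have lin: "linear T" and norm_T: "\<And>x. norm (T x) = norm x"
    using T by (auto simp: orthogonal_transformation)
  have [measurable]: "T \<in> borel_measurable borel"
    by (intro borel_measurable_continuous_onI linear_continuous_on linear_conv_bounded_linear [THEN iffD1] lin)
  have surj: "surj T"
    using T by (rule orthogonal_transformation_surj)
  \<comment> \<open>Composition with \<open>T\<close> keeps translation invariance: a shift by
    \<open>t = T s\<close> after \<open>T\<close> is a shift by \<open>s\<close> before it.\<close>
  have T_inv: "(\<integral>\<^sup>+x. f (t + T x) \<partial>lborel) = (\<integral>\<^sup>+x. f (T x) \<partial>lborel)"
    if [measurable]: "f \<in> borel_measurable borel" for f :: "'a \<Rightarrow> ennreal" and t
  proof -
    obtain s where "t = T s" using surj by (metis surjD)
    then show ?thesis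
      using nn_integral_lborel_translate [of "\<lambda>x. f (T x)" s] by (simp add: linear_add [OF lin])
  qed
  define g :: "'a \<Rightarrow> ennreal" where "g = indicator (ball 0 1)"
  have [measurable]: "g \<in> borel_measurable borel"
    unfolding g_def by measurable
  define V where "V = emeasure lborel (ball (0::'a) 1)"
  have V: "V \<noteq> 0" "V \<noteq> \<infinity>"
    by (simp_all add: V_def emeasure_ball ennreal_eq_0_iff not_le)
  have g: "(\<integral>\<^sup>+x. g x \<partial>lborel) = V" "(\<integral>\<^sup>+x. g (T x) \<partial>lborel) = V"
    by (simp_all add: g_def V_def indicator_def norm_T flip: nn_integral_indicator)
  have "(\<integral>\<^sup>+x. F (T x) \<partial>lborel) * V = (\<integral>\<^sup>+x. \<integral>\<^sup>+y. F (T x) * g (T x + y) \<partial>lborel \<partial>lborel)"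
    by (simp add: nn_integral_cmult nn_integral_lborel_translate g nn_integral_multc)
  also have "\<dots> = (\<integral>\<^sup>+y. \<integral>\<^sup>+x. F (T x) * g (T x + y) \<partial>lborel \<partial>lborel)"
    by (rule lborel_pair.Fubini') measurable
  also have "\<dots> = (\<integral>\<^sup>+y. \<integral>\<^sup>+x. F (T x - y) * g (T x) \<partial>lborel \<partial>lborel)"
  proof (rule nn_integral_cong)
    fix y :: 'a
    show "(\<integral>\<^sup>+x. F (T x) * g (T x + y) \<partial>lborel) = (\<integral>\<^sup>+x. F (T x - y) * g (T x) \<partial>lborel)"
      using T_inv [of "\<lambda>x. F x * g (x + y)" "- y"] by simp
  qed
  also have "\<dots> = (\<integral>\<^sup>+x. \<integral>\<^sup>+y. F (T x - y) * g (T x) \<partial>lborel \<partial>lborel)"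
    by (rule lborel_pair.Fubini') measurable
  also have "\<dots> = (\<integral>\<^sup>+x. F x \<partial>lborel) * V"
    by (simp add: nn_integral_multc nn_integral_lborel_reflect g nn_integral_cmult)
  \<comment> \<open>The volume \<open>V\<close> of the unit ball is positive and finite, so it
    cancels.\<close>
  finally show ?thesis
    using V by (simp add: mult.commute [of _ V] ennreal_mult_cancel_left)
qed

text \<open>Complex rotations are real orthogonal maps. They are the rotations along which circular
  means are taken.\<close>

lemma nn_integral_lborel_unimodular:
  fixes F :: "complex ^ 'n::finite \<Rightarrow> ennreal"
  assumes "F \<in> borel_measurable borel" and "cmod c = 1"
  shows "(\<integral>\<^sup>+x. F (c *s x) \<partial>lborel) = (\<integral>\<^sup>+x. F x \<partial>lborel)"
proof (rule nn_integral_lborel_orthogonal [OF assms(1)])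
  have "linear (\<lambda>x. c *s (x :: complex ^ 'n))"
    by (rule linearI) (simp_all add: vec_eq_iff algebra_simps)
  then show "orthogonal_transformation (\<lambda>x. c *s (x :: complex ^ 'n))"
    using assms(2) by (simp add: orthogonal_transformation norm_vector_mult)
qed

section \<open>Volumes of anisotropic neighbourhoods\<close>

text \<open>With \<open>a\<close> of order \<open>d\<close> and \<open>b\<close> of order
  \<open>sqrt d\<close>, this is the shape adapted to the ball near its boundary: a point at
  distance \<open>d\<close> from the sphere may move by about \<open>d\<close> in its complex radial
  direction \<open>e\<close>, but by about \<open>sqrt d\<close> in the complex tangential
  directions.\<close>

definition slab :: "complex ^ 'n::finite \<Rightarrow> real \<Rightarrow> real \<Rightarrow> (complex ^ 'n) set" where
  "slab e a b = {u. cmod (cinner u e) < a \<and> norm u < b}"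

lemma open_slab: "open (slab e a b)"
  unfolding slab_def by (intro open_Collect_conj open_Collect_less continuous_intros)

lemma slab_measurable [measurable]: "slab e a b \<in> sets borel"
  by (rule borel_open [OF open_slab])

text \<open>The volume of \<open>slab e a b\<close> has the order of magnitude \<open>a\<^sup>2 b\<^bsup>2N-2\<^esup>\<close>: integrate
  the volume of its translates by \<open>k e\<close> over all complex \<open>k\<close> with \<open>|k| < b\<close>.\<close>

lemma slab_translates:
  fixes e :: "complex ^ 'n::finite"
  assumes "0 < b"
  shows "ennreal (pi * b\<^sup>2) * emeasure lborel (slab e a b)
    = (\<integral>\<^sup>+u. emeasure lborel {k \<in> ball 0 b. u - k *s e \<in> slab e a b} \<partial>lborel)"
proof -
  have [measurable]: "(\<lambda>x. fst x - snd x *s e) \<in> borel_measurable (borel \<Otimes>\<^sub>M borel)"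
    "(\<lambda>x. snd x - fst x *s e) \<in> borel_measurable (borel \<Otimes>\<^sub>M borel)"
    unfolding borel_prod by (intro borel_measurable_continuous_onI continuous_intros)+
  have [measurable]: "(\<lambda>k. u - k *s e) \<in> borel_measurable borel" for u
    by (intro borel_measurable_continuous_onI continuous_intros)
  have area: "emeasure lborel (ball (0::complex) b) = ennreal (pi * b\<^sup>2)"
    using assms by (simp add: emeasure_ball unit_ball_vol_2)
  have "ennreal (pi * b\<^sup>2) * emeasure lborel (slab e a b)
    = (\<integral>\<^sup>+k. indicator (ball 0 b) (k::complex) * emeasure lborel (slab e a b) \<partial>lborel)"
    by (subst nn_integral_multc) (simp_all add: area borel_measurable_indicator)
  also have "\<dots> = (\<integral>\<^sup>+k. \<integral>\<^sup>+u. indicator (ball 0 b) k * indicator (slab e a b) (u - k *s e) \<partial>lborel \<partial>lborel)"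
  proof (rule nn_integral_cong)
    fix k :: complex
    have "(\<integral>\<^sup>+u. indicator (slab e a b) (u - k *s e) \<partial>lborel) = emeasure lborel (slab e a b)"
      using nn_integral_lborel_translate [of "indicator (slab e a b)" "- (k *s e)"] by simp
    then show "indicator (ball 0 b) k * emeasure lborel (slab e a b)
      = (\<integral>\<^sup>+u. indicator (ball 0 b) k * indicator (slab e a b) (u - k *s e) \<partial>lborel)"
      by (simp add: nn_integral_cmult)
  qed
  also have "\<dots> = (\<integral>\<^sup>+u. \<integral>\<^sup>+k. indicator (ball 0 b) k * indicator (slab e a b) (u - k *s e) \<partial>lborel \<partial>lborel)"
    by (rule lborel_pair.Fubini') (simp add: case_prod_unfold)
  also have "\<dots> = (\<integral>\<^sup>+u. emeasure lborel {k \<in> ball 0 b. u - k *s e \<in> slab e a b} \<partial>lborel)"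
  proof (rule nn_integral_cong)
    fix u
    have "{k \<in> ball 0 b. u - k *s e \<in> slab e a b} \<in> sets lborel"
      unfolding sets_lborel by measurable
    moreover have "(\<lambda>k. indicator (ball 0 b) k * indicator (slab e a b) (u - k *s e) :: ennreal)
      = indicator {k \<in> ball 0 b. u - k *s e \<in> slab e a b}"
      by (auto simp: fun_eq_iff indicator_def)
    ultimately show "(\<integral>\<^sup>+k. indicator (ball 0 b) k * indicator (slab e a b) (u - k *s e) \<partial>lborel)
      = emeasure lborel {k \<in> ball 0 b. u - k *s e \<in> slab e a b}"
      by (simp only: nn_integral_indicator)
  qed
  finally show ?thesis .
qed

text \<open>If \<open>u - k *s e\<close> lies in the slab, then \<open>k\<close> lies in the disc of
  radius \<open>a\<close> about \<open>cinner u e\<close>, and \<open>norm u < 2 * b\<close>. So the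
  integrand of \<open>slab_translates\<close> is at most the area of that disc, on a ball of radius
  \<open>2 * b\<close> in real dimension 2N.\<close>

lemma emeasure_slab_le:
  fixes e :: "complex ^ 'n::finite"
  assumes "norm e = 1" and "0 < a" and "0 < b"
  shows "emeasure lborel (slab e a b)
    \<le> ennreal (a\<^sup>2 / b\<^sup>2 * (2 * b) ^ (2 * CARD('n))) * emeasure lborel (ball (0 :: complex ^ 'n) 1)"
proof -
  let ?V = "emeasure lborel (ball (0 :: complex ^ 'n) 1)"
  have "emeasure lborel {k \<in> ball 0 b. u - k *s e \<in> slab e a b}
    \<le> ennreal (pi * a\<^sup>2) * indicator (ball 0 (2 * b)) u" for u :: "complex ^ 'n"
  proof -
    have sub: "{k \<in> ball 0 b. u - k *s e \<in> slab e a b} \<subseteq> (if norm u < 2 * b then ball (cinner u e) a else {})"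
    proof (clarify)
      fix k :: complex
      assume k: "k \<in> ball 0 b" "u - k *s e \<in> slab e a b"
      have "cinner (u - k *s e) e = cinner u e - k"
        using assms(1) by (simp add: cinner_diff_left cinner_vector_mult_left cinner_self)
      moreover have "norm u \<le> norm (u - k *s e) + norm (k *s e)"
        using norm_triangle_ineq [of "u - k *s e" "k *s e"] by simp
      ultimately show "k \<in> (if norm u < 2 * b then ball (cinner u e) a else {})"
        using k assms(1) by (auto simp: slab_def dist_norm norm_vector_mult)
    qed
    have "emeasure lborel {k \<in> ball 0 b. u - k *s e \<in> slab e a b}
      \<le> emeasure lborel (if norm u < 2 * b then ball (cinner u e) a else {})"
      by (rule emeasure_mono [OF sub]) auto
    also have "\<dots> = ennreal (pi * a\<^sup>2) * indicator (ball 0 (2 * b)) u"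
      using assms by (auto simp: emeasure_ball unit_ball_vol_2)
    finally show ?thesis .
  qed
  then have "ennreal (pi * b\<^sup>2) * emeasure lborel (slab e a b)
    \<le> (\<integral>\<^sup>+u. ennreal (pi * a\<^sup>2) * indicator (ball 0 (2 * b)) (u :: complex ^ 'n) \<partial>lborel)"
    unfolding slab_translates [OF assms(3)] by (intro nn_integral_mono)
  also have "\<dots> = ennreal (pi * a\<^sup>2) * (ennreal ((2 * b) ^ (2 * CARD('n))) * ?V)"
    using emeasure_ball_scale [of "2 * b" 1, where 'a = "complex ^ 'n"] assms
    by (simp add: nn_integral_cmult mult.commute)
  also have "\<dots> = ennreal (pi * a\<^sup>2 * (2 * b) ^ (2 * CARD('n))) * ?V"
    using assms by (subst ennreal_mult) (simp_all add: mult.assoc)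
  finally have "emeasure lborel (slab e a b)
    \<le> ennreal (pi * a\<^sup>2 * (2 * b) ^ (2 * CARD('n)) / (pi * b\<^sup>2)) * ?V"
    by (rule ennreal_mult_le_cancel) (use assms in simp_all)
  then show ?thesis
    by simp
qed

text \<open>Conversely, for \<open>norm u < b / 4\<close> every \<open>k\<close> in the disc of
  radius \<open>a\<close> about \<open>cinner u e\<close> qualifies. With
  \<open>a \<le> b / 4\<close> such a \<open>k\<close> has modulus below \<open>b / 2\<close>, so
  \<open>u - k *s e\<close> still has norm below \<open>b\<close>.\<close>

lemma emeasure_slab_ge:
  fixes e :: "complex ^ 'n::finite"
  assumes "norm e = 1" and "0 < a" and "a \<le> b / 4"
  shows "ennreal (a\<^sup>2 / b\<^sup>2 * (b / 4) ^ (2 * CARD('n))) * emeasure lborel (ball (0 :: complex ^ 'n) 1)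
    \<le> emeasure lborel (slab e a b)"
proof -
  let ?V = "emeasure lborel (ball (0 :: complex ^ 'n) 1)"
  have "0 < b"
    using assms by simp
  have "ennreal (pi * a\<^sup>2) * indicator (ball 0 (b / 4)) u
    \<le> emeasure lborel {k \<in> ball 0 b. u - k *s e \<in> slab e a b}" for u :: "complex ^ 'n"
  proof (cases "norm u < b / 4")
    case True
    have sub: "ball (cinner u e) a \<subseteq> {k \<in> ball 0 b. u - k *s e \<in> slab e a b}"
    proof
      fix k assume "k \<in> ball (cinner u e) a"
      then have k: "cmod (cinner u e - k) < a"
        by (simp add: dist_norm)
      have "cmod (cinner u e) < b / 4"
        using norm_cinner_le [of u e] True assms(1) by simp
      then have "cmod k < b / 2"
        using k assms(3) norm_triangle_ineq2 [of k "cinner u e"] by (simp add: norm_minus_commute)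
      moreover have "norm (u - k *s e) \<le> norm u + cmod k"
        using norm_triangle_ineq4 [of u "k *s e"] assms(1) by (simp add: norm_vector_mult)
      moreover have "cinner (u - k *s e) e = cinner u e - k"
        using assms(1) by (simp add: cinner_diff_left cinner_vector_mult_left cinner_self)
      ultimately show "k \<in> {k \<in> ball 0 b. u - k *s e \<in> slab e a b}"
        using k True \<open>0 < b\<close> by (auto simp: slab_def)
    qed
    have [measurable]: "(\<lambda>k. u - k *s e) \<in> borel_measurable borel"
      by (intro borel_measurable_continuous_onI continuous_intros)
    have "{k \<in> ball 0 b. u - k *s e \<in> slab e a b} \<in> sets lborel"
      unfolding sets_lborel by measurable
    from emeasure_mono [OF sub this] show ?thesis
      using True assms(2) by (simp add: emeasure_ball unit_ball_vol_2)
  qed simp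
  then have "(\<integral>\<^sup>+u. ennreal (pi * a\<^sup>2) * indicator (ball 0 (b / 4)) (u :: complex ^ 'n) \<partial>lborel)
    \<le> ennreal (pi * b\<^sup>2) * emeasure lborel (slab e a b)"
    unfolding slab_translates [OF \<open>0 < b\<close>] by (intro nn_integral_mono)
  moreover have "(\<integral>\<^sup>+u. ennreal (pi * a\<^sup>2) * indicator (ball 0 (b / 4)) (u :: complex ^ 'n) \<partial>lborel)
      = ennreal (pi * a\<^sup>2) * (ennreal ((b / 4) ^ (2 * CARD('n))) * ?V)"
    using emeasure_ball_scale [of "b / 4" 1, where 'a = "complex ^ 'n"] \<open>0 < b\<close>
    by (simp add: nn_integral_cmult mult.commute)
  ultimately have "ennreal (pi * a\<^sup>2) * (ennreal ((b / 4) ^ (2 * CARD('n))) * ?V)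
    \<le> ennreal (pi * b\<^sup>2) * emeasure lborel (slab e a b)"
    by simp
  then have "ennreal ((b / 4) ^ (2 * CARD('n))) * ?V
    \<le> ennreal (pi * b\<^sup>2 / (pi * a\<^sup>2)) * emeasure lborel (slab e a b)"
    by (rule ennreal_mult_le_cancel) (use assms in simp_all)
  then have "ennreal (a\<^sup>2 / b\<^sup>2) * (ennreal ((b / 4) ^ (2 * CARD('n))) * ?V)
    \<le> ennreal (a\<^sup>2 / b\<^sup>2) * (ennreal (b\<^sup>2 / a\<^sup>2) * emeasure lborel (slab e a b))"
    by (intro mult_left_mono) simp_all
  also have "\<dots> = emeasure lborel (slab e a b)"
    using assms(2) \<open>0 < b\<close> by (simp flip: mult.assoc ennreal_mult)
  also have "ennreal (a\<^sup>2 / b\<^sup>2) * (ennreal ((b / 4) ^ (2 * CARD('n))) * ?V)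
    = ennreal (a\<^sup>2 / b\<^sup>2 * (b / 4) ^ (2 * CARD('n))) * ?V"
    using \<open>0 < b\<close> by (subst ennreal_mult) (simp_all add: mult.assoc)
  finally show ?thesis .
qed

section \<open>Polar coordinates\<close>

text \<open>The antiderivative - (r / t) ^ D rises from -1 at \<open>t = r\<close> to 0 at infinity.
  This is the integral over the scaling parameter that remains at the end of the polar coordinate
  computation.\<close>

lemma nn_integral_power_tail:
  fixes r :: real and D :: nat
  assumes "0 < r" "0 < D"
  shows "(\<integral>\<^sup>+t. indicator {r<..} t * ennreal (real D * r ^ D / t ^ Suc D) \<partial>lborel) = 1"
proof -
  have lim: "((\<lambda>t. (-1) * (r / t) ^ D) \<longlongrightarrow> (-1) * 0 ^ D) at_top"
    by (intro tendsto_intros filterlim_ident tendsto_divide_0 [OF tendsto_const]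
        filterlim_at_top_imp_at_infinity)
  have deriv: "((\<lambda>t. (-1) * (r / t) ^ D) has_real_derivative real D * r ^ D / t ^ Suc D) (at t)"
    if "r \<le> t" for t
  proof -
    have "0 < t" using that assms by simp
    then have "((\<lambda>t. r / t) has_real_derivative - r / t\<^sup>2) (at t)"
      by (auto intro!: derivative_eq_intros simp: power2_eq_square)
    from DERIV_cmult [OF DERIV_power [OF this, of D], of "-1"] show ?thesis
    proof (rule DERIV_cong)
      obtain k where "D = Suc k" using assms by (metis gr0_conv_Suc)
      then show "(-1) * (real D * (- r / t\<^sup>2 * (r / t) ^ (D - Suc 0))) = real D * r ^ D / t ^ Suc D"
        using \<open>0 < t\<close> by (simp add: power_divide power2_eq_square)
    qed
  qed
  have "(\<integral>\<^sup>+t. indicator {r<..} t * ennreal (real D * r ^ D / t ^ Suc D) \<partial>lborel)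
    = (\<integral>\<^sup>+t. ennreal (real D * r ^ D / t ^ Suc D) * indicator {r..} t \<partial>lborel)"
    using AE_lborel_singleton [of r]
    by (intro nn_integral_cong_AE, eventually_elim) (auto simp: indicator_def)
  also have "\<dots> = ennreal ((-1) * 0 ^ D - (-1) * (r / r) ^ D)"
    by (rule nn_integral_FTC_atLeast [OF _ deriv _ lim]) (use assms in auto)
  also have "\<dots> = 1"
    using assms by (simp add: power_0_left)
  finally show ?thesis .
qed

text \<open>Substitute \<open>\<rho> = t |z|\<close> and then \<open>y = t z\<close>.\<close>

lemma nn_integral_lborel_polar:
  fixes F :: "'a::euclidean_space \<Rightarrow> ennreal"
  assumes [measurable]: "F \<in> borel_measurable borel"
  defines "D \<equiv> DIM('a)"
  shows "(\<integral>\<^sup>+\<rho>. indicator {0<..<1} \<rho> * ennreal (real D * \<rho> ^ (D - 1)) *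
      (\<integral>\<^sup>+z. F (\<rho> *\<^sub>R (z /\<^sub>R norm z)) * indicator (ball 0 1) z \<partial>lborel) \<partial>lborel)
    = (\<integral>\<^sup>+z. F z * indicator (ball 0 1) z \<partial>lborel)"
proof -
  have "0 < D" by (simp add: D_def)
  then have Dpow: "x * x ^ (D - 1) = x ^ D" for x :: real
    by (metis Suc_diff_1 power_Suc)
  define B where "B = ball (0::'a) 1"
  have [measurable]: "B \<in> sets borel" by (simp add: B_def)
  \<comment> \<open>The integrand after \<rho> = t |z|: one of the D factors \<open>norm z\<close>
    comes from the change of variable, the other D - 1 from the radial density. The truncation
    \<rho> < 1 has become the condition that \<open>t *\<^sub>R z\<close> lies in the ball.\<close>
  define g where "g t z = indicator {0<..} t * indicator B (t *\<^sub>R z) * indicator B z *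
      (ennreal (real D * norm z ^ D * t ^ (D - 1)) * F (t *\<^sub>R z))" for t :: real and z :: 'a
  have [measurable]: "case_prod g \<in> borel_measurable (borel \<Otimes>\<^sub>M borel)"
    unfolding g_def case_prod_unfold by measurable
  have [measurable]: "(\<lambda>(z, t). g t z) \<in> borel_measurable (borel \<Otimes>\<^sub>M borel)"
    unfolding g_def case_prod_unfold by measurable
  have "(\<integral>\<^sup>+\<rho>. indicator {0<..<1} \<rho> * ennreal (real D * \<rho> ^ (D - 1)) *
      (\<integral>\<^sup>+z. F (\<rho> *\<^sub>R (z /\<^sub>R norm z)) * indicator B z \<partial>lborel) \<partial>lborel)
    = (\<integral>\<^sup>+\<rho>. \<integral>\<^sup>+z. indicator {0<..<1} \<rho> * ennreal (real D * \<rho> ^ (D - 1)) *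
      (F (\<rho> *\<^sub>R (z /\<^sub>R norm z)) * indicator B z) \<partial>lborel \<partial>lborel)"
    by (simp add: nn_integral_cmult)
  also have "\<dots> = (\<integral>\<^sup>+z. \<integral>\<^sup>+\<rho>. indicator {0<..<1} \<rho> * ennreal (real D * \<rho> ^ (D - 1)) *
      (F (\<rho> *\<^sub>R (z /\<^sub>R norm z)) * indicator B z) \<partial>lborel \<partial>lborel)"
    by (rule lborel_pair.Fubini') (simp add: case_prod_unfold)
  also have "\<dots> = (\<integral>\<^sup>+z. \<integral>\<^sup>+t. g t z \<partial>lborel \<partial>lborel)"
  proof (intro nn_integral_cong_AE)
    show "AE z in lborel. (\<integral>\<^sup>+\<rho>. indicator {0<..<1} \<rho> * ennreal (real D * \<rho> ^ (D - 1)) *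
      (F (\<rho> *\<^sub>R (z /\<^sub>R norm z)) * indicator B z) \<partial>lborel) = (\<integral>\<^sup>+t. g t z \<partial>lborel)"
      using AE_lborel_singleton [of "0::'a"]
    proof eventually_elim
      fix z :: 'a assume "z \<noteq> 0"
      have "(\<integral>\<^sup>+\<rho>. indicator {0<..<1} \<rho> * ennreal (real D * \<rho> ^ (D - 1)) *
          (F (\<rho> *\<^sub>R (z /\<^sub>R norm z)) * indicator B z) \<partial>lborel)
        = ennreal (norm z) * (\<integral>\<^sup>+t. indicator {0<..<1} (norm z * t) * ennreal (real D * (norm z * t) ^ (D - 1)) *
          (F ((norm z * t) *\<^sub>R (z /\<^sub>R norm z)) * indicator B z) \<partial>lborel)"
        using \<open>z \<noteq> 0\<close> by (subst nn_integral_real_affine [where c = "norm z" and t = 0]) simp_all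
      also have "\<dots> = (\<integral>\<^sup>+t. ennreal (norm z) * (indicator {0<..<1} (norm z * t) * ennreal (real D * (norm z * t) ^ (D - 1)) *
          (F ((norm z * t) *\<^sub>R (z /\<^sub>R norm z)) * indicator B z)) \<partial>lborel)"
        by (rule nn_integral_cmult [symmetric]) simp
      also have "\<dots> = (\<integral>\<^sup>+t. g t z \<partial>lborel)"
      proof (rule nn_integral_cong)
        fix t :: real
        have "ennreal (norm z) * ennreal (real D * (norm z * t) ^ (D - 1))
          = ennreal (real D * norm z ^ D * t ^ (D - 1))" if "0 < t"
        proof -
          have "norm z * (real D * (norm z * t) ^ (D - 1)) = real D * norm z ^ D * t ^ (D - 1)"
            unfolding Dpow [symmetric] by (simp add: power_mult_distrib)
          then show ?thesis
            using that by (simp flip: ennreal_mult)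
        qed
        then have eq: "ennreal (norm z) * (ennreal (real D * (norm z * t) ^ (D - 1)) * y)
          = ennreal (real D * norm z ^ D * t ^ (D - 1)) * y" if "0 < t" for y
          using that by (simp only: mult.assoc [symmetric])
        have scale: "(norm z * t) *\<^sub>R (z /\<^sub>R norm z) = t *\<^sub>R z"
          using \<open>z \<noteq> 0\<close> by simp
        show "ennreal (norm z) * (indicator {0<..<1} (norm z * t) * ennreal (real D * (norm z * t) ^ (D - 1)) *
          (F ((norm z * t) *\<^sub>R (z /\<^sub>R norm z)) * indicator B z)) = g t z"
          unfolding scale using \<open>z \<noteq> 0\<close>
          by (cases "0 < t"; cases "norm z * t < 1")
            (simp_all add: g_def B_def eq indicator_def zero_less_mult_iff mult.commute [of t] del: One_nat_def)
      qed
      finally show "(\<integral>\<^sup>+\<rho>. indicator {0<..<1} \<rho> * ennreal (real D * \<rho> ^ (D - 1)) *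
          (F (\<rho> *\<^sub>R (z /\<^sub>R norm z)) * indicator B z) \<partial>lborel) = (\<integral>\<^sup>+t. g t z \<partial>lborel)" .
    qed
  qed
  also have "\<dots> = (\<integral>\<^sup>+t. \<integral>\<^sup>+z. g t z \<partial>lborel \<partial>lborel)"
    by (rule lborel_pair.Fubini') measurable
  also have "\<dots> = (\<integral>\<^sup>+t. \<integral>\<^sup>+y. F y * indicator B y *
      (indicator {norm y<..} t * ennreal (real D * norm y ^ D / t ^ Suc D)) \<partial>lborel \<partial>lborel)"
  proof (rule nn_integral_cong)
    fix t :: real
    show "(\<integral>\<^sup>+z. g t z \<partial>lborel) = (\<integral>\<^sup>+y. F y * indicator B y *
      (indicator {norm y<..} t * ennreal (real D * norm y ^ D / t ^ Suc D)) \<partial>lborel)"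
    proof (cases "0 < t")
      case True
      \<comment> \<open>With y = t z, the Jacobian and \<open>norm z ^ D\<close> each contribute t ^
        (-D), which leaves the power t ^ (-D - 1). The condition that z lies in the ball turns into
        \<open>norm y < t\<close>.\<close>
      have "(\<integral>\<^sup>+z. g t z \<partial>lborel) = (\<integral>\<^sup>+y. ennreal (\<bar>1 / t\<bar> ^ D) * g t ((1 / t) *\<^sub>R y) \<partial>lborel)"
        using True unfolding D_def
        by (subst nn_integral_lborel_scale [of _ "1 / t"]) (simp_all add: nn_integral_cmult)
      also have "\<dots> = (\<integral>\<^sup>+y. F y * indicator B y *
        (indicator {norm y<..} t * ennreal (real D * norm y ^ D / t ^ Suc D)) \<partial>lborel)"
      proof (rule nn_integral_cong)
        fix y :: 'a
        have "(1 / t) ^ D * (real D * (norm y / t) ^ D * t ^ (D - 1)) = real D * norm y ^ D / t ^ Suc D"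
          using True \<open>0 < D\<close> by (simp add: field_simps Dpow [symmetric])
        then have "ennreal (\<bar>1 / t\<bar> ^ D) * ennreal (real D * (norm y / t) ^ D * t ^ (D - 1))
          = ennreal (real D * norm y ^ D / t ^ Suc D)"
          using True by (simp flip: ennreal_mult)
        then have eq: "ennreal (\<bar>1 / t\<bar> ^ D) * (ennreal (real D * (norm y / t) ^ D * t ^ (D - 1)) * x)
          = x * ennreal (real D * norm y ^ D / t ^ Suc D)" for x
          by (simp only: mult.assoc [symmetric] mult.commute [of x])
        show "ennreal (\<bar>1 / t\<bar> ^ D) * g t ((1 / t) *\<^sub>R y) = F y * indicator B y *
          (indicator {norm y<..} t * ennreal (real D * norm y ^ D / t ^ Suc D))"
          using True eq [of "F y"]
          by (cases "norm y < 1"; cases "norm y < t") (simp_all add: g_def B_def indicator_def)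
      qed
      finally show ?thesis .
    next
      case False
      then have "g t z = 0" for z by (simp add: g_def)
      moreover have "indicator {norm y<..} t = (0::ennreal)" for y :: 'a
        using False norm_ge_zero [of y] by (auto simp: indicator_def simp del: norm_ge_zero)
      ultimately show ?thesis by simp
    qed
  qed
  also have "\<dots> = (\<integral>\<^sup>+y. \<integral>\<^sup>+t. F y * indicator B y *
      (indicator {norm y<..} t * ennreal (real D * norm y ^ D / t ^ Suc D)) \<partial>lborel \<partial>lborel)"
    unfolding greaterThan_def by (rule lborel_pair.Fubini') (simp add: case_prod_unfold)
  \<comment> \<open>For each nonzero \<open>y\<close> the integral over \<open>t\<close> is
    1.\<close>
  also have "\<dots> = (\<integral>\<^sup>+y. F y * indicator B y \<partial>lborel)"
  proof (intro nn_integral_cong_AE)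
    show "AE y in lborel. (\<integral>\<^sup>+t. F y * indicator B y *
      (indicator {norm y<..} t * ennreal (real D * norm y ^ D / t ^ Suc D)) \<partial>lborel) = F y * indicator B y"
      using AE_lborel_singleton [of "0::'a"]
    proof eventually_elim
      fix y :: 'a assume "y \<noteq> 0"
      then show "(\<integral>\<^sup>+t. F y * indicator B y *
        (indicator {norm y<..} t * ennreal (real D * norm y ^ D / t ^ Suc D)) \<partial>lborel) = F y * indicator B y"
        using nn_integral_power_tail [of "norm y" D] \<open>0 < D\<close> by (subst nn_integral_cmult) simp_all
    qed
  qed
  finally show ?thesis
    unfolding B_def .
qed

section \<open>Normalized volume on the ball and surface measure on the sphere\<close>

lemma emeasure_unit_ball:
  "emeasure lborel (ball (0::'a::euclidean_space) 1) \<noteq> 0"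
  "emeasure lborel (ball (0::'a::euclidean_space) 1) \<noteq> \<infinity>"
  by (simp_all add: emeasure_ball ennreal_eq_0_iff not_le)

lemma sphere_in_sets_borel [measurable]: "sphere (x :: 'a::euclidean_space) r \<in> sets borel"
  by (rule borel_closed [OF closed_sphere])

lemma sets_ball_measure [measurable_cong, simp]: "sets ball_measure = sets borel"
  by (simp add: ball_measure_def)

lemma sets_sphere_measure [measurable_cong, simp]: "sets sphere_measure = sets borel"
  by (simp add: sphere_measure_def)

lemma space_ball_measure [simp]: "space ball_measure = UNIV"
  by (simp add: ball_measure_def)

lemma nn_integral_ball_measure:
  fixes F :: "complex ^ 'n::finite \<Rightarrow> ennreal"
  assumes "F \<in> borel_measurable borel"
  shows "(\<integral>\<^sup>+z. F z \<partial>ball_measure)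
    = (\<integral>\<^sup>+z. F z * indicator unit_ball z \<partial>lborel) / emeasure lborel (unit_ball :: (complex ^ 'n) set)"
  using assms by (simp add: ball_measure_def nn_integral_uniform_measure)

lemma emeasure_ball_measure_le_1: "emeasure ball_measure (A :: (complex ^ 'n::finite) set) \<le> 1"
proof -
  have "emeasure ball_measure A \<le> emeasure ball_measure (space (ball_measure :: (complex ^ 'n) measure))"
    by (rule emeasure_space)
  also have "\<dots> = 1"
    unfolding ball_measure_def using emeasure_lborel_ball_finite [of "0 :: complex ^ 'n" 1]
    by (simp add: emeasure_unit_ball)
  finally show ?thesis .
qed

text \<open>The origin is removed because the radial projection sends it to itself, off the sphere.
  On the other points it has values in the sphere, which gives
  \<open>AE_sphere_measure\<close>.\<close>

lemma AE_ball_measure: "AE z :: complex ^ 'n::finite in ball_measure. z \<in> unit_ball - {0}"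
proof -
  have "AE z :: complex ^ 'n in lborel. z \<in> unit_ball \<longrightarrow> z \<in> unit_ball - {0}"
    using AE_lborel_singleton [of 0] by eventually_elim simp
  then show ?thesis
    unfolding ball_measure_def
    using emeasure_lborel_ball_finite [of "0 :: complex ^ 'n" 1]
    by (subst AE_uniform_measure) (auto simp: emeasure_unit_ball elim: eventually_mono)
qed

lemma nn_integral_sphere_measure:
  assumes "F \<in> borel_measurable borel"
  shows "(\<integral>\<^sup>+\<zeta>. F \<zeta> \<partial>sphere_measure) = (\<integral>\<^sup>+z. F (z /\<^sub>R norm z) \<partial>ball_measure)"
  unfolding sphere_measure_def using assms by (subst nn_integral_distr) simp_all

lemma emeasure_sphere_measure_le_1: "emeasure sphere_measure (A :: (complex ^ 'n::finite) set) \<le> 1"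
proof -
  have "emeasure sphere_measure A \<le> emeasure sphere_measure (space (sphere_measure :: (complex ^ 'n) measure))"
    by (rule emeasure_space)
  also have "\<dots> \<le> 1"
    unfolding sphere_measure_def by (simp add: emeasure_distr emeasure_ball_measure_le_1)
  finally show ?thesis .
qed

lemma AE_sphere_measure: "AE \<zeta> in sphere_measure. \<zeta> \<in> unit_sphere"
  unfolding sphere_measure_def
  by (subst AE_distr_iff) (use AE_ball_measure in \<open>auto elim!: eventually_mono\<close>)

text \<open>This is the polar formula for Lebesgue measure divided by the volume of the ball. The
  directions \<open>z /\<^sub>R norm z\<close>, averaged over the ball, are distributed by
  \<open>sphere_measure\<close>.\<close>

lemma nn_integral_ball_measure_polar:
  fixes F :: "complex ^ 'n::finite \<Rightarrow> ennreal"
  assumes [measurable]: "F \<in> borel_measurable borel"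
  shows "(\<integral>\<^sup>+z. F z \<partial>ball_measure)
    = (\<integral>\<^sup>+\<rho>. indicator {0<..<1} \<rho> * ennreal (real (2 * CARD('n)) * \<rho> ^ (2 * CARD('n) - 1)) *
        (\<integral>\<^sup>+\<zeta>. F (\<rho> *\<^sub>R \<zeta>) \<partial>sphere_measure) \<partial>lborel)"
proof -
  have "DIM(complex ^ 'n) = 2 * CARD('n)" by simp
  note polar = nn_integral_lborel_polar [OF assms, unfolded this]
  let ?V = "emeasure lborel (unit_ball :: (complex ^ 'n) set)"
  have "(\<integral>\<^sup>+z. F z \<partial>ball_measure) = (\<integral>\<^sup>+\<rho>. indicator {0<..<1} \<rho> *
      ennreal (real (2 * CARD('n)) * \<rho> ^ (2 * CARD('n) - 1)) *
      (\<integral>\<^sup>+z. F (\<rho> *\<^sub>R (z /\<^sub>R norm z)) * indicator (ball 0 1) z \<partial>lborel) \<partial>lborel) / ?V"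
    unfolding polar by (rule nn_integral_ball_measure [OF assms])
  also have "\<dots> = (\<integral>\<^sup>+\<rho>. indicator {0<..<1} \<rho> *
      ennreal (real (2 * CARD('n)) * \<rho> ^ (2 * CARD('n) - 1)) *
      (\<integral>\<^sup>+z. F (\<rho> *\<^sub>R (z /\<^sub>R norm z)) * indicator (ball 0 1) z \<partial>lborel) / ?V \<partial>lborel)"
    by (subst nn_integral_divide) simp_all
  also have "\<dots> = (\<integral>\<^sup>+\<rho>. indicator {0<..<1} \<rho> * ennreal (real (2 * CARD('n)) * \<rho> ^ (2 * CARD('n) - 1)) *
        (\<integral>\<^sup>+\<zeta>. F (\<rho> *\<^sub>R \<zeta>) \<partial>sphere_measure) \<partial>lborel)"
    by (subst nn_integral_sphere_measure)
      (simp_all add: nn_integral_ball_measure ennreal_times_divide)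
  finally show ?thesis .
qed

section \<open>A sub-mean value property on anisotropic neighbourhoods\<close>

text \<open>Cauchy's formula at the centre of the unit circle, with the modulus taken inside. The
  form as a nonnegative integral allows a later exchange with an integral in another
  variable.\<close>

lemma circle_mean_value_bound:
  assumes "f holomorphic_on cball 0 1"
  shows "ennreal (2 * pi * cmod (f 0)) \<le> (\<integral>\<^sup>+t. indicator {0..2 * pi} t * ennreal (cmod (f (cis t))) \<partial>lborel)"
proof -
  have cont: "continuous_on UNIV (\<lambda>t. f (cis t))"
    by (rule continuous_on_compose2 [OF holomorphic_on_imp_continuous_on [OF assms]])
      (auto intro!: continuous_intros)
  have "((\<lambda>u. f u / (u - 0)) has_contour_integral (2 * of_real pi * \<i> * f 0)) (circlepath 0 1)"
    by (rule Cauchy_integral_circlepath_simple [OF assms]) simp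
  then have "((\<lambda>t. f (cis t) * \<i>) has_integral (2 * of_real pi * \<i> * f 0)) {0..2 * pi}"
    unfolding circlepath_def by (subst (asm) has_contour_integral_part_circlepath_iff) (simp_all add: mult_ac)
  \<comment> \<open>On the circle du / u = i dt; multiplication by -i removes this factor.\<close>
  from has_integral_mult_left [OF this, of "- \<i>"]
  have int: "((\<lambda>t. f (cis t)) has_integral (2 * of_real pi * f 0)) {0..2 * pi}"
    by (simp add: mult_ac)
  have "(\<lambda>t. cmod (f (cis t))) integrable_on {0..2 * pi}"
    by (intro integrable_continuous_interval continuous_intros continuous_on_subset [OF cont]) simp
  then obtain I where I: "((\<lambda>t. cmod (f (cis t))) has_integral I) {0..2 * pi}"
    by blast
  have "cmod (2 * of_real pi * f 0) \<le> I"
    using int I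
    by (metis (no_types, lifting) has_integral_iff integral_norm_bound_integral order_refl)
  then have "ennreal (2 * pi * cmod (f 0)) \<le> ennreal I"
    by (intro ennreal_leI) (simp add: norm_mult)
  also have "ennreal I = (\<integral>\<^sup>+t. indicator {0..2 * pi} t * ennreal (cmod (f (cis t))) \<partial>lborel)"
    using nn_integral_has_integral_lebesgue' [OF _ I] by (simp add: mult.commute)
  finally show ?thesis .
qed

lemma several_holomorphic_imp_continuous_on:
  "several_holomorphic_on g S \<Longrightarrow> continuous_on S g"
  unfolding several_holomorphic_on_def
  by (meson continuous_at_imp_continuous_on has_derivative_continuous)

text \<open>By the chain rule the complex-linear derivative, restricted to a complex line, is
  multiplication by a number. This brings in one-variable theory.\<close>

lemma several_holomorphic_slice:
  assumes g: "several_holomorphic_on g S" and S: "\<And>c. c \<in> A \<Longrightarrow> z + c *s u \<in> S"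
  shows "(\<lambda>c. g (z + c *s u)) holomorphic_on A"
proof -
  have "\<exists>d. ((\<lambda>c. g (z + c *s u)) has_field_derivative d) (at c)" if cA: "c \<in> A" for c
  proof -
    obtain a where a: "(g has_derivative (\<lambda>h. \<Sum>i\<in>UNIV. a $ i * h $ i)) (at (z + c *s u))"
      using g S [OF cA] unfolding several_holomorphic_on_def by blast
    have "linear (\<lambda>h. h *s u)"
      by (rule linearI) (simp_all add: vec_eq_iff algebra_simps)
    then have "((\<lambda>c. z + c *s u) has_derivative (\<lambda>h. 0 + h *s u)) (at c)"
      by (intro has_derivative_add has_derivative_const bounded_linear_imp_has_derivative
          linear_conv_bounded_linear [THEN iffD1])
    from has_derivative_compose [OF this a]
    have "((\<lambda>c. g (z + c *s u)) has_derivative (\<lambda>h. \<Sum>i\<in>UNIV. a $ i * (h * u $ i))) (at c)"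
      by simp
    also have "(\<lambda>h. \<Sum>i\<in>UNIV. a $ i * (h * u $ i)) = (*) (\<Sum>i\<in>UNIV. a $ i * u $ i)"
      by (simp add: fun_eq_iff sum_distrib_left sum_distrib_right mult_ac)
    finally show ?thesis
      unfolding has_field_derivative_def by blast
  qed
  then show ?thesis
    unfolding holomorphic_on_def field_differentiable_def
    by (meson has_field_derivative_at_within)
qed

lemma zero_extension_measurable:
  fixes g :: "complex ^ 'n::finite \<Rightarrow> complex"
  assumes "several_holomorphic_on g unit_ball" and "\<And>z. z \<notin> unit_ball \<Longrightarrow> g z = 0"
  shows "g \<in> borel_measurable borel"
proof -
  have "(\<lambda>z. if z \<in> unit_ball then g z else 0) \<in> borel_measurable borel"
    by (intro borel_measurable_continuous_on_if several_holomorphic_imp_continuous_on [OF assms(1)]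
        continuous_on_const ball_in_sets_borel)
  also have "(\<lambda>z. if z \<in> unit_ball then g z else 0) = g"
    using assms(2) by (auto simp: fun_eq_iff)
  finally show ?thesis .
qed

text \<open>Slabs are circled, so a slab that fits around \<open>z\<close> contains whole discs
  through \<open>z\<close>, as the mean value property on complex lines requires.\<close>

lemma slab_vector_mult: "cmod c \<le> 1 \<Longrightarrow> u \<in> slab e a b \<Longrightarrow> c *s u \<in> slab e a b"
  unfolding slab_def
  by (auto simp: cinner_vector_mult_left norm_mult norm_vector_mult
      intro: le_less_trans [OF mult_left_le_one_le])

lemma indicator_slab_unimodular:
  assumes "cmod c = 1"
  shows "indicator (slab e a b) (c *s u) = (indicator (slab e a b) u :: ennreal)"
  using assms by (simp add: slab_def indicator_def cinner_vector_mult_left norm_mult norm_vector_mult)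

text \<open>On each complex line through \<open>z\<close> the square of \<open>g\<close> is
  holomorphic, so its modulus at \<open>z\<close> is at most its circular mean. These inequalities
  are integrated over the slab; after exchanging integrals, every rotation preserves both the slab
  and Lebesgue measure, and the factor 2 pi cancels.\<close>

lemma slab_submean:
  fixes g :: "complex ^ 'n::finite \<Rightarrow> complex"
  assumes g: "several_holomorphic_on g unit_ball" "\<And>z. z \<notin> unit_ball \<Longrightarrow> g z = 0"
    and sub: "\<And>u. u \<in> slab e a b \<Longrightarrow> z + u \<in> unit_ball"
  shows "emeasure lborel (slab e a b) * ennreal ((cmod (g z))\<^sup>2)
    \<le> (\<integral>\<^sup>+u. indicator (slab e a b) u * ennreal ((cmod (g (z + u)))\<^sup>2) \<partial>lborel)"
proof -
  have gm [measurable]: "g \<in> borel_measurable borel"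
    using g by (rule zero_extension_measurable)
  have rot: "(\<lambda>x. z + cis (fst x) *s snd x) \<in> borel_measurable (borel \<Otimes>\<^sub>M borel)"
    "(\<lambda>x. z + cis (snd x) *s fst x) \<in> borel_measurable (borel \<Otimes>\<^sub>M borel)"
    unfolding borel_prod by (intro borel_measurable_continuous_onI continuous_intros)+
  have [measurable]: "(\<lambda>x. g (z + cis (fst x) *s snd x)) \<in> borel_measurable (borel \<Otimes>\<^sub>M borel)"
    "(\<lambda>x. g (z + cis (snd x) *s fst x)) \<in> borel_measurable (borel \<Otimes>\<^sub>M borel)"
    by (rule measurable_compose [OF rot(1) gm], rule measurable_compose [OF rot(2) gm])
  let ?I = "\<integral>\<^sup>+u. indicator (slab e a b) u * ennreal ((cmod (g (z + u)))\<^sup>2) \<partial>lborel"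
  have "ennreal (2 * pi) * (emeasure lborel (slab e a b) * ennreal ((cmod (g z))\<^sup>2))
    = (\<integral>\<^sup>+u. indicator (slab e a b) u * ennreal (2 * pi * (cmod (g z))\<^sup>2) \<partial>lborel)"
    by (subst nn_integral_multc) (simp_all add: ennreal_mult mult_ac)
  also have "\<dots> \<le> (\<integral>\<^sup>+u. \<integral>\<^sup>+t. indicator {0..2 * pi} t *
      (indicator (slab e a b) u * ennreal ((cmod (g (z + cis t *s u)))\<^sup>2)) \<partial>lborel \<partial>lborel)"
  proof (intro nn_integral_mono)
    fix u
    show "indicator (slab e a b) u * ennreal (2 * pi * (cmod (g z))\<^sup>2)
      \<le> (\<integral>\<^sup>+t. indicator {0..2 * pi} t * (indicator (slab e a b) u * ennreal ((cmod (g (z + cis t *s u)))\<^sup>2)) \<partial>lborel)"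
    proof (cases "u \<in> slab e a b")
      case True
      then have "(\<lambda>c. (g (z + c *s u))\<^sup>2) holomorphic_on cball 0 1"
        by (intro holomorphic_on_power several_holomorphic_slice [OF g(1)] sub slab_vector_mult) auto
      from circle_mean_value_bound [OF this] show ?thesis
        using True by (simp add: norm_power)
    qed simp
  qed
  also have "\<dots> = (\<integral>\<^sup>+t. \<integral>\<^sup>+u. indicator {0..2 * pi} t *
      (indicator (slab e a b) u * ennreal ((cmod (g (z + cis t *s u)))\<^sup>2)) \<partial>lborel \<partial>lborel)"
    by (rule lborel_pair.Fubini') (simp add: case_prod_unfold)
  also have "\<dots> = (\<integral>\<^sup>+t. indicator {0..2 * pi} t * ?I \<partial>lborel)"
  proof (rule nn_integral_cong)
    fix t :: real
    have [measurable]: "(\<lambda>u. g (z + cis t *s u)) \<in> borel_measurable borel"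
      by (rule measurable_compose [OF _ gm])
        (intro borel_measurable_continuous_onI continuous_intros)
    show "(\<integral>\<^sup>+u. indicator {0..2 * pi} t * (indicator (slab e a b) u *
        ennreal ((cmod (g (z + cis t *s u)))\<^sup>2)) \<partial>lborel) = indicator {0..2 * pi} t * ?I"
      using nn_integral_lborel_unimodular [of "\<lambda>u. indicator (slab e a b) u * ennreal ((cmod (g (z + u)))\<^sup>2)" "cis t"]
      by (simp add: nn_integral_cmult indicator_slab_unimodular)
  qed
  also have "\<dots> = ennreal (2 * pi) * ?I"
    by (simp add: nn_integral_multc)
  finally show ?thesis
    using ennreal_mult_le_cancel [of "2 * pi" _ "2 * pi"] by simp
qed

section \<open>Bounding a value by an integral over a shell\<close>

text \<open>The constants 1/2 and 3 leave room for the slab around a point with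
  \<open>1 - norm z = d\<close> that is used in \<open>shell_bound\<close>.\<close>

definition shell :: "real \<Rightarrow> (complex ^ 'n::finite) set" where
  "shell d = {w \<in> unit_ball. d / 2 \<le> 1 - (norm w)\<^sup>2 \<and> 1 - (norm w)\<^sup>2 \<le> 3 * d}"

lemma shell_measurable [measurable]: "shell d \<in> sets borel"
  unfolding shell_def by measurable

text \<open>The sub-mean value property is applied to a slab about \<open>z\<close> inside the
  shell. Its volume has order d^2 d^(N-1) = d^(N+1), which gives the right growth exponent; a round
  ball of radius d would only give d^(2N).\<close>

lemma shell_bound:
  fixes g :: "complex ^ 'n::finite \<Rightarrow> complex"
  assumes g: "several_holomorphic_on g unit_ball" "\<And>z. z \<notin> unit_ball \<Longrightarrow> g z = 0"
    and z: "z \<in> unit_ball"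
  defines "d \<equiv> 1 - norm z"
  shows "ennreal (d ^ (CARD('n) + 1) / (16 * 64 ^ CARD('n))) * ennreal ((cmod (g z))\<^sup>2)
    \<le> (\<integral>\<^sup>+w. indicator (shell d) w * ennreal ((cmod (g w))\<^sup>2) \<partial>ball_measure)"
proof -
  have [measurable]: "g \<in> borel_measurable borel"
    using g by (rule zero_extension_measurable)
  have d: "0 < d" "d \<le> 1" "norm z = 1 - d"
    using z by (auto simp: d_def)
  \<comment> \<open>At the origin every unit vector serves as direction.\<close>
  obtain e :: "complex ^ 'n" where e: "norm e = 1" "z = norm z *\<^sub>R e"
  proof (cases "z = 0")
    case True
    then show ?thesis using that [of "axis undefined 1"] by (simp add: norm_axis_1)
  next
    case False
    then show ?thesis using that [of "z /\<^sub>R norm z"] by simp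
  qed
  \<comment> \<open>In the expansion of the squared norm of \<open>z + u\<close> the mixed term is
    at most d/4 in modulus by the choice of \<open>a\<close>, and the squared norm of
    \<open>u\<close> is at most d/4 by the choice of \<open>b\<close>. As 1 - (1 - d)^2 lies between
    d and 2 d, the sum meets the bounds d/2 and 3 d of the shell.\<close>
  define a where "a = d / 8"
  define b where "b = sqrt d / 2"
  have b2: "b\<^sup>2 = d / 4"
    using d by (simp add: b_def power_divide)
  \<comment> \<open>This yields \<open>a \<le> b / 4\<close>, the condition for the lower volume
    bound.\<close>
  have "d \<le> sqrt d"
    using d by (intro real_le_rsqrt) (simp add: power2_eq_square mult_left_le)
  then have ab: "0 < a" "a \<le> b / 4"
    using d by (simp_all add: a_def b_def)
  have sub: "z + u \<in> shell d" if "u \<in> slab e a b" for u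
  proof -
    have u: "cmod (cinner u e) < a" "norm u < b"
      using that by (auto simp: slab_def)
    have "\<bar>u \<bullet> z\<bar> \<le> cmod (cinner u z)"
      unfolding Re_cinner [symmetric] by (rule abs_Re_le_cmod)
    also have "\<dots> = norm z * cmod (cinner u e)"
      by (subst e(2)) (simp add: cinner_scaleR_right norm_mult)
    also have "\<dots> \<le> a"
      using u(1) d by (intro order.trans [OF mult_left_le_one_le]) auto
    finally have uz: "\<bar>u \<bullet> z\<bar> \<le> a" .
    have "(norm u)\<^sup>2 \<le> b\<^sup>2"
      using u(2) by (intro power_mono) auto
    then have u2: "(norm u)\<^sup>2 \<le> d / 4"
      by (simp add: b2)
    have nzu: "(norm (z + u))\<^sup>2 = (1 - d)\<^sup>2 + 2 * (u \<bullet> z) + (norm u)\<^sup>2"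
      unfolding d(3) [symmetric] by (simp add: power2_norm_eq_inner inner_simps inner_commute)
    have "d\<^sup>2 \<le> d"
      using d by (simp add: power2_eq_square mult_left_le)
    moreover have "(1 - d)\<^sup>2 = 1 - 2 * d + d\<^sup>2"
      by (simp add: power2_diff)
    moreover have "- (d / 8) \<le> u \<bullet> z" "u \<bullet> z \<le> d / 8" "0 \<le> (norm u)\<^sup>2" "0 \<le> d\<^sup>2"
      using uz by (simp_all add: a_def abs_le_iff)
    ultimately have le: "d / 2 \<le> 1 - (norm (z + u))\<^sup>2" "1 - (norm (z + u))\<^sup>2 \<le> 3 * d"
      using u2 d(1,2) unfolding nzu by linarith+
    then have "(norm (z + u))\<^sup>2 < 1"
      using d by linarith
    then have "norm (z + u) < 1"
      by (simp add: abs_square_less_1)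
    with le show ?thesis
      by (simp add: shell_def)
  qed
  let ?V = "emeasure lborel (unit_ball :: (complex ^ 'n) set)"
  have "a\<^sup>2 / b\<^sup>2 * (b / 4) ^ (2 * CARD('n)) = d ^ (CARD('n) + 1) / (16 * 64 ^ CARD('n))"
    using d by (simp add: b2 a_def power_mult power_divide) (simp add: power2_eq_square)
  then have "ennreal (d ^ (CARD('n) + 1) / (16 * 64 ^ CARD('n))) * ?V \<le> emeasure lborel (slab e a b)"
    using emeasure_slab_ge [OF e(1) ab] by simp
  then have "(ennreal (d ^ (CARD('n) + 1) / (16 * 64 ^ CARD('n))) * ?V) * ennreal ((cmod (g z))\<^sup>2)
    \<le> emeasure lborel (slab e a b) * ennreal ((cmod (g z))\<^sup>2)"
    by (rule mult_right_mono) simp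
  also have "\<dots> \<le> (\<integral>\<^sup>+u. indicator (slab e a b) u * ennreal ((cmod (g (z + u)))\<^sup>2) \<partial>lborel)"
    by (rule slab_submean [OF g]) (use sub in \<open>auto simp: shell_def\<close>)
  also have "\<dots> \<le> (\<integral>\<^sup>+u. indicator (shell d) (z + u) * ennreal ((cmod (g (z + u)))\<^sup>2) \<partial>lborel)"
    by (intro nn_integral_mono mult_right_mono) (auto simp: indicator_def sub)
  also have "\<dots> = (\<integral>\<^sup>+w. indicator (shell d) w * ennreal ((cmod (g w))\<^sup>2) \<partial>lborel)"
    by (rule nn_integral_lborel_translate) measurable
  also have "\<dots> = (\<integral>\<^sup>+w. (indicator (shell d) w * ennreal ((cmod (g w))\<^sup>2)) * indicator unit_ball w \<partial>lborel)"
    by (rule nn_integral_cong) (auto simp: indicator_def shell_def)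
  finally have "(ennreal (d ^ (CARD('n) + 1) / (16 * 64 ^ CARD('n))) * ?V * ennreal ((cmod (g z))\<^sup>2)) / ?V
    \<le> (\<integral>\<^sup>+w. (indicator (shell d) w * ennreal ((cmod (g w))\<^sup>2)) * indicator unit_ball w \<partial>lborel) / ?V"
    by (rule divide_right_mono_ennreal)
  moreover have "(x * ?V * y) / ?V = x * y" for x y
    using mult_divide_eq_ennreal [of ?V "x * y"] emeasure_unit_ball [where 'a = "complex ^ 'n"]
    by (simp only: mult.assoc mult.commute [of ?V] infinity_ennreal_def) simp
  ultimately show ?thesis
    by (subst nn_integral_ball_measure) simp_all
qed

section \<open>Point evaluations\<close>

text \<open>The exponent \<alpha> of the reproducing kernel, the power -\<alpha> of
  \<open>1 - cinner z w\<close>, of the respective space.\<close>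

fun kernel_exponent :: "nat \<Rightarrow> space_kind \<Rightarrow> real" where
  "kernel_exponent N Hardy = real N"
| "kernel_exponent N (Bergman s) = real N + s + 1"

definition admissible :: "space_kind \<Rightarrow> bool" where
  "admissible H \<longleftrightarrow> H = Hardy \<or> (\<exists>s>-1. H = Bergman s)"

lemma fun_spaceD:
  assumes "g \<in> fun_space H"
  shows "several_holomorphic_on g unit_ball" "\<And>z. z \<notin> unit_ball \<Longrightarrow> g z = 0" "sq_norm H g < \<infinity>"
  using assms by (auto simp: fun_space_def)

lemma fun_space_measurable: "g \<in> fun_space H \<Longrightarrow> g \<in> borel_measurable borel"
  by (blast intro: zero_extension_measurable fun_spaceD)

text \<open>In polar coordinates the shell only meets radii with 1 - \<rho> \<le> 1 - \<rho>^2 \<le>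
  3 d, and on each sphere the integral is at most the squared Hardy norm. The radial density is at
  most 2N, so the thickness contributes the factor d that turns d^(N+1) into d^N. The interval of
  radii may reach below 0; only its length matters.\<close>

lemma shell_le_hardy:
  fixes g :: "complex ^ 'n::finite \<Rightarrow> complex"
  assumes [measurable]: "g \<in> borel_measurable borel" and "0 < d"
  shows "(\<integral>\<^sup>+w. indicator (shell d) w * ennreal ((cmod (g w))\<^sup>2) \<partial>ball_measure)
    \<le> ennreal (6 * real CARD('n) * d) * sq_norm Hardy g"
proof -
  let ?N = "CARD('n)"
  have "(\<integral>\<^sup>+w. indicator (shell d) w * ennreal ((cmod (g w))\<^sup>2) \<partial>ball_measure)
    = (\<integral>\<^sup>+\<rho>. indicator {0<..<1} \<rho> * ennreal (real (2 * ?N) * \<rho> ^ (2 * ?N - 1)) *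
        (\<integral>\<^sup>+\<zeta>. indicator (shell d) (\<rho> *\<^sub>R \<zeta>) * ennreal ((cmod (g (\<rho> *\<^sub>R \<zeta>)))\<^sup>2) \<partial>sphere_measure) \<partial>lborel)"
    by (rule nn_integral_ball_measure_polar) measurable
  also have "\<dots> \<le> (\<integral>\<^sup>+\<rho>. indicator {1 - 3 * d..1} \<rho> * (ennreal (real (2 * ?N)) * sq_norm Hardy g) \<partial>lborel)"
  proof (rule nn_integral_mono)
    fix \<rho> :: real
    show "indicator {0<..<1} \<rho> * ennreal (real (2 * ?N) * \<rho> ^ (2 * ?N - 1)) *
        (\<integral>\<^sup>+\<zeta>. indicator (shell d) (\<rho> *\<^sub>R \<zeta>) * ennreal ((cmod (g (\<rho> *\<^sub>R \<zeta>)))\<^sup>2) \<partial>sphere_measure)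
      \<le> indicator {1 - 3 * d..1} \<rho> * (ennreal (real (2 * ?N)) * sq_norm Hardy g)"
    proof (cases "\<rho> \<in> {0<..<1}")
      case \<rho>: True
      have "indicator (shell d) (\<rho> *\<^sub>R \<zeta>) * x \<le> indicator {1 - 3 * d..1} \<rho> * (x * indicator unit_sphere \<zeta>)"
        if "\<zeta> \<in> unit_sphere" for \<zeta> :: "complex ^ 'n" and x :: ennreal
      proof (cases "\<rho> *\<^sub>R \<zeta> \<in> shell d")
        case True
        then have "1 - \<rho>\<^sup>2 \<le> 3 * d"
          using that by (simp add: shell_def)
        moreover have "\<rho>\<^sup>2 \<le> \<rho>"
          using \<rho> by (simp add: power2_eq_square mult_left_le)
        ultimately show ?thesis
          using that \<rho> by (simp add: indicator_def)
      qed simp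
      then have "(\<integral>\<^sup>+\<zeta>. indicator (shell d) (\<rho> *\<^sub>R \<zeta>) * ennreal ((cmod (g (\<rho> *\<^sub>R \<zeta>)))\<^sup>2) \<partial>sphere_measure)
        \<le> (\<integral>\<^sup>+\<zeta>. indicator {1 - 3 * d..1} \<rho> * (ennreal ((cmod (g (\<rho> *\<^sub>R \<zeta>)))\<^sup>2) * indicator unit_sphere \<zeta>) \<partial>sphere_measure)"
        by (intro nn_integral_mono_AE) (use AE_sphere_measure in \<open>eventually_elim, simp\<close>)
      also have "\<dots> = indicator {1 - 3 * d..1} \<rho> *
          (\<integral>\<^sup>+\<zeta>. ennreal ((cmod (g (\<rho> *\<^sub>R \<zeta>)))\<^sup>2) * indicator unit_sphere \<zeta> \<partial>sphere_measure)"
        by (rule nn_integral_cmult) simp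
      also have "\<dots> \<le> indicator {1 - 3 * d..1} \<rho> * sq_norm Hardy g"
        using \<rho> by (auto intro!: mult_left_mono SUP_upper)
      finally have "ennreal (real (2 * ?N) * \<rho> ^ (2 * ?N - 1)) *
          (\<integral>\<^sup>+\<zeta>. indicator (shell d) (\<rho> *\<^sub>R \<zeta>) * ennreal ((cmod (g (\<rho> *\<^sub>R \<zeta>)))\<^sup>2) \<partial>sphere_measure)
        \<le> ennreal (real (2 * ?N)) * (indicator {1 - 3 * d..1} \<rho> * sq_norm Hardy g)"
        using \<rho> by (intro mult_mono ennreal_leI) (auto simp: mult_left_le power_le_one)
      then show ?thesis
        using \<rho> by (simp add: mult_ac)
    qed simp
  qed
  also have "\<dots> = ennreal (3 * d) * (ennreal (real (2 * ?N)) * sq_norm Hardy g)"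
    using assms(2) by (subst nn_integral_multc) (simp_all del: sq_norm.simps)
  also have "\<dots> = ennreal (3 * d * real (2 * ?N)) * sq_norm Hardy g"
    using assms(2) by (simp only: ennreal_mult mult.assoc of_nat_0_le_iff mult_nonneg_nonneg less_imp_le zero_le_numeral)
  finally show ?thesis
    by (simp add: mult_ac del: sq_norm.simps)
qed

lemma bergman_weight_const_pos:
  assumes "-1 < s"
  shows "0 < Gamma (real N + s + 1) / (Gamma (real N + 1) * Gamma (s + 1))"
  using assms by (intro divide_pos_pos mult_pos_pos Gamma_real_pos) auto

text \<open>On the shell the weight is comparable to \<open>d powr s\<close>. For s \<ge> 0 the
  lower end d/2 of the range gives the bound, for negative s the upper end 3 d; the minimum covers
  both signs.\<close>

lemma shell_le_bergman:
  fixes g :: "complex ^ 'n::finite \<Rightarrow> complex"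
  assumes [measurable]: "g \<in> borel_measurable borel" and "0 < d" and "-1 < s"
  shows "ennreal (Gamma (real CARD('n) + s + 1) / (Gamma (real CARD('n) + 1) * Gamma (s + 1)) *
      min ((1 / 2) powr s) (3 powr s) * d powr s) *
      (\<integral>\<^sup>+w. indicator (shell d) w * ennreal ((cmod (g w))\<^sup>2) \<partial>ball_measure)
    \<le> sq_norm (Bergman s) g"
proof -
  define \<kappa> where "\<kappa> = Gamma (real CARD('n) + s + 1) / (Gamma (real CARD('n) + 1) * Gamma (s + 1))"
  define m where "m = min ((1 / 2) powr s) (3 powr s)"
  have \<kappa>: "0 < \<kappa>"
    unfolding \<kappa>_def using assms(3) by (rule bergman_weight_const_pos)
  have lower: "m * d powr s \<le> (1 - (norm w)\<^sup>2) powr s" if "w \<in> shell d" for w :: "complex ^ 'n"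
  proof (cases "0 \<le> s")
    case True
    have "m * d powr s \<le> (1 / 2) powr s * d powr s"
      by (intro mult_right_mono) (auto simp: m_def)
    also have "\<dots> = (d / 2) powr s"
      using assms(2) by (simp flip: powr_mult)
    also have "\<dots> \<le> (1 - (norm w)\<^sup>2) powr s"
      using that assms(2) True by (intro powr_mono2) (auto simp: shell_def)
    finally show ?thesis .
  next
    case False
    have "m * d powr s \<le> 3 powr s * d powr s"
      by (intro mult_right_mono) (auto simp: m_def)
    also have "\<dots> = (3 * d) powr s"
      using assms(2) by (simp add: powr_mult)
    also have "\<dots> \<le> (1 - (norm w)\<^sup>2) powr s"
      using that assms(2) False by (intro powr_mono2') (auto simp: shell_def)
    finally show ?thesis .
  qed
  have "ennreal (\<kappa> * m * d powr s) * (\<integral>\<^sup>+w. indicator (shell d) w * ennreal ((cmod (g w))\<^sup>2) \<partial>ball_measure)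
    = (\<integral>\<^sup>+w. ennreal (\<kappa> * m * d powr s) * (indicator (shell d) w * ennreal ((cmod (g w))\<^sup>2)) \<partial>ball_measure)"
    by (rule nn_integral_cmult [symmetric]) measurable
  also have "\<dots> \<le> (\<integral>\<^sup>+w. ennreal ((cmod (g w))\<^sup>2 * bergman_weight s w) * indicator unit_ball w \<partial>ball_measure)"
  proof (rule nn_integral_mono)
    fix w :: "complex ^ 'n"
    show "ennreal (\<kappa> * m * d powr s) * (indicator (shell d) w * ennreal ((cmod (g w))\<^sup>2))
      \<le> ennreal ((cmod (g w))\<^sup>2 * bergman_weight s w) * indicator unit_ball w"
    proof (cases "w \<in> shell d")
      case True
      have "\<kappa> * m * d powr s * (cmod (g w))\<^sup>2 \<le> (cmod (g w))\<^sup>2 * (\<kappa> * (1 - (norm w)\<^sup>2) powr s)"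
        using mult_left_mono [OF mult_left_mono [OF lower [OF True]], of \<kappa> "(cmod (g w))\<^sup>2"] \<kappa>
        by (simp add: mult_ac)
      moreover have "bergman_weight s w = \<kappa> * (1 - (norm w)\<^sup>2) powr s"
        by (simp add: bergman_weight_def \<kappa>_def)
      moreover have "0 \<le> \<kappa> * m * d powr s"
        using \<kappa> by (simp add: m_def)
      moreover have "w \<in> unit_ball"
        using True by (simp add: shell_def)
      ultimately show ?thesis
        using True by (simp add: ennreal_leI flip: ennreal_mult)
    qed simp
  qed
  finally show ?thesis
    by (simp add: \<kappa>_def m_def)
qed

text \<open>\<open>shell_bound\<close> combined with the comparison of shell integral and norm. It
  serves twice: at fixed points it turns norm convergence into pointwise convergence, and at moving
  points it gives the quantitative estimate.\<close>

lemma point_evaluation_bound: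
  assumes "admissible H"
  shows "\<exists>C. 0 \<le> C \<and> (\<forall>g \<in> fun_space H. \<forall>z \<in> unit_ball.
    (cmod (g z))\<^sup>2 * (1 - norm (z :: complex ^ 'n::finite)) powr kernel_exponent CARD('n) H \<le> C * (space_norm H g)\<^sup>2)"
proof -
  let ?N = "CARD('n)" and ?\<alpha> = "kernel_exponent CARD('n) H"
  have "\<exists>C\<ge>0. \<forall>g \<in> fun_space H. \<forall>z :: complex ^ 'n \<in> unit_ball.
    ennreal ((cmod (g z))\<^sup>2 * (1 - norm z) powr ?\<alpha>) \<le> ennreal C * sq_norm H g"
  proof (cases H)
    case Hardy
    show ?thesis
    proof (intro exI [of _ "6 * real ?N * (16 * 64 ^ ?N)"] conjI ballI)
      fix g :: "complex ^ 'n \<Rightarrow> complex" and z :: "complex ^ 'n"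
      assume g: "g \<in> fun_space H" and z: "z \<in> unit_ball"
      define d where "d = 1 - norm z"
      have "0 < d" using z by (simp add: d_def)
      have "ennreal (d ^ (?N + 1) / (16 * 64 ^ ?N)) * ennreal ((cmod (g z))\<^sup>2)
        \<le> ennreal (6 * real ?N * d) * sq_norm Hardy g"
        using shell_bound [OF fun_spaceD(1,2) [OF g] z] shell_le_hardy [OF fun_space_measurable [OF g] \<open>0 < d\<close>]
        unfolding d_def by (rule order.trans)
      then have "ennreal ((cmod (g z))\<^sup>2) \<le> ennreal (6 * real ?N * d / (d ^ (?N + 1) / (16 * 64 ^ ?N))) * sq_norm Hardy g"
        by (rule ennreal_mult_le_cancel) (use \<open>0 < d\<close> in simp_all)
      then have "ennreal (d ^ ?N) * ennreal ((cmod (g z))\<^sup>2)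
        \<le> ennreal (d ^ ?N) * (ennreal (6 * real ?N * d / (d ^ (?N + 1) / (16 * 64 ^ ?N))) * sq_norm Hardy g)"
        by (rule mult_left_mono) simp
      also have "\<dots> = ennreal (6 * real ?N * (16 * 64 ^ ?N)) * sq_norm Hardy g"
        using \<open>0 < d\<close> by (simp flip: mult.assoc ennreal_mult del: sq_norm.simps)
      finally show "ennreal ((cmod (g z))\<^sup>2 * (1 - norm z) powr ?\<alpha>)
        \<le> ennreal (6 * real ?N * (16 * 64 ^ ?N)) * sq_norm H g"
        using \<open>0 < d\<close> Hardy
        by (simp add: powr_realpow d_def mult.commute flip: ennreal_mult del: sq_norm.simps)
    qed simp
  next
    case (Bergman s)
    then have s: "-1 < s"
      using assms by (auto simp: admissible_def)
    define k where "k = Gamma (real CARD('n) + s + 1) / (Gamma (real CARD('n) + 1) * Gamma (s + 1)) *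
      min ((1 / 2) powr s) (3 powr s)"
    have k: "0 < k"
      unfolding k_def using bergman_weight_const_pos [OF s] by (intro mult_pos_pos) auto
    show ?thesis
    proof (intro exI [of _ "16 * 64 ^ ?N / k"] conjI ballI)
      fix g :: "complex ^ 'n \<Rightarrow> complex" and z :: "complex ^ 'n"
      assume g: "g \<in> fun_space H" and z: "z \<in> unit_ball"
      define d where "d = 1 - norm z"
      have "0 < d" using z by (simp add: d_def)
      have "ennreal (k * d powr s) * (ennreal (d ^ (?N + 1) / (16 * 64 ^ ?N)) * ennreal ((cmod (g z))\<^sup>2))
        \<le> ennreal (k * d powr s) * (\<integral>\<^sup>+w. indicator (shell d) w * ennreal ((cmod (g w))\<^sup>2) \<partial>ball_measure)"
        unfolding d_def by (intro mult_left_mono shell_bound fun_spaceD [OF g] z) simp_all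
      also have "\<dots> \<le> sq_norm H g"
        using shell_le_bergman [OF fun_space_measurable [OF g] \<open>0 < d\<close> s] by (simp add: Bergman k_def)
      finally have "ennreal (k / (16 * 64 ^ ?N)) * ennreal ((cmod (g z))\<^sup>2 * d powr ?\<alpha>) \<le> ennreal 1 * sq_norm H g"
        using \<open>0 < d\<close> k
        by (simp add: Bergman powr_add powr_realpow mult_ac flip: ennreal_mult del: sq_norm.simps)
      then show "ennreal ((cmod (g z))\<^sup>2 * (1 - norm z) powr ?\<alpha>) \<le> ennreal (16 * 64 ^ ?N / k) * sq_norm H g"
        using ennreal_mult_le_cancel [of "k / (16 * 64 ^ ?N)" _ 1] k by (simp add: d_def)
    qed (use k in simp)
  qed
  then obtain C where C: "0 \<le> C" "\<And>g z. g \<in> fun_space H \<Longrightarrow> (z :: complex ^ 'n) \<in> unit_ball \<Longrightarrow>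
    ennreal ((cmod (g z))\<^sup>2 * (1 - norm z) powr ?\<alpha>) \<le> ennreal C * sq_norm H g"
    by blast
  show ?thesis
  proof (intro exI [of _ C] conjI ballI C(1))
    fix g :: "complex ^ 'n \<Rightarrow> complex" and z :: "complex ^ 'n"
      assume g: "g \<in> fun_space H" and z: "z \<in> unit_ball"
    \<comment> \<open>The squared norm is finite on the space, so nothing is lost by passing to the
      real number \<open>space_norm\<close>.\<close>
    have "sq_norm H g = ennreal ((space_norm H g)\<^sup>2)"
      using fun_spaceD(3) [OF g] by (simp add: space_norm_def)
    with C(2) [OF g z] C(1) show "(cmod (g z))\<^sup>2 * (1 - norm z) powr ?\<alpha> \<le> C * (space_norm H g)\<^sup>2"
      by (simp flip: ennreal_mult)
  qed
qed

section \<open>Caps\<close>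

text \<open>Dyadic decomposition by the size of \<open>h\<close>. The part with \<open>h\<close>
  between 2^j \<delta> and 2^(j+1) \<delta> contributes at most (2^j \<delta>)^(-p) C (2^(j+1)
  \<delta>)^a, and since a - p \<le> -1 these bounds are dominated by a geometric series with ratio
  1/2.\<close>

lemma nn_integral_inverse_power_le:
  fixes h :: "'a \<Rightarrow> real"
  assumes [measurable]: "h \<in> borel_measurable M"
    and h: "AE x in M. \<delta> \<le> h x" and "0 < \<delta>" and "0 \<le> C"
    and dist: "\<And>t. 0 < t \<Longrightarrow> emeasure M {x \<in> space M. h x < t} \<le> ennreal (C * t powr a)"
    and p: "a + 1 \<le> p" "0 \<le> p"
  shows "(\<integral>\<^sup>+x. ennreal (h x powr - p) \<partial>M) \<le> ennreal (C * 2 powr (a + 1) * \<delta> powr (a - p))"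
proof -
  \<comment> \<open>The whole sublevel set stands in for the dyadic layer. This only enlarges the
    sum, and its measure is what \<open>dist\<close> controls.\<close>
  define A where "A j = {x \<in> space M. h x < 2 ^ Suc j * \<delta>}" for j :: nat
  have [measurable]: "A j \<in> sets M" for j
    unfolding A_def by measurable
  define f where "f j x = ennreal ((2 ^ j * \<delta>) powr - p) * indicator (A j) x" for j x
  have "ennreal (h x powr - p) \<le> (\<Sum>j. f j x)" if "\<delta> \<le> h x" "x \<in> space M" for x
  proof -
    \<comment> \<open>The least such \<open>n\<close> is positive because \<delta> \<le> h x, so its
      predecessor \<open>j\<close> indexes the layer of \<open>x\<close>.\<close>
    define n where "n = (LEAST n. h x < 2 ^ n * \<delta>)"
    have ex: "\<exists>n. h x < 2 ^ n * \<delta>"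
      using real_arch_pow [of 2 "h x / \<delta>"] \<open>0 < \<delta>\<close> by (auto simp: field_simps)
    have n: "h x < 2 ^ n * \<delta>"
      unfolding n_def using ex by (rule LeastI_ex)
    then have "n \<noteq> 0"
      using that(1) by (auto intro: ccontr)
    then obtain j where j: "n = Suc j"
      using not0_implies_Suc by blast
    have "2 ^ j * \<delta> \<le> h x"
      using not_less_Least [of j "\<lambda>n. h x < 2 ^ n * \<delta>"] j by (simp add: n_def)
    then have "h x powr - p \<le> (2 ^ j * \<delta>) powr - p"
      using \<open>0 < \<delta>\<close> p by (intro powr_mono2') auto
    then have "ennreal (h x powr - p) \<le> f j x"
      using n j that(2) by (auto simp: f_def A_def intro: ennreal_leI)
    also have "f j x = (\<Sum>j\<in>{j}. f j x)"
      by simp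
    also have "\<dots> \<le> (\<Sum>j. f j x)"
      by (rule sum_le_suminf) auto
    finally show ?thesis .
  qed
  then have "(\<integral>\<^sup>+x. ennreal (h x powr - p) \<partial>M) \<le> (\<integral>\<^sup>+x. (\<Sum>j. f j x) \<partial>M)"
    by (intro nn_integral_mono_AE) (use h AE_space in \<open>eventually_elim, simp\<close>)
  also have "\<dots> = (\<Sum>j. \<integral>\<^sup>+x. f j x \<partial>M)"
    by (rule nn_integral_suminf) (simp add: f_def)
  also have "\<dots> \<le> (\<Sum>j. ennreal (C * 2 powr a * \<delta> powr (a - p) * (1 / 2) ^ j))"
  proof (intro suminf_le summableI)
    fix j
    have "(\<integral>\<^sup>+x. f j x \<partial>M) = ennreal ((2 ^ j * \<delta>) powr - p) * emeasure M (A j)"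
      by (simp add: f_def nn_integral_cmult)
    also have "\<dots> \<le> ennreal ((2 ^ j * \<delta>) powr - p) * ennreal (C * (2 ^ Suc j * \<delta>) powr a)"
      unfolding A_def using \<open>0 < \<delta>\<close> by (intro mult_left_mono dist) auto
    also have "\<dots> = ennreal (C * 2 powr a * \<delta> powr (a - p) * (2 ^ j) powr (a - p))"
      using \<open>0 < \<delta>\<close> \<open>0 \<le> C\<close>
      by (simp add: powr_mult powr_diff powr_minus_divide mult_ac flip: ennreal_mult)
    also have "\<dots> \<le> ennreal (C * 2 powr a * \<delta> powr (a - p) * (1 / 2) ^ j)"
    proof (intro ennreal_leI mult_left_mono)
      have "(2 ^ j :: real) powr (a - p) \<le> (2 ^ j) powr (- 1)"
        using p by (intro powr_mono) auto
      then show "(2 ^ j :: real) powr (a - p) \<le> (1 / 2) ^ j"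
        by (simp add: powr_minus_divide power_divide)
    qed (use \<open>0 \<le> C\<close> in auto)
    finally show "(\<integral>\<^sup>+x. f j x \<partial>M) \<le> ennreal (C * 2 powr a * \<delta> powr (a - p) * (1 / 2) ^ j)" .
  qed
  also have "\<dots> = ennreal (C * 2 powr a * \<delta> powr (a - p) * 2)"
    using \<open>0 \<le> C\<close> geometric_sums [of "1 / 2 :: real"]
    by (intro suminf_ennreal_eq sums_mult) auto
  finally show ?thesis
    by (simp add: powr_add mult_ac)
qed

text \<open>For t \<le> 1 and nonzero \<open>w\<close>, the cap lies in a translate by e = w / |w|
  of a slab with a = 2 t and b = 2 sqrt t, whose volume has order t^2 t^(N-1).\<close>

lemma ball_measure_cap:
  fixes w :: "complex ^ 'n::finite"
  assumes "norm w \<le> 1" and "0 < t"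
  shows "emeasure ball_measure {z \<in> unit_ball. cmod (1 - cinner z w) < t} \<le> ennreal (16 ^ CARD('n) * t ^ (CARD('n) + 1))"
proof (cases "t \<le> 1 \<and> w \<noteq> 0")
  case True
  define e where "e = w /\<^sub>R norm w"
  have e: "norm e = 1" "w = norm w *\<^sub>R e"
    using True by (simp_all add: e_def)
  let ?A = "{z \<in> unit_ball. cmod (1 - cinner z w) < t}"
  let ?V = "emeasure lborel (unit_ball :: (complex ^ 'n) set)"
  have sub: "- e + z \<in> slab e (2 * t) (2 * sqrt t)" if "z \<in> ?A" for z
  proof -
    have z: "norm z < 1" "cmod (1 - cinner z w) < t"
      using that by auto
    have "1 - norm w \<le> 1 - norm z * norm w"
      using z(1) by (simp add: mult_left_le_one_le)
    also have "\<dots> < t"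
      using norm_one_minus_cinner_ge [of z w] z(2) by linarith
    finally have w: "1 - norm w < t" .
    \<comment> \<open>A nonempty cap forces 1 - |w| < t, so replacing \<open>w\<close> by the unit
      vector \<open>e\<close> costs less than another t.\<close>
    have eq: "1 - cinner z e = (1 - cinner z w) - (1 - norm w) * cinner z e"
      by (subst e(2)) (simp add: cinner_scaleR_right algebra_simps)
    have "cmod (1 - cinner z e) \<le> cmod (1 - cinner z w) + (1 - norm w) * cmod (cinner z e)"
      unfolding eq using norm_triangle_ineq4 [of "1 - cinner z w" "(1 - norm w) * cinner z e"] assms(1)
      by (simp add: norm_mult flip: of_real_diff)
    also have "\<dots> < t + t * 1"
      using norm_cinner_le [of z e] z e(1) w assms
      by (intro add_less_le_mono mult_mono) auto
    finally have ze: "cmod (1 - cinner z e) < 2 * t"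
      by simp
    \<comment> \<open>The squared distance from \<open>e\<close> is controlled by the real part of
      \<open>1 - cinner z e\<close>; this is the source of the radius 2 sqrt t.\<close>
    have "(norm (- e + z))\<^sup>2 = (norm z)\<^sup>2 + 1 - 2 * (z \<bullet> e)"
      using e(1) by (simp add: power2_norm_eq_inner inner_simps inner_commute norm_eq_1)
    also have "\<dots> \<le> 2 * Re (1 - cinner z e)"
      using z(1) by (simp add: Re_cinner power_le_one)
    also have "\<dots> < 4 * t"
      using ze complex_Re_le_cmod [of "1 - cinner z e"] by linarith
    finally have "norm (- e + z) < sqrt (4 * t)"
      by (rule real_less_rsqrt)
    moreover have "cinner (- e + z) e = - (1 - cinner z e)"
      using e(1) by (simp add: cinner_diff_left cinner_self)
    ultimately show ?thesis
      using ze by (simp add: slab_def real_sqrt_mult norm_minus_commute)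
  qed
  have "emeasure lborel ?A = (\<integral>\<^sup>+z. indicator ?A z \<partial>lborel)"
    by simp
  also have "\<dots> \<le> (\<integral>\<^sup>+z. indicator (slab e (2 * t) (2 * sqrt t)) (- e + z) \<partial>lborel)"
    using sub by (intro nn_integral_mono) (auto simp: indicator_def)
  also have "\<dots> = emeasure lborel (slab e (2 * t) (2 * sqrt t))"
    by (subst nn_integral_lborel_translate) auto
  also have "\<dots> \<le> ennreal ((2 * t)\<^sup>2 / (2 * sqrt t)\<^sup>2 * (2 * (2 * sqrt t)) ^ (2 * CARD('n))) * ?V"
    using assms by (intro emeasure_slab_le e) auto
  also have "(2 * t)\<^sup>2 / (2 * sqrt t)\<^sup>2 * (2 * (2 * sqrt t)) ^ (2 * CARD('n)) = 16 ^ CARD('n) * t ^ (CARD('n) + 1)"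
    using assms(2) by (simp add: power_mult power_mult_distrib) (simp add: power2_eq_square)
  finally have "emeasure lborel ?A / ?V \<le> (ennreal (16 ^ CARD('n) * t ^ (CARD('n) + 1)) * ?V) / ?V"
    by (rule divide_right_mono_ennreal)
  also have "\<dots> = ennreal (16 ^ CARD('n) * t ^ (CARD('n) + 1))"
    using emeasure_unit_ball [where 'a = "complex ^ 'n"] by (intro mult_divide_eq_ennreal) auto
  also have "emeasure lborel ?A / ?V = emeasure ball_measure ?A"
    unfolding ball_measure_def
    by (subst emeasure_uniform_measure) (auto intro!: arg_cong2 [where f = "(/)"] arg_cong [where f = "emeasure lborel"])
  finally show ?thesis .
next
  case False
  show ?thesis
  proof (cases "t \<le> 1")
    case True
    \<comment> \<open>Here \<open>w\<close> is 0, so the modulus equals 1 and is not below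
      \<open>t\<close>.\<close>
    with False have "{z \<in> unit_ball. cmod (1 - cinner z w) < t} = {}"
      by auto
    then show ?thesis
      by (metis emeasure_empty zero_le)
  next
    case False
    \<comment> \<open>For t > 1 the bound exceeds the total mass.\<close>
    then have "1 \<le> 16 ^ CARD('n) * t ^ (CARD('n) + 1)"
      using mult_mono [of 1 "16 ^ CARD('n)" 1 "t ^ (CARD('n) + 1)"] by (simp add: one_le_power del: power_Suc)
    then have "1 \<le> ennreal (16 ^ CARD('n) * t ^ (CARD('n) + 1))"
      by (simp flip: ennreal_1 del: power_Suc)
    with emeasure_ball_measure_le_1 show ?thesis
      by (rule order.trans)
  qed
qed

text \<open>The spherical cap is thickened radially: its multiples by radii in (1 - t, 1) lie in the
  solid cap of size 2 t, and these radii have mass at least t. Dividing the bound for the solid cap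
  by t lowers the exponent to N.\<close>

lemma sphere_measure_cap:
  fixes w :: "complex ^ 'n::finite"
  assumes "norm w \<le> 1" and "0 < t"
  shows "emeasure sphere_measure {\<zeta> \<in> unit_sphere. cmod (1 - cinner \<zeta> w) < t} \<le> ennreal (2 * 32 ^ CARD('n) * t ^ CARD('n))"
proof (cases "t \<le> 1")
  case True
  let ?N = "CARD('n)"
  let ?E = "{\<zeta> \<in> unit_sphere. cmod (1 - cinner \<zeta> w) < t}"
  let ?A = "{z \<in> unit_ball. cmod (1 - cinner z w) < 2 * t}"
  \<comment> \<open>The radial mass is 1 - (1 - t)^(2N), which is at least t for 0 < t \<le>
    1.\<close>
  have int: "((\<lambda>\<rho>. real (2 * ?N) * \<rho> ^ (2 * ?N - 1)) has_integral (1 ^ (2 * ?N) - (1 - t) ^ (2 * ?N))) {1 - t..1}"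
    using assms(2)
    by (intro fundamental_theorem_of_calculus)
      (auto intro!: derivative_eq_intros simp flip: has_real_derivative_iff_has_vector_derivative)
  have "(1 - t) ^ (2 * ?N) \<le> (1 - t) ^ 1"
    using True assms(2) by (intro power_decreasing) auto
  then have "ennreal t \<le> ennreal (1 ^ (2 * ?N) - (1 - t) ^ (2 * ?N))"
    by (intro ennreal_leI) simp
  also have "\<dots> = (\<integral>\<^sup>+\<rho>. ennreal (real (2 * ?N) * \<rho> ^ (2 * ?N - 1)) * indicator {1 - t..1} \<rho> \<partial>lborel)"
    using True by (intro nn_integral_has_integral_lebesgue' [OF _ int, symmetric]) auto
  finally have "ennreal t * emeasure sphere_measure ?E
    \<le> (\<integral>\<^sup>+\<rho>. ennreal (real (2 * ?N) * \<rho> ^ (2 * ?N - 1)) * indicator {1 - t..1} \<rho> \<partial>lborel) * emeasure sphere_measure ?E"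
    by (rule mult_right_mono) simp
  also have "\<dots> = (\<integral>\<^sup>+\<rho>. ennreal (real (2 * ?N) * \<rho> ^ (2 * ?N - 1)) * indicator {1 - t..1} \<rho> *
      emeasure sphere_measure ?E \<partial>lborel)"
    by (rule nn_integral_multc [symmetric]) measurable
  also have "\<dots> \<le> (\<integral>\<^sup>+\<rho>. indicator {0<..<1} \<rho> * ennreal (real (2 * ?N) * \<rho> ^ (2 * ?N - 1)) *
        (\<integral>\<^sup>+\<zeta>. indicator ?A (\<rho> *\<^sub>R \<zeta>) \<partial>sphere_measure) \<partial>lborel)"
  proof (intro nn_integral_mono_AE)
    show "AE \<rho> in lborel. ennreal (real (2 * ?N) * \<rho> ^ (2 * ?N - 1)) * indicator {1 - t..1} \<rho> * emeasure sphere_measure ?E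
      \<le> indicator {0<..<1} \<rho> * ennreal (real (2 * ?N) * \<rho> ^ (2 * ?N - 1)) *
        (\<integral>\<^sup>+\<zeta>. indicator ?A (\<rho> *\<^sub>R \<zeta>) \<partial>sphere_measure)"
      using AE_lborel_singleton [of "1 - t"] AE_lborel_singleton [of 1]
    proof eventually_elim
      case (elim \<rho>)
      show ?case
      proof (cases "1 - t < \<rho> \<and> \<rho> < 1")
        case \<rho>: True
        have sub: "\<rho> *\<^sub>R \<zeta> \<in> ?A" if "\<zeta> \<in> ?E" for \<zeta>
        proof -
          have \<zeta>: "norm \<zeta> = 1" "cmod (1 - cinner \<zeta> w) < t"
            using that by auto
          have eq: "1 - cinner (\<rho> *\<^sub>R \<zeta>) w = (1 - cinner \<zeta> w) + (1 - \<rho>) * cinner \<zeta> w"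
            by (simp add: cinner_scaleR_left algebra_simps)
          have "cmod (1 - cinner (\<rho> *\<^sub>R \<zeta>) w) \<le> cmod (1 - cinner \<zeta> w) + (1 - \<rho>) * cmod (cinner \<zeta> w)"
            unfolding eq using norm_triangle_ineq [of "1 - cinner \<zeta> w" "(1 - \<rho>) * cinner \<zeta> w"] \<rho>
            by (simp add: norm_mult flip: of_real_diff)
          also have "\<dots> < t + t * 1"
            using norm_cinner_le [of \<zeta> w] \<zeta> \<rho> assms
            by (intro add_less_le_mono mult_mono) auto
          finally show ?thesis
            using \<zeta> \<rho> True by simp
        qed
        have "emeasure sphere_measure ?E = (\<integral>\<^sup>+\<zeta>. indicator ?E \<zeta> \<partial>sphere_measure)"
          by simp
        also have "\<dots> \<le> (\<integral>\<^sup>+\<zeta>. indicator ?A (\<rho> *\<^sub>R \<zeta>) \<partial>sphere_measure)"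
          using sub by (intro nn_integral_mono) (auto simp: indicator_def)
        finally show ?thesis
          using \<rho> True by (auto simp: indicator_def intro!: mult_left_mono)
      next
        case False
        then show ?thesis
          using elim by (auto simp: indicator_def)
      qed
    qed
  qed
  also have "\<dots> = (\<integral>\<^sup>+z. indicator ?A z \<partial>ball_measure)"
    by (rule nn_integral_ball_measure_polar [symmetric]) measurable
  also have "\<dots> = emeasure ball_measure ?A"
    by simp
  also have "\<dots> \<le> ennreal (16 ^ ?N * (2 * t) ^ (?N + 1)) * 1"
    using ball_measure_cap [of w "2 * t"] assms by simp
  finally have "emeasure sphere_measure ?E \<le> ennreal (16 ^ ?N * (2 * t) ^ (?N + 1) / t) * 1"
    by (rule ennreal_mult_le_cancel) (use assms in simp_all)
  also have "16 ^ ?N * (2 * t) ^ (?N + 1) / t = 2 * 32 ^ ?N * t ^ ?N"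
    using assms(2) by (simp add: power_mult_distrib flip: power_mult_distrib [of 16 2])
  finally show ?thesis
    by simp
next
  case False
  then have "1 \<le> 2 * 32 ^ CARD('n) * t ^ CARD('n)"
    using mult_mono [of 1 "2 * 32 ^ CARD('n)" 1 "t ^ CARD('n)"] by (simp add: one_le_power mult_ge1_I)
  then have "1 \<le> ennreal (2 * 32 ^ CARD('n) * t ^ CARD('n))"
    by (metis ennreal_1 ennreal_leI)
  with emeasure_sphere_measure_le_1 show ?thesis
    by (rule order.trans)
qed

text \<open>In polar coordinates the slice at radius \<rho> is the spherical cap of \<rho> w, with
  mass of order t^N, and it is empty unless 1 - \<rho> < t. Integrating the weight over this range
  gives t^(s+1) / (s+1), where s > -1 makes the integral converge.\<close>

lemma bergman_measure_cap:
  fixes w :: "complex ^ 'n::finite"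
  assumes "norm w \<le> 1" and "0 < t" and s: "-1 < s"
  shows "(\<integral>\<^sup>+z. ennreal ((1 - (norm z)\<^sup>2) powr s) * indicator {z \<in> unit_ball. cmod (1 - cinner z w) < t} z \<partial>ball_measure)
    \<le> ennreal (4 * real CARD('n) * 32 ^ CARD('n) * max 1 (2 powr s) / (s + 1) * t powr (real CARD('n) + s + 1))"
proof -
  let ?N = "CARD('n)"
  let ?A = "{z \<in> unit_ball. cmod (1 - cinner z w) < t}"
  \<comment> \<open>Collects the bound 2N of the radial density, the bound for (1 + \<rho>)^s and
    the mass of the spherical cap.\<close>
  define c where "c = 2 * real ?N * max 1 (2 powr s) * (2 * 32 ^ ?N * t ^ ?N)"
  have "0 \<le> c"
    using assms(2) by (simp add: c_def)
  have "(\<integral>\<^sup>+z. ennreal ((1 - (norm z)\<^sup>2) powr s) * indicator ?A z \<partial>ball_measure)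
    = (\<integral>\<^sup>+\<rho>. indicator {0<..<1} \<rho> * ennreal (real (2 * ?N) * \<rho> ^ (2 * ?N - 1)) *
        (\<integral>\<^sup>+\<zeta>. ennreal ((1 - (norm (\<rho> *\<^sub>R \<zeta>))\<^sup>2) powr s) * indicator ?A (\<rho> *\<^sub>R \<zeta>) \<partial>sphere_measure) \<partial>lborel)"
    by (rule nn_integral_ball_measure_polar) measurable
  also have "\<dots> \<le> (\<integral>\<^sup>+\<rho>. ennreal c * (ennreal ((1 - \<rho>) powr s) * indicator {0..t} (1 - \<rho>)) \<partial>lborel)"
  proof (rule nn_integral_mono)
    fix \<rho> :: real
    show "indicator {0<..<1} \<rho> * ennreal (real (2 * ?N) * \<rho> ^ (2 * ?N - 1)) *
        (\<integral>\<^sup>+\<zeta>. ennreal ((1 - (norm (\<rho> *\<^sub>R \<zeta>))\<^sup>2) powr s) * indicator ?A (\<rho> *\<^sub>R \<zeta>) \<partial>sphere_measure)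
      \<le> ennreal c * (ennreal ((1 - \<rho>) powr s) * indicator {0..t} (1 - \<rho>))"
    proof (cases "\<rho> \<in> {0<..<1}")
      case True
      have w\<rho>: "norm (\<rho> *\<^sub>R w) \<le> 1"
        using True assms(1) by (simp add: mult_le_one)
      let ?E = "{\<zeta> \<in> unit_sphere. cmod (1 - cinner \<zeta> (\<rho> *\<^sub>R w)) < t}"
      have pt: "ennreal ((1 - (norm (\<rho> *\<^sub>R \<zeta>))\<^sup>2) powr s) * indicator ?A (\<rho> *\<^sub>R \<zeta>)
        \<le> ennreal (max 1 (2 powr s) * (1 - \<rho>) powr s) * indicator {0..t} (1 - \<rho>) * indicator ?E \<zeta>"
        if "\<zeta> \<in> unit_sphere" for \<zeta> :: "complex ^ 'n"
      proof (cases "\<rho> *\<^sub>R \<zeta> \<in> ?A")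
        case A: True
        have "\<rho> * norm w \<le> \<rho>"
          using True assms(1) by (simp add: mult_left_le)
        moreover have "1 - \<rho> * norm w < t"
          using norm_one_minus_cinner_ge [of "\<rho> *\<^sub>R \<zeta>" w] A that True by simp
        ultimately have "1 - \<rho> \<le> t"
          by linarith
        moreover have "\<zeta> \<in> ?E"
          using A that by (simp add: cinner_scaleR_left cinner_scaleR_right)
        moreover have "(1 - \<rho>\<^sup>2) powr s \<le> max 1 (2 powr s) * (1 - \<rho>) powr s"
        proof -
          \<comment> \<open>The factor (1 + \<rho>)^s stays bounded; the maximum with 1 accounts for
            negative s.\<close>
          have "(1 - \<rho>\<^sup>2) powr s = (1 + \<rho>) powr s * (1 - \<rho>) powr s"
            using True by (simp add: power2_eq_square algebra_simps flip: powr_mult)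
          moreover have "(1 + \<rho>) powr s \<le> max 1 (2 powr s)"
          proof (cases "0 \<le> s")
            case s: True
            then have "(1 + \<rho>) powr s \<le> 2 powr s"
              using True by (intro powr_mono2) auto
            then show ?thesis by simp
          next
            case False
            then have "(1 + \<rho>) powr s \<le> 1 powr s"
              using True by (intro powr_mono2') auto
            then show ?thesis by simp
          qed
          ultimately show ?thesis
            by (simp add: mult_right_mono)
        qed
        ultimately show ?thesis
          using True that A by (simp add: ennreal_leI)
      qed simp
      have "(\<integral>\<^sup>+\<zeta>. ennreal ((1 - (norm (\<rho> *\<^sub>R \<zeta>))\<^sup>2) powr s) * indicator ?A (\<rho> *\<^sub>R \<zeta>) \<partial>sphere_measure)
        \<le> (\<integral>\<^sup>+\<zeta>. ennreal (max 1 (2 powr s) * (1 - \<rho>) powr s) * indicator {0..t} (1 - \<rho>) * indicator ?E \<zeta> \<partial>sphere_measure)"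
        by (intro nn_integral_mono_AE eventually_mono [OF AE_sphere_measure] pt)
      also have "\<dots> = ennreal (max 1 (2 powr s) * (1 - \<rho>) powr s) * indicator {0..t} (1 - \<rho>) * emeasure sphere_measure ?E"
        by (rule nn_integral_cmult_indicator) measurable
      also have "\<dots> \<le> ennreal (max 1 (2 powr s) * (1 - \<rho>) powr s) * indicator {0..t} (1 - \<rho>) * ennreal (2 * 32 ^ ?N * t ^ ?N)"
        by (intro mult_left_mono sphere_measure_cap [OF w\<rho> assms(2)]) simp
      finally have "ennreal (real (2 * ?N) * \<rho> ^ (2 * ?N - 1)) *
          (\<integral>\<^sup>+\<zeta>. ennreal ((1 - (norm (\<rho> *\<^sub>R \<zeta>))\<^sup>2) powr s) * indicator ?A (\<rho> *\<^sub>R \<zeta>) \<partial>sphere_measure)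
        \<le> ennreal (real (2 * ?N)) * (ennreal (max 1 (2 powr s) * (1 - \<rho>) powr s) * indicator {0..t} (1 - \<rho>) * ennreal (2 * 32 ^ ?N * t ^ ?N))"
        using True by (intro mult_mono ennreal_leI) (auto simp: mult_left_le power_le_one)
      also have "\<dots> = ennreal c * (ennreal ((1 - \<rho>) powr s) * indicator {0..t} (1 - \<rho>))"
      proof (cases "1 - \<rho> \<le> t")
        case t: True
        have "real (2 * ?N) * (max 1 (2 powr s) * (1 - \<rho>) powr s * (2 * 32 ^ ?N * t ^ ?N)) = c * (1 - \<rho>) powr s"
          by (simp add: c_def)
        then have "ennreal (real (2 * ?N)) * (ennreal (max 1 (2 powr s) * (1 - \<rho>) powr s) * ennreal (2 * 32 ^ ?N * t ^ ?N))
          = ennreal c * ennreal ((1 - \<rho>) powr s)"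
          using \<open>0 \<le> c\<close> ennreal_mult' [of "real (2 * ?N)"] ennreal_mult' [of c]
            ennreal_mult' [of "max 1 (2 powr s) * (1 - \<rho>) powr s"]
          by (metis max.coboundedI1 mult_nonneg_nonneg of_nat_0_le_iff powr_ge_zero zero_le_one)
        then show ?thesis
          using True t by (simp add: indicator_def)
      next
        case False
        then show ?thesis by (simp add: indicator_def)
      qed
      finally show ?thesis
        using True by simp
    qed simp
  qed
  also have "\<dots> = ennreal c * (\<integral>\<^sup>+\<rho>. ennreal ((1 - \<rho>) powr s) * indicator {0..t} (1 - \<rho>) \<partial>lborel)"
    by (rule nn_integral_cmult) measurable
  also have "(\<integral>\<^sup>+\<rho>. ennreal ((1 - \<rho>) powr s) * indicator {0..t} (1 - \<rho>) \<partial>lborel)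
    = (\<integral>\<^sup>+u. ennreal (u powr s) * indicator {0..t} u \<partial>lborel)"
    by (rule nn_integral_lborel_reflect [of "\<lambda>u. ennreal (u powr s) * indicator {0..t} u"]) measurable
  also have "\<dots> = ennreal (t powr (s + 1) / (s + 1))"
    using assms(2) by (intro nn_integral_has_integral_lebesgue' has_integral_powr_from_0 s) auto
  also have "ennreal c * ennreal (t powr (s + 1) / (s + 1))
    = ennreal (4 * real ?N * 32 ^ ?N * max 1 (2 powr s) / (s + 1) * t powr (real ?N + s + 1))"
  proof -
    have "c * (t powr (s + 1) / (s + 1)) = 4 * real ?N * 32 ^ ?N * max 1 (2 powr s) / (s + 1) * t powr (real ?N + s + 1)"
      using assms(2) s by (simp add: c_def powr_add powr_realpow field_simps)
    then show ?thesis
      using \<open>0 \<le> c\<close> s by (simp flip: ennreal_mult)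
  qed
  finally show ?thesis .
qed

section \<open>Test functions\<close>

text \<open>An integer power in the denominator needs no branch of a complex power. The real factor
  balances the growth of the norm as \<open>w\<close> approaches the sphere, and the value 0 outside
  the ball is what \<open>fun_space\<close> demands.\<close>

definition test_function :: "nat \<Rightarrow> real \<Rightarrow> complex ^ 'n::finite \<Rightarrow> complex ^ 'n \<Rightarrow> complex" where
  "test_function m \<alpha> w z = (if z \<in> unit_ball
     then of_real ((1 - (norm w)\<^sup>2) powr (real m - \<alpha> / 2)) / (1 - cinner z w) ^ m else 0)"

lemma one_minus_cinner_nonzero:
  assumes "norm z < 1" "norm w \<le> 1"
  shows "1 - cinner z w \<noteq> 0"
proof -
  have "norm z * norm w < 1"
    using assms by (metis mult_left_le norm_ge_zero order.strict_trans1)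
  then show ?thesis
    using norm_one_minus_cinner_ge [of z w] by auto
qed

lemma several_holomorphic_test_function:
  assumes "w \<in> unit_ball"
  shows "several_holomorphic_on (test_function m \<alpha> w) unit_ball"
  unfolding several_holomorphic_on_def
proof
  fix z assume z: "z \<in> (unit_ball :: (complex ^ 'a) set)"
  define c where "c = complex_of_real ((1 - (norm w)\<^sup>2) powr (real m - \<alpha> / 2))"
  have nz: "1 - cinner z w \<noteq> 0"
    using z assms by (intro one_minus_cinner_nonzero) auto
  have "(\<lambda>x. c / (1 - x) ^ m) field_differentiable at (cinner z w)"
    using nz by (intro derivative_intros) auto
  then obtain D where "((\<lambda>x. c / (1 - x) ^ m) has_field_derivative D) (at (cinner z w))"
    unfolding field_differentiable_def by blast
  then have D: "((\<lambda>x. c / (1 - x) ^ m) has_derivative (*) D) (at (cinner z w))"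
    by (simp add: has_field_derivative_def)
  have "((\<lambda>z. cinner z w) has_derivative (\<lambda>h. cinner h w)) (at z)"
    by (rule bounded_linear_imp_has_derivative [OF bounded_linear_cinner_left])
  from has_derivative_compose [OF this D]
  have "((\<lambda>z. c / (1 - cinner z w) ^ m) has_derivative (\<lambda>h. D * cinner h w)) (at z)" .
  then have "(test_function m \<alpha> w has_derivative (\<lambda>h. D * cinner h w)) (at z)"
    by (rule has_derivative_transform_within_open [OF _ open_ball z])
      (auto simp: test_function_def c_def)
  moreover have "(\<lambda>h. D * cinner h w) = (\<lambda>h. \<Sum>i\<in>UNIV. (\<chi> i. D * cnj (w $ i)) $ i * h $ i)"
    by (simp add: cinner_def sum_distrib_left mult_ac)
  ultimately show "\<exists>a. (test_function m \<alpha> w has_derivative (\<lambda>h. \<Sum>i\<in>UNIV. a $ i * h $ i)) (at z)"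
    by metis
qed

lemma norm_test_function:
  assumes "z \<in> unit_ball" "w \<in> unit_ball"
  shows "(cmod (test_function m \<alpha> w z))\<^sup>2
    = (1 - (norm w)\<^sup>2) powr (real (2 * m) - \<alpha>) * cmod (1 - cinner z w) powr - real (2 * m)"
proof -
  have "1 - cinner z w \<noteq> 0"
    using assms by (intro one_minus_cinner_nonzero) auto
  then have pos: "0 < cmod (1 - cinner z w)"
    by (simp only: zero_less_norm_iff not_False_eq_True)
  have "((1 - (norm w)\<^sup>2) powr (real m - \<alpha> / 2))\<^sup>2 = (1 - (norm w)\<^sup>2) powr (real (2 * m) - \<alpha>)"
    by (simp add: power2_eq_square flip: powr_add)
  moreover from pos have "cmod (1 - cinner z w) powr - real (2 * m) = 1 / (cmod (1 - cinner z w) ^ m)\<^sup>2"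
    by (simp only: powr_minus_divide powr_realpow power_mult mult.commute [of 2 m])
  ultimately show ?thesis
    using assms by (simp add: test_function_def norm_divide norm_power power_divide)
qed

text \<open>The numerator of the squared test function cancels the blow-up of the integral of the
  negative kernel power, up to a power of 1 + |w|. This makes the norm bounds uniform in
  \<open>w\<close>.\<close>

lemma weight_le:
  fixes w :: "complex ^ 'n::finite"
  assumes "w \<in> unit_ball" and "\<alpha> \<le> p"
  shows "(1 - (norm w)\<^sup>2) powr (p - \<alpha>) * (1 - norm w) powr (\<alpha> - p) \<le> 2 powr (p - \<alpha>)"
proof -
  have w: "0 < 1 - norm w"
    using assms by simp
  have "(1 - (norm w)\<^sup>2) powr (p - \<alpha>) = (1 + norm w) powr (p - \<alpha>) * (1 - norm w) powr (p - \<alpha>)"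
    using w by (simp add: power2_eq_square algebra_simps flip: powr_mult)
  moreover have "(1 - norm w) powr (p - \<alpha>) * (1 - norm w) powr (\<alpha> - p) = 1"
    using w by (simp flip: powr_add)
  moreover have "(1 + norm w) powr (p - \<alpha>) \<le> 2 powr (p - \<alpha>)"
    using w assms(2) by (intro powr_mono2) auto
  ultimately show ?thesis
    by (simp add: mult.assoc)
qed

text \<open>Since the dilation by \<open>r\<close> can be moved from the point to \<open>w\<close>,
  each circle of radii reduces to a spherical integral with \<delta> = 1 - |w| and p = 2 m. The caps
  have exponent N, and the resulting bound is free of \<open>r\<close>.\<close>

lemma test_function_hardy:
  fixes w :: "complex ^ 'n::finite"
  assumes w: "w \<in> unit_ball" and m: "real CARD('n) + 1 \<le> real (2 * m)"
  shows "sq_norm Hardy (test_function m (real CARD('n)) w)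
    \<le> ennreal (2 * 32 ^ CARD('n) * 2 powr (real CARD('n) + 1) * 2 powr (real (2 * m) - real CARD('n)))"
proof -
  let ?N = "real CARD('n)" and ?p = "real (2 * m)"
  define k where "k = (1 - (norm w)\<^sup>2) powr (?p - ?N)"
  have "(\<integral>\<^sup>+\<zeta>\<in>unit_sphere. ennreal ((cmod (test_function m ?N w (r *\<^sub>R \<zeta>)))\<^sup>2) \<partial>sphere_measure)
    \<le> ennreal (2 * 32 ^ CARD('n) * 2 powr (?N + 1) * 2 powr (?p - ?N))" if r: "r \<in> {0<..<1}" for r
  proof -
    let ?h = "\<lambda>\<zeta>. cmod (1 - cinner \<zeta> (r *\<^sub>R w))"
    have rw: "norm (r *\<^sub>R w) \<le> norm w"
      using r by (simp add: mult_left_le_one_le)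
    have int: "(\<integral>\<^sup>+\<zeta>. ennreal (?h \<zeta> powr - ?p) \<partial>sphere_measure)
      \<le> ennreal (2 * 32 ^ CARD('n) * 2 powr (?N + 1) * (1 - norm w) powr (?N - ?p))"
    proof (rule nn_integral_inverse_power_le)
      show "AE \<zeta> in sphere_measure. 1 - norm w \<le> ?h \<zeta>"
        using AE_sphere_measure
      proof eventually_elim
        case (elim \<zeta>)
        then show ?case
          using norm_one_minus_cinner_ge [of \<zeta> "r *\<^sub>R w"] rw by simp
      qed
      fix t :: real assume "0 < t"
      have "emeasure sphere_measure {\<zeta> \<in> space sphere_measure. ?h \<zeta> < t}
        = emeasure sphere_measure {\<zeta> \<in> unit_sphere. ?h \<zeta> < t}"
        by (intro emeasure_eq_AE) (use AE_sphere_measure in \<open>auto elim!: eventually_mono\<close>)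
      also have "\<dots> \<le> ennreal (2 * 32 ^ CARD('n) * t ^ CARD('n))"
        using rw w \<open>0 < t\<close> by (intro sphere_measure_cap) auto
      finally show "emeasure sphere_measure {\<zeta> \<in> space sphere_measure. ?h \<zeta> < t}
        \<le> ennreal (2 * 32 ^ CARD('n) * t powr ?N)"
        using \<open>0 < t\<close> by (simp add: powr_realpow)
    qed (use m w in auto)
    have "(\<integral>\<^sup>+\<zeta>\<in>unit_sphere. ennreal ((cmod (test_function m ?N w (r *\<^sub>R \<zeta>)))\<^sup>2) \<partial>sphere_measure)
      \<le> (\<integral>\<^sup>+\<zeta>. ennreal k * ennreal (?h \<zeta> powr - ?p) \<partial>sphere_measure)"
    proof (rule nn_integral_mono)
      fix \<zeta> :: "complex ^ 'n"
      show "ennreal ((cmod (test_function m ?N w (r *\<^sub>R \<zeta>)))\<^sup>2) * indicator unit_sphere \<zeta>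
        \<le> ennreal k * ennreal (?h \<zeta> powr - ?p)"
      proof (cases "\<zeta> \<in> unit_sphere")
        case True
        then have "r *\<^sub>R \<zeta> \<in> unit_ball"
          using r by simp
        from norm_test_function [OF this w, of m ?N] show ?thesis
          using True by (simp add: k_def cinner_scaleR_left cinner_scaleR_right ennreal_mult)
      qed simp
    qed
    also have "\<dots> = ennreal k * (\<integral>\<^sup>+\<zeta>. ennreal (?h \<zeta> powr - ?p) \<partial>sphere_measure)"
      by (rule nn_integral_cmult) measurable
    also have "\<dots> \<le> ennreal k * ennreal (2 * 32 ^ CARD('n) * 2 powr (?N + 1) * (1 - norm w) powr (?N - ?p))"
      by (intro mult_left_mono int) simp
    also have "\<dots> = ennreal (2 * 32 ^ CARD('n) * 2 powr (?N + 1) * (k * (1 - norm w) powr (?N - ?p)))"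
      by (simp add: k_def mult_ac flip: ennreal_mult)
    also have "\<dots> \<le> ennreal (2 * 32 ^ CARD('n) * 2 powr (?N + 1) * 2 powr (?p - ?N))"
      unfolding k_def using m by (intro ennreal_leI mult_left_mono weight_le w) auto
    finally show ?thesis .
  qed
  then show ?thesis
    by (simp add: SUP_le_iff)
qed

text \<open>The same argument as on the sphere, with cap exponent N + s + 1.\<close>

lemma test_function_bergman:
  fixes w :: "complex ^ 'n::finite"
  assumes w: "w \<in> unit_ball" and m: "real CARD('n) + s + 1 + 1 \<le> real (2 * m)" and s: "-1 < s"
  shows "sq_norm (Bergman s) (test_function m (real CARD('n) + s + 1) w)
    \<le> ennreal (Gamma (real CARD('n) + s + 1) / (Gamma (real CARD('n) + 1) * Gamma (s + 1)) *
      (4 * real CARD('n) * 32 ^ CARD('n) * max 1 (2 powr s) / (s + 1)) *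
      2 powr (real CARD('n) + s + 1 + 1) * 2 powr (real (2 * m) - (real CARD('n) + s + 1)))"
proof -
  define \<alpha> where "\<alpha> = real CARD('n) + s + 1"
  define p where "p = real (2 * m)"
  define k where "k = (1 - (norm w)\<^sup>2) powr (p - \<alpha>)"
  define C where "C = 4 * real CARD('n) * 32 ^ CARD('n) * max 1 (2 powr s) / (s + 1)"
  define \<kappa> where "\<kappa> = Gamma \<alpha> / (Gamma (real CARD('n) + 1) * Gamma (s + 1))"
  have \<kappa>: "0 < \<kappa>"
    unfolding \<kappa>_def \<alpha>_def using s by (rule bergman_weight_const_pos)
  have C: "0 \<le> C"
    using s by (simp add: C_def)
  let ?h = "\<lambda>z. cmod (1 - cinner z w)"
  let ?f = "\<lambda>z :: complex ^ 'n. ennreal ((1 - (norm z)\<^sup>2) powr s) * indicator unit_ball z"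
  \<comment> \<open>Absorbing the weight into the measure brings the integral into the form of the
    dyadic estimate.\<close>
  define M where "M = density ball_measure ?f"
  have [measurable]: "?f \<in> borel_measurable ball_measure"
    by measurable
  have sets_M [measurable_cong, simp]: "sets M = sets borel" and space_M [simp]: "space M = UNIV"
    by (simp_all add: M_def)
  have int: "(\<integral>\<^sup>+z. ennreal (?h z powr - p) \<partial>M) \<le> ennreal (C * 2 powr (\<alpha> + 1) * (1 - norm w) powr (\<alpha> - p))"
  proof (rule nn_integral_inverse_power_le)
    show "AE z in M. 1 - norm w \<le> ?h z"
      unfolding M_def
    proof (subst AE_density)
      show "AE z in ball_measure. 0 < ?f z \<longrightarrow> 1 - norm w \<le> ?h z"
        using AE_ball_measure
      proof eventually_elim
        case (elim z)
        then have "norm z * norm w \<le> norm w"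
          by (simp add: mult_left_le_one_le)
        then show ?case
          using norm_one_minus_cinner_ge [of z w] by linarith
      qed
    qed measurable
    fix t :: real assume t: "0 < t"
    have "emeasure M {z \<in> space M. ?h z < t}
      = (\<integral>\<^sup>+z. ?f z * indicator {z. ?h z < t} z \<partial>ball_measure)"
      unfolding M_def by (subst emeasure_density) (auto simp: space_ball_measure)
    also have "\<dots> = (\<integral>\<^sup>+z. ennreal ((1 - (norm z)\<^sup>2) powr s) * indicator {z \<in> unit_ball. ?h z < t} z \<partial>ball_measure)"
      by (rule nn_integral_cong) (auto simp: indicator_def)
    also have "\<dots> \<le> ennreal (C * t powr \<alpha>)"
      unfolding C_def \<alpha>_def using w by (intro bergman_measure_cap t s) auto
    finally show "emeasure M {z \<in> space M. ?h z < t} \<le> ennreal (C * t powr \<alpha>)" .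
  qed (use m w C in \<open>auto simp: \<alpha>_def p_def\<close>)
  have "sq_norm (Bergman s) (test_function m \<alpha> w) \<le> (\<integral>\<^sup>+z. ennreal (\<kappa> * k) * (?f z * ennreal (?h z powr - p)) \<partial>ball_measure)"
    unfolding sq_norm.simps
  proof (rule nn_integral_mono)
    fix z :: "complex ^ 'n"
    show "ennreal ((cmod (test_function m \<alpha> w z))\<^sup>2 * bergman_weight s z) * indicator unit_ball z
      \<le> ennreal (\<kappa> * k) * (?f z * ennreal (?h z powr - p))"
    proof (cases "z \<in> unit_ball")
      case True
      have "(cmod (test_function m \<alpha> w z))\<^sup>2 * bergman_weight s z
        = \<kappa> * k * ((1 - (norm z)\<^sup>2) powr s * ?h z powr - p)"
        unfolding norm_test_function [OF True w] by (simp add: bergman_weight_def \<kappa>_def \<alpha>_def k_def p_def)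
      then show ?thesis
        using True \<kappa> by (simp add: ennreal_mult k_def)
    qed simp
  qed
  also have "\<dots> = ennreal (\<kappa> * k) * (\<integral>\<^sup>+z. ?f z * ennreal (?h z powr - p) \<partial>ball_measure)"
    by (rule nn_integral_cmult) measurable
  also have "(\<integral>\<^sup>+z. ?f z * ennreal (?h z powr - p) \<partial>ball_measure) = (\<integral>\<^sup>+z. ennreal (?h z powr - p) \<partial>M)"
    unfolding M_def by (subst nn_integral_density) measurable
  also have "ennreal (\<kappa> * k) * \<dots> \<le> ennreal (\<kappa> * k) * ennreal (C * 2 powr (\<alpha> + 1) * (1 - norm w) powr (\<alpha> - p))"
    by (intro mult_left_mono int) simp
  also have "\<dots> = ennreal (\<kappa> * C * 2 powr (\<alpha> + 1) * (k * (1 - norm w) powr (\<alpha> - p)))"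
    using \<kappa> C by (simp add: k_def mult_ac flip: ennreal_mult)
  also have "\<dots> \<le> ennreal (\<kappa> * C * 2 powr (\<alpha> + 1) * 2 powr (p - \<alpha>))"
    unfolding k_def using m \<kappa> C by (intro ennreal_leI mult_left_mono weight_le w) (auto simp: \<alpha>_def p_def)
  finally show ?thesis
    unfolding \<kappa>_def \<alpha>_def p_def C_def .
qed

text \<open>The condition on \<open>m\<close> is the one under which the dyadic series converges
  with p = 2 m. The constant may depend on \<open>m\<close> but not on \<open>w\<close>.\<close>

lemma test_function_bounded:
  assumes "admissible H" and "kernel_exponent CARD('n::finite) H + 1 \<le> real (2 * m)"
  shows "\<exists>K. \<forall>w :: complex ^ 'n \<in> unit_ball.
    test_function m (kernel_exponent CARD('n) H) w \<in> fun_space H \<and>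
    space_norm H (test_function m (kernel_exponent CARD('n) H) w) \<le> K"
proof -
  let ?\<alpha> = "kernel_exponent CARD('n) H"
  have "\<exists>K\<ge>0. \<forall>w :: complex ^ 'n \<in> unit_ball. sq_norm H (test_function m ?\<alpha> w) \<le> ennreal K"
  proof (cases H)
    case Hardy
    then show ?thesis
      using test_function_hardy [where 'n = 'n] assms(2)
      by (intro exI [of _ "2 * 32 ^ CARD('n) * 2 powr (real CARD('n) + 1) * 2 powr (real (2 * m) - real CARD('n))"])
        (simp del: sq_norm.simps)
  next
    case (Bergman s)
    then have s: "-1 < s"
      using assms(1) by (auto simp: admissible_def)
    show ?thesis
      using test_function_bergman [where 'n = 'n, OF _ _ s] assms(2) Bergman bergman_weight_const_pos [OF s, of "CARD('n)"] s
      by (intro exI [of _ "Gamma (real CARD('n) + s + 1) / (Gamma (real CARD('n) + 1) * Gamma (s + 1)) *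
        (4 * real CARD('n) * 32 ^ CARD('n) * max 1 (2 powr s) / (s + 1)) *
        2 powr (real CARD('n) + s + 1 + 1) * 2 powr (real (2 * m) - (real CARD('n) + s + 1))"] conjI mult_nonneg_nonneg)
        (simp_all del: sq_norm.simps)
  qed
  then obtain K where K: "0 \<le> K" "\<And>w :: complex ^ 'n. w \<in> unit_ball \<Longrightarrow> sq_norm H (test_function m ?\<alpha> w) \<le> ennreal K"
    by blast
  have "test_function m ?\<alpha> w \<in> fun_space H \<and> space_norm H (test_function m ?\<alpha> w) \<le> sqrt K"
    if w: "w \<in> unit_ball" for w :: "complex ^ 'n"
  proof
    show "test_function m ?\<alpha> w \<in> fun_space H"
      using several_holomorphic_test_function [OF w] le_less_trans [OF K(2) [OF w]]
      by (auto simp: fun_space_def test_function_def [of _ _ _ z for z] simp del: sq_norm.simps)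
    have "enn2real (sq_norm H (test_function m ?\<alpha> w)) \<le> K"
      using enn2real_mono [OF K(2) [OF w]] K(1) by simp
    then show "space_norm H (test_function m ?\<alpha> w) \<le> sqrt K"
      by (simp add: space_norm_def)
  qed
  then show ?thesis
    by blast
qed

section \<open>Compact differences\<close>

lemma several_holomorphic_on_diff:
  assumes "several_holomorphic_on f S" "several_holomorphic_on g S"
  shows "several_holomorphic_on (\<lambda>z. f z - g z) S"
  unfolding several_holomorphic_on_def
proof
  fix z assume "z \<in> S"
  then obtain a b where "(f has_derivative (\<lambda>h. \<Sum>i\<in>UNIV. a $ i * h $ i)) (at z)"
    "(g has_derivative (\<lambda>h. \<Sum>i\<in>UNIV. b $ i * h $ i)) (at z)"
    using assms unfolding several_holomorphic_on_def by blast
  then have "((\<lambda>z. f z - g z) has_derivative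
      (\<lambda>h. (\<Sum>i\<in>UNIV. a $ i * h $ i) - (\<Sum>i\<in>UNIV. b $ i * h $ i))) (at z)"
    by (rule has_derivative_diff)
  then show "\<exists>a. ((\<lambda>z. f z - g z) has_derivative (\<lambda>h. \<Sum>i\<in>UNIV. a $ i * h $ i)) (at z)"
    by (intro exI [of _ "a - b"]) (simp add: left_diff_distrib sum_subtractf)
qed

lemma cmod_diff_squared_le: "(cmod (a - b))\<^sup>2 \<le> 2 * (cmod a)\<^sup>2 + 2 * (cmod b)\<^sup>2"
proof -
  have "(cmod (a - b))\<^sup>2 \<le> (cmod a + cmod b)\<^sup>2"
    by (intro power_mono norm_triangle_ineq4) simp
  also have "\<dots> \<le> 2 * (cmod a)\<^sup>2 + 2 * (cmod b)\<^sup>2"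
    using sum_squares_bound [of "cmod a" "cmod b"] by (simp add: power2_sum)
  finally show ?thesis .
qed

text \<open>A crude constant suffices: the estimate only serves to show that differences have finite
  norm.\<close>

lemma sq_norm_diff_le:
  fixes f g :: "complex ^ 'n::finite \<Rightarrow> complex"
  assumes H: "admissible H" and [measurable]: "f \<in> borel_measurable borel" "g \<in> borel_measurable borel"
  shows "sq_norm H (\<lambda>z. f z - g z) \<le> 2 * sq_norm H f + 2 * sq_norm H g"
proof -
  have pt: "ennreal ((cmod (a - b))\<^sup>2) \<le> 2 * ennreal ((cmod a)\<^sup>2) + 2 * ennreal ((cmod b)\<^sup>2)" for a b
    using ennreal_leI [OF cmod_diff_squared_le [of a b]] by (simp add: ennreal_mult)
  show ?thesis
  proof (cases H)
    case Hardy
    show ?thesis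
      unfolding Hardy sq_norm.simps
    proof (rule SUP_least)
      fix r :: real assume r: "r \<in> {0<..<1}"
      have "(\<integral>\<^sup>+\<zeta>\<in>unit_sphere. ennreal ((cmod (f (r *\<^sub>R \<zeta>) - g (r *\<^sub>R \<zeta>)))\<^sup>2) \<partial>sphere_measure)
        \<le> (\<integral>\<^sup>+\<zeta>. 2 * (ennreal ((cmod (f (r *\<^sub>R \<zeta>)))\<^sup>2) * indicator unit_sphere \<zeta>)
            + 2 * (ennreal ((cmod (g (r *\<^sub>R \<zeta>)))\<^sup>2) * indicator unit_sphere \<zeta>) \<partial>sphere_measure)"
        using pt by (intro nn_integral_mono) (simp add: indicator_def)
      also have "\<dots> = 2 * (\<integral>\<^sup>+\<zeta>\<in>unit_sphere. ennreal ((cmod (f (r *\<^sub>R \<zeta>)))\<^sup>2) \<partial>sphere_measure)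
          + 2 * (\<integral>\<^sup>+\<zeta>\<in>unit_sphere. ennreal ((cmod (g (r *\<^sub>R \<zeta>)))\<^sup>2) \<partial>sphere_measure)"
        by (subst nn_integral_add) (simp_all add: nn_integral_cmult)
      also have "\<dots> \<le> 2 * (SUP r\<in>{0<..<1::real}. \<integral>\<^sup>+\<zeta>\<in>unit_sphere. ennreal ((cmod (f (r *\<^sub>R \<zeta>)))\<^sup>2) \<partial>sphere_measure)
          + 2 * (SUP r\<in>{0<..<1::real}. \<integral>\<^sup>+\<zeta>\<in>unit_sphere. ennreal ((cmod (g (r *\<^sub>R \<zeta>)))\<^sup>2) \<partial>sphere_measure)"
        using r by (intro add_mono mult_left_mono SUP_upper) auto
      finally show "(\<integral>\<^sup>+\<zeta>\<in>unit_sphere. ennreal ((cmod (f (r *\<^sub>R \<zeta>) - g (r *\<^sub>R \<zeta>)))\<^sup>2) \<partial>sphere_measure)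
        \<le> 2 * (SUP r\<in>{0<..<1::real}. \<integral>\<^sup>+\<zeta>\<in>unit_sphere. ennreal ((cmod (f (r *\<^sub>R \<zeta>)))\<^sup>2) \<partial>sphere_measure)
          + 2 * (SUP r\<in>{0<..<1::real}. \<integral>\<^sup>+\<zeta>\<in>unit_sphere. ennreal ((cmod (g (r *\<^sub>R \<zeta>)))\<^sup>2) \<partial>sphere_measure)" .
    qed
  next
    case (Bergman s)
    then have s: "-1 < s"
      using H by (auto simp: admissible_def)
    have w: "0 \<le> bergman_weight s z" for z :: "complex ^ 'n"
      unfolding bergman_weight_def using bergman_weight_const_pos [OF s, of "CARD('n)"]
      by (intro mult_nonneg_nonneg) auto
    have [measurable]: "bergman_weight s \<in> borel_measurable (borel :: (complex ^ 'n) measure)"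
      unfolding bergman_weight_def by measurable
    have pt: "ennreal ((cmod (a - b))\<^sup>2 * bergman_weight s z)
      \<le> 2 * ennreal ((cmod a)\<^sup>2 * bergman_weight s z) + 2 * ennreal ((cmod b)\<^sup>2 * bergman_weight s z)"
      for a b and z :: "complex ^ 'n"
      using mult_right_mono [OF pt [of a b], of "ennreal (bergman_weight s z)"] w [of z]
      by (simp add: ennreal_mult distrib_right mult.assoc)
    have "sq_norm H (\<lambda>z. f z - g z)
      \<le> (\<integral>\<^sup>+z. 2 * (ennreal ((cmod (f z))\<^sup>2 * bergman_weight s z) * indicator unit_ball z)
          + 2 * (ennreal ((cmod (g z))\<^sup>2 * bergman_weight s z) * indicator unit_ball z) \<partial>ball_measure)"
      unfolding Bergman sq_norm.simps using pt by (intro nn_integral_mono) (simp add: indicator_def)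
    also have "\<dots> = 2 * sq_norm H f + 2 * sq_norm H g"
      by (subst nn_integral_add) (simp_all add: nn_integral_cmult Bergman)
    finally show ?thesis .
  qed
qed

lemma fun_space_diff:
  assumes "admissible H" "f \<in> fun_space H" "g \<in> fun_space H"
  shows "(\<lambda>z. f z - g z) \<in> fun_space H"
proof -
  have "sq_norm H (\<lambda>z. f z - g z) \<le> 2 * sq_norm H f + 2 * sq_norm H g"
    using assms by (intro sq_norm_diff_le fun_space_measurable)
  also have "\<dots> < \<infinity>"
    using fun_spaceD(3) [OF assms(2)] fun_spaceD(3) [OF assms(3)] by (simp add: ennreal_mult_less_top)
  finally have "sq_norm H (\<lambda>z. f z - g z) < \<infinity>" .
  then show ?thesis
    using several_holomorphic_on_diff [OF fun_spaceD(1) [OF assms(2)] fun_spaceD(1) [OF assms(3)]]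
      fun_spaceD(2) [OF assms(2)] fun_spaceD(2) [OF assms(3)]
    by (simp add: fun_space_def)
qed

lemma space_norm_minus_commute: "space_norm H (\<lambda>z. f z - g z) = space_norm H (\<lambda>z. g z - f z)"
  unfolding space_norm_def by (cases H) (simp_all add: norm_minus_commute)

text \<open>Negating the limit functions keeps the subsequences. This supplies the symmetry between
  \<phi> and \<psi>.\<close>

lemma compact_op_diff_commute:
  fixes S T :: "(complex ^ 'n::finite \<Rightarrow> complex) \<Rightarrow> complex ^ 'n \<Rightarrow> complex"
  assumes H: "admissible H" and "compact_op H (\<lambda>f z. S f z - T f z)"
  shows "compact_op H (\<lambda>f z. T f z - S f z)"
proof -
  \<comment> \<open>The negative of g is (g - g) - g, so closure under differences is
    enough.\<close>
  have neg: "(\<lambda>z. - g z) \<in> fun_space H" if "g \<in> fun_space H" for g :: "complex ^ 'n \<Rightarrow> complex"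
    using fun_space_diff [OF H fun_space_diff [OF H that that] that] by simp
  show ?thesis
    unfolding compact_op_def
  proof (intro conjI allI impI)
    show "(\<lambda>f z. T f z - S f z) ` fun_space H \<subseteq> fun_space H"
    proof clarify
      fix f :: "complex ^ 'n \<Rightarrow> complex" assume "f \<in> fun_space H"
      then have "(\<lambda>z. S f z - T f z) \<in> fun_space H"
        using assms(2) by (auto simp: compact_op_def)
      from neg [OF this] show "(\<lambda>z. T f z - S f z) \<in> fun_space H"
        by simp
    qed
    fix f :: "nat \<Rightarrow> complex ^ 'n \<Rightarrow> complex"
    assume "(\<forall>k. f k \<in> fun_space H) \<and> (\<exists>K. \<forall>k. space_norm H (f k) \<le> K)"
    then obtain g u where g: "g \<in> fun_space H" and u: "strict_mono u"
      and lim: "(\<lambda>k. space_norm H (\<lambda>z. (S (f (u k)) z - T (f (u k)) z) - g z)) \<longlonglongrightarrow> 0"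
      using assms(2) [unfolded compact_op_def, THEN conjunct2, rule_format, of f] by blast
    have "space_norm H (\<lambda>z. (S (f (u k)) z - T (f (u k)) z) - g z)
      = space_norm H (\<lambda>z. (T (f (u k)) z - S (f (u k)) z) - (- g z))" for k
      using space_norm_minus_commute [of H "\<lambda>z. S (f (u k)) z - T (f (u k)) z" g]
      by (simp add: algebra_simps)
    with lim have "(\<lambda>k. space_norm H (\<lambda>z. (T (f (u k)) z - S (f (u k)) z) - (- g z))) \<longlonglongrightarrow> 0"
      by simp
    with neg [OF g] u show "\<exists>g\<in>fun_space H. \<exists>u. strict_mono u \<and>
        (\<lambda>k. space_norm H (\<lambda>z. T (f (u k)) z - S (f (u k)) z - g z)) \<longlonglongrightarrow> 0"
      by (intro bexI [of _ "\<lambda>z. - g z"] exI [of _ u] conjI)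
  qed
qed

section \<open>Test functions centred near the sphere and the limit of kernel quotients\<close>

lemma kernel_exponent_pos: "admissible H \<Longrightarrow> 0 < kernel_exponent CARD('n::finite) H"
  using add_less_le_mono [of "-1" s 1 "real CARD('n)" for s] by (auto simp: admissible_def)

text \<open>The exponent m - \<alpha>/2 of the vanishing numerator is positive, while the
  denominator at a fixed \<open>z\<close> keeps modulus at least (1 - |z|)^m.\<close>

lemma test_function_tendsto_0:
  fixes w :: "nat \<Rightarrow> complex ^ 'n::finite"
  assumes w: "\<And>k. w k \<in> unit_ball" "(\<lambda>k. norm (w k)) \<longlonglongrightarrow> 1" and m: "\<alpha> < real (2 * m)"
  shows "(\<lambda>k. test_function m \<alpha> (w k) z) \<longlonglongrightarrow> 0"
proof (cases "z \<in> unit_ball")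
  case True
  have "(\<lambda>k. (1 - (norm (w k))\<^sup>2) powr (real m - \<alpha> / 2)) \<longlonglongrightarrow> 0"
  proof (rule tendsto_zero_powrI)
    show "(\<lambda>k. 1 - (norm (w k))\<^sup>2) \<longlonglongrightarrow> 0"
      using tendsto_diff [OF tendsto_const [of 1] tendsto_power [OF w(2), of 2]] by simp
  qed (use m w(1) in \<open>auto simp: power_le_one less_imp_le\<close>)
  then have lim: "(\<lambda>k. (1 - (norm (w k))\<^sup>2) powr (real m - \<alpha> / 2) / (1 - norm z) ^ m) \<longlonglongrightarrow> 0"
    using tendsto_divide_zero by blast
  show ?thesis
  proof (rule Lim_null_comparison [OF _ lim], rule always_eventually, rule allI)
    fix k
    have "norm z * norm (w k) \<le> norm z"
      using w(1) [of k] by (simp add: mult_left_le)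
    then have "1 - norm z \<le> cmod (1 - cinner z (w k))"
      using norm_one_minus_cinner_ge [of z "w k"] by linarith
    then have "(1 - norm z) ^ m \<le> cmod (1 - cinner z (w k)) ^ m"
      using True by (intro power_mono) auto
    then show "norm (test_function m \<alpha> (w k) z)
      \<le> (1 - (norm (w k))\<^sup>2) powr (real m - \<alpha> / 2) / (1 - norm z) ^ m"
      using True by (simp add: test_function_def norm_divide norm_power frac_le)
  qed
qed (simp add: test_function_def)

text \<open>At its own centre the test function has the value (1 - |w|^2)^(-\<alpha>/2). Taking this
  factor out of the difference leaves 1 minus a power of the kernel quotient.\<close>

lemma test_function_difference:
  fixes v w :: "complex ^ 'n::finite"
  assumes v: "v \<in> unit_ball" and w: "w \<in> unit_ball"
  shows "(cmod (1 - (of_real (1 - (norm w)\<^sup>2) / (1 - cinner v w)) ^ m))\<^sup>2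
    = (cmod (test_function m \<alpha> w w - test_function m \<alpha> w v))\<^sup>2 * (1 - (norm w)\<^sup>2) powr \<alpha>"
proof -
  define s where "s = 1 - (norm w)\<^sup>2"
  have s: "0 < s"
    using w by (simp add: s_def abs_square_less_1)
  have ww: "1 - cinner w w = of_real s"
    by (simp add: s_def cinner_self)
  let ?x = "of_real s / (1 - cinner v w)"
  have "test_function m \<alpha> w w - test_function m \<alpha> w v = of_real (s powr (real m - \<alpha> / 2) / s ^ m) * (1 - ?x ^ m)"
    using v w s ww by (simp add: test_function_def power_divide right_diff_distrib flip: s_def)
  moreover have "s powr (real m - \<alpha> / 2) / s ^ m = s powr (- \<alpha> / 2)"
    using s by (simp add: powr_realpow [symmetric] flip: powr_diff)
  ultimately have "(cmod (test_function m \<alpha> w w - test_function m \<alpha> w v))\<^sup>2 * s powr \<alpha>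
    = (cmod (1 - ?x ^ m))\<^sup>2 * ((s powr (- \<alpha> / 2))\<^sup>2 * s powr \<alpha>)"
    by (simp add: norm_mult power_mult_distrib)
  also have "(s powr (- \<alpha> / 2))\<^sup>2 * s powr \<alpha> = 1"
    using s by (simp add: power2_eq_square flip: powr_add)
  finally show ?thesis
    by (simp add: s_def)
qed

text \<open>Compactness yields norm convergence along a subsequence only. The hypothesis with
  \<open>K\<close> lets the evaluation bound at \<open>z k\<close>, weighted by a power of 1 - |z
  k|, control the quantity weighted by a power of 1 - |\<phi>(z k)|^2.\<close>

lemma compact_difference_power_limit:
  fixes \<phi> \<psi> :: "complex ^ 'n::finite \<Rightarrow> complex ^ 'n" and z :: "nat \<Rightarrow> complex ^ 'n"
  assumes H: "admissible H" and \<phi>: "\<phi> ` unit_ball \<subseteq> unit_ball" and \<psi>: "\<psi> ` unit_ball \<subseteq> unit_ball"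
    and compact: "compact_op H (\<lambda>f z. comp_op \<phi> f z - comp_op \<psi> f z)"
    and z: "\<And>k. z k \<in> unit_ball" "(\<lambda>k. norm (\<phi> (z k))) \<longlonglongrightarrow> 1"
    and K: "0 \<le> K" "\<forall>\<^sub>F k in sequentially. 1 - norm (\<phi> (z k)) \<le> K * (1 - norm (z k))"
    and m: "kernel_exponent CARD('n) H + 1 \<le> real (2 * m)"
  shows "\<exists>u. strict_mono u \<and> (\<lambda>k. (of_real (1 - (norm (\<phi> (z (u k))))\<^sup>2) /
    (1 - cinner (\<psi> (z (u k))) (\<phi> (z (u k))))) ^ m) \<longlonglongrightarrow> 1"
proof -
  define \<alpha> where "\<alpha> = kernel_exponent CARD('n) H"
  have \<alpha>: "0 < \<alpha>"
    unfolding \<alpha>_def by (rule kernel_exponent_pos [OF H])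
  define w where "w k = \<phi> (z k)" for k
  define v where "v k = \<psi> (z k)" for k
  have w: "w k \<in> unit_ball" and v: "v k \<in> unit_ball" for k
    unfolding w_def v_def using \<phi> \<psi> z(1) [of k] by blast+
  define f where "f k = test_function m \<alpha> (w k)" for k
  define T where "T g x = comp_op \<phi> g x - comp_op \<psi> g x" for g x
  have compT: "compact_op H T"
    using compact by (simp add: T_def [abs_def])
  obtain B where B: "\<And>k. f k \<in> fun_space H" "\<And>k. space_norm H (f k) \<le> B"
    using test_function_bounded [OF H m] w unfolding f_def \<alpha>_def by meson
  then have "(\<forall>k. f k \<in> fun_space H) \<and> (\<exists>K. \<forall>k. space_norm H (f k) \<le> K)"
    by blast
  then obtain g u where g: "g \<in> fun_space H" and u: "strict_mono u"
    and lim: "(\<lambda>k. space_norm H (\<lambda>x. T (f (u k)) x - g x)) \<longlonglongrightarrow> 0"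
    using compT [unfolded compact_op_def, THEN conjunct2, rule_format, of f] by blast
  have Tf: "T (f k) \<in> fun_space H" for k
    using compT B(1) by (auto simp: compact_op_def)
  obtain C where C: "0 \<le> C" "\<And>h x. h \<in> fun_space H \<Longrightarrow> (x :: complex ^ 'n) \<in> unit_ball \<Longrightarrow>
    (cmod (h x))\<^sup>2 * (1 - norm x) powr \<alpha> \<le> C * (space_norm H h)\<^sup>2"
    using point_evaluation_bound [OF H, where 'n = 'n] unfolding \<alpha>_def by blast
  have lim2: "(\<lambda>k. c * (space_norm H (\<lambda>x. T (f (u k)) x - g x))\<^sup>2) \<longlonglongrightarrow> 0" for c
    using tendsto_mult [OF tendsto_const [of c] tendsto_power [OF lim, of 2]] by simp
  \<comment> \<open>Norm convergence gives pointwise convergence to \<open>g\<close>, while the test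
    functions at the two fixed points \<phi> x and \<psi> x tend to 0.\<close>
  have "g x = 0" for x
  proof (cases "x \<in> unit_ball")
    case x: True
    have pos: "0 < (1 - norm x) powr \<alpha>"
      using x by simp
    have sq: "(\<lambda>k. (cmod (T (f (u k)) x - g x))\<^sup>2) \<longlonglongrightarrow> 0"
    proof (rule tendsto_sandwich [OF _ _ tendsto_const])
      show "(\<lambda>k. C / (1 - norm x) powr \<alpha> * (space_norm H (\<lambda>x. T (f (u k)) x - g x))\<^sup>2) \<longlonglongrightarrow> 0"
        by (rule lim2)
      show "\<forall>\<^sub>F k in sequentially. (cmod (T (f (u k)) x - g x))\<^sup>2
        \<le> C / (1 - norm x) powr \<alpha> * (space_norm H (\<lambda>x. T (f (u k)) x - g x))\<^sup>2"
        using C(2) [OF fun_space_diff [OF H Tf g] x] pos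
        by (intro always_eventually allI) (simp add: field_simps)
    qed simp
    have "(\<lambda>k. T (f (u k)) x - g x) \<longlonglongrightarrow> 0"
      by (rule tendsto_norm_zero_cancel) (use tendsto_real_sqrt [OF sq] in simp)
    then have 1: "(\<lambda>k. T (f (u k)) x) \<longlonglongrightarrow> g x"
      by (simp add: LIM_zero_iff)
    have "(\<lambda>k. f k y) \<longlonglongrightarrow> 0" for y
      unfolding f_def using z(2) m w by (intro test_function_tendsto_0) (auto simp: w_def \<alpha>_def)
    then have f0: "(\<lambda>k. f (u k) y) \<longlonglongrightarrow> 0" for y
      using LIMSEQ_subseq_LIMSEQ [OF _ u, of "\<lambda>k. f k y"] by (simp add: o_def)
    have 2: "(\<lambda>k. T (f (u k)) x) \<longlonglongrightarrow> 0"
      using tendsto_diff [OF f0 [of "\<phi> x"] f0 [of "\<psi> x"]] x by (simp add: T_def comp_op_def)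
    from LIMSEQ_unique [OF 1 2] show ?thesis .
  next
    case False
    then show ?thesis
      using fun_spaceD(2) [OF g] by blast
  qed
  then have g0: "(\<lambda>x. T (f k) x - g x) = T (f k)" for k
    by simp
  let ?y = "\<lambda>k. (of_real (1 - (norm (w k))\<^sup>2) / (1 - cinner (v k) (w k))) ^ m"
  have sq: "(\<lambda>k. (cmod (1 - ?y (u k)))\<^sup>2) \<longlonglongrightarrow> 0"
  proof (rule tendsto_sandwich [OF _ _ tendsto_const])
    show "(\<lambda>k. ((2 * K) powr \<alpha> * C) * (space_norm H (\<lambda>x. T (f (u k)) x - g x))\<^sup>2) \<longlonglongrightarrow> 0"
      by (rule lim2)
    have "\<forall>\<^sub>F k in sequentially. 1 - norm (w (u k)) \<le> K * (1 - norm (z (u k)))"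
      using eventually_subseq [OF u K(2)] by (simp add: w_def)
    then show "\<forall>\<^sub>F k in sequentially. (cmod (1 - ?y (u k)))\<^sup>2
      \<le> ((2 * K) powr \<alpha> * C) * (space_norm H (\<lambda>x. T (f (u k)) x - g x))\<^sup>2"
    proof eventually_elim
      case (elim k)
      let ?z = "z (u k)" and ?w = "w (u k)" and ?v = "v (u k)"
      \<comment> \<open>The centre of the test function is \<phi>(z), so evaluating the image at z
        compares its value at the centre with its value at \<psi>(z).\<close>
      have D: "T (f (u k)) ?z = test_function m \<alpha> ?w ?w - test_function m \<alpha> ?w ?v"
        using z(1) [of "u k"] by (simp add: T_def comp_op_def f_def w_def v_def)
      \<comment> \<open>The constant 2 K arises from 1 + |w| \<le> 2 and the hypothesis on
        \<open>K\<close>.\<close>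
      have "1 - (norm ?w)\<^sup>2 = (1 - norm ?w) * (1 + norm ?w)"
        by (simp add: power2_eq_square algebra_simps)
      also have "\<dots> \<le> (1 - norm ?w) * 2"
        using w [of "u k"] by (intro mult_left_mono) auto
      also have "\<dots> \<le> (2 * K) * (1 - norm ?z)"
        using elim by simp
      finally have "(1 - (norm ?w)\<^sup>2) powr \<alpha> \<le> ((2 * K) * (1 - norm ?z)) powr \<alpha>"
        using w [of "u k"] \<alpha> by (intro powr_mono2) (auto simp: power_le_one)
      also have "\<dots> = (2 * K) powr \<alpha> * (1 - norm ?z) powr \<alpha>"
        using K(1) z(1) [of "u k"] by (subst powr_mult) auto
      finally have "(cmod (1 - ?y (u k)))\<^sup>2
        \<le> (cmod (T (f (u k)) ?z))\<^sup>2 * ((2 * K) powr \<alpha> * (1 - norm ?z) powr \<alpha>)"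
        unfolding test_function_difference [OF v w, where \<alpha> = \<alpha>] D by (intro mult_left_mono) auto
      also have "\<dots> = (2 * K) powr \<alpha> * ((cmod (T (f (u k)) ?z))\<^sup>2 * (1 - norm ?z) powr \<alpha>)"
        by simp
      also have "\<dots> \<le> (2 * K) powr \<alpha> * (C * (space_norm H (T (f (u k))))\<^sup>2)"
        by (intro mult_left_mono C(2) Tf z(1)) simp
      finally show ?case
        by (simp add: g0)
    qed
  qed simp
  have "(\<lambda>k. 1 - ?y (u k)) \<longlonglongrightarrow> 0"
    by (rule tendsto_norm_zero_cancel) (use tendsto_real_sqrt [OF sq] in simp)
  then have "(\<lambda>k. 1 - (1 - ?y (u k))) \<longlonglongrightarrow> 1 - 0"
    by (intro tendsto_diff tendsto_const)
  then have "(\<lambda>k. ?y (u k)) \<longlonglongrightarrow> 1"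
    by (simp only: diff_diff_eq2 add_diff_cancel_left' diff_0_right)
  with u show ?thesis
    unfolding w_def v_def by blast
qed

section \<open>Angular derivatives\<close>

text \<open>Expanding the square and bounding both norms by 1 leaves twice the real part of
  \<open>1 - cinner v w\<close>.\<close>

lemma dist_squared_le_one_minus_cinner:
  assumes "norm v \<le> 1" "norm w \<le> 1"
  shows "(norm (v - w))\<^sup>2 \<le> 2 * cmod (1 - cinner v w)"
proof -
  have "(norm (v - w))\<^sup>2 = (norm v)\<^sup>2 + (norm w)\<^sup>2 - 2 * (v \<bullet> w)"
    by (simp add: power2_norm_eq_inner inner_simps inner_commute)
  also have "\<dots> \<le> 2 * Re (1 - cinner v w)"
    using power_le_one [of "norm v" 2] power_le_one [of "norm w" 2] assms by (simp add: Re_cinner)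
  also have "\<dots> \<le> 2 * cmod (1 - cinner v w)"
    using complex_Re_le_cmod [of "1 - cinner v w"] by simp
  finally show ?thesis .
qed

lemma tendsto_of_dist_squared_le:
  fixes f g :: "'a \<Rightarrow> 'b::real_normed_vector"
  assumes "\<forall>\<^sub>F x in F. (norm (f x - g x))\<^sup>2 \<le> h x" and "(h \<longlongrightarrow> 0) F"
  shows "((\<lambda>x. f x - g x) \<longlongrightarrow> 0) F"
proof -
  have "((\<lambda>x. (norm (f x - g x))\<^sup>2) \<longlongrightarrow> 0) F"
    by (rule tendsto_sandwich [OF _ assms(1) tendsto_const assms(2)]) simp
  from tendsto_real_sqrt [OF this] have "((\<lambda>x. norm (f x - g x)) \<longlongrightarrow> 0) F"
    by simp
  then show ?thesis
    by (rule tendsto_norm_zero_cancel)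
qed

text \<open>The limit of one power determines the quotient only up to roots of unity. Dividing the
  limit for m + 1 by the one for m removes this ambiguity.\<close>

lemma compact_difference_limit:
  fixes \<phi> \<psi> :: "complex ^ 'n::finite \<Rightarrow> complex ^ 'n" and z :: "nat \<Rightarrow> complex ^ 'n"
  assumes H: "admissible H" and \<phi>: "\<phi> ` unit_ball \<subseteq> unit_ball" and \<psi>: "\<psi> ` unit_ball \<subseteq> unit_ball"
    and compact: "compact_op H (\<lambda>f z. comp_op \<phi> f z - comp_op \<psi> f z)"
    and z: "\<And>k. z k \<in> unit_ball" "(\<lambda>k. norm (\<phi> (z k))) \<longlonglongrightarrow> 1"
    and K: "0 \<le> K" "\<forall>\<^sub>F k in sequentially. 1 - norm (\<phi> (z k)) \<le> K * (1 - norm (z k))"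
  obtains u where "strict_mono u" "(\<lambda>k. of_real (1 - (norm (\<phi> (z (u k))))\<^sup>2) /
    (1 - cinner (\<psi> (z (u k))) (\<phi> (z (u k))))) \<longlonglongrightarrow> 1"
proof -
  define x where "x k = of_real (1 - (norm (\<phi> (z k)))\<^sup>2) / (1 - cinner (\<psi> (z k)) (\<phi> (z k)))" for k
  have in_ball: "\<phi> (z k) \<in> unit_ball" "\<psi> (z k) \<in> unit_ball" for k
    using \<phi> \<psi> z(1) [of k] by blast+
  obtain m :: nat where m: "kernel_exponent CARD('n) H + 1 \<le> real m"
    using real_arch_simple by blast
  then have m2: "kernel_exponent CARD('n) H + 1 \<le> real (2 * m)"
    "kernel_exponent CARD('n) H + 1 \<le> real (2 * Suc m)"
    by simp_all
  obtain u where u: "strict_mono u" and xm: "(\<lambda>k. x (u k) ^ m) \<longlonglongrightarrow> 1"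
    using compact_difference_power_limit [OF H \<phi> \<psi> compact z K m2(1)] unfolding x_def by blast
  \<comment> \<open>The second extraction starts from the first subsequence, so that both powers
    converge along the final one.\<close>
  have "\<exists>u'. strict_mono u' \<and> (\<lambda>k. x (u (u' k)) ^ Suc m) \<longlonglongrightarrow> 1"
    unfolding x_def
  proof (rule compact_difference_power_limit [OF H \<phi> \<psi> compact _ _ K(1)])
    show "(\<lambda>k. norm (\<phi> (z (u k)))) \<longlonglongrightarrow> 1"
      using LIMSEQ_subseq_LIMSEQ [OF z(2) u] by (simp add: o_def)
    show "\<forall>\<^sub>F k in sequentially. 1 - norm (\<phi> (z (u k))) \<le> K * (1 - norm (z (u k)))"
      using eventually_subseq [OF u K(2)] .
  qed (rule z(1), rule m2(2))
  then obtain u' where u': "strict_mono u'" and xm1: "(\<lambda>k. x (u (u' k)) ^ Suc m) \<longlonglongrightarrow> 1"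
    by blast
  have "(\<lambda>k. x (u (u' k)) ^ m) \<longlonglongrightarrow> 1"
    using LIMSEQ_subseq_LIMSEQ [OF xm u'] by (simp add: o_def)
  from tendsto_divide [OF xm1 this]
  have "(\<lambda>k. x (u (u' k)) ^ Suc m / x (u (u' k)) ^ m) \<longlonglongrightarrow> 1"
    by simp
  moreover have "x k ^ Suc m / x k ^ m = x k" for k
  proof -
    have "(norm (\<phi> (z k)))\<^sup>2 < 1"
      using in_ball(1) [of k] by (simp add: abs_square_less_1)
    then have "complex_of_real (1 - (norm (\<phi> (z k)))\<^sup>2) \<noteq> 0"
      by (simp only: of_real_eq_0_iff)
    moreover have "1 - cinner (\<psi> (z k)) (\<phi> (z k)) \<noteq> 0"
      using in_ball [of k] by (intro one_minus_cinner_nonzero) auto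
    ultimately have "x k \<noteq> 0"
      by (simp only: x_def divide_eq_0_iff) simp
    then show ?thesis
      by simp
  qed
  ultimately have "(\<lambda>k. x (u (u' k))) \<longlonglongrightarrow> 1"
    by simp
  moreover have "strict_mono (\<lambda>k. u (u' k))"
    using u u' by (rule strict_mono_compose)
  ultimately show thesis
    using that [of "\<lambda>k. u (u' k)"] by (simp only: x_def)
qed

text \<open>The limit says that the modulus of 1 - <v,w> is asymptotic to 1 - |w|^2, where w and v
  are the values of \<phi> and \<psi>. This modulus dominates half the squared distance of v and w,
  and also 1 - |v| |w|; the two bounds give the two conclusions.\<close>

lemma compact_difference_asymptotics:
  fixes \<phi> \<psi> :: "complex ^ 'n::finite \<Rightarrow> complex ^ 'n" and z :: "nat \<Rightarrow> complex ^ 'n"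
  assumes H: "admissible H" and \<phi>: "\<phi> ` unit_ball \<subseteq> unit_ball" and \<psi>: "\<psi> ` unit_ball \<subseteq> unit_ball"
    and compact: "compact_op H (\<lambda>f z. comp_op \<phi> f z - comp_op \<psi> f z)"
    and z: "\<And>k. z k \<in> unit_ball" "(\<lambda>k. norm (z k)) \<longlonglongrightarrow> 1"
    and K: "0 \<le> K" "\<forall>\<^sub>F k in sequentially. 1 - norm (\<phi> (z k)) \<le> K * (1 - norm (z k))"
  obtains u q where "strict_mono u" "(\<lambda>k. \<psi> (z (u k)) - \<phi> (z (u k))) \<longlonglongrightarrow> 0"
    "q \<longlonglongrightarrow> (1::real)" "\<forall>\<^sub>F k in sequentially. 1 - norm (\<psi> (z (u k))) \<le> q k * (1 - norm (\<phi> (z (u k))))"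
proof -
  have in_ball: "\<phi> (z k) \<in> unit_ball" "\<psi> (z k) \<in> unit_ball" for k
    using \<phi> \<psi> z(1) [of k] by blast+
  \<comment> \<open>The hypothesis with \<open>K\<close> forces the values of \<phi> to the sphere
    as |z k| tends to 1.\<close>
  have "(\<lambda>k. 1 - norm (\<phi> (z k))) \<longlonglongrightarrow> 0"
  proof (rule tendsto_sandwich [OF _ K(2) tendsto_const])
    show "(\<lambda>k. K * (1 - norm (z k))) \<longlonglongrightarrow> 0"
      using tendsto_mult [OF tendsto_const [of K] tendsto_diff [OF tendsto_const [of 1] z(2)]] by simp
  qed (use in_ball(1) in \<open>simp add: less_imp_le\<close>)
  from tendsto_diff [OF tendsto_const [of 1] this]
  have lim\<phi>: "(\<lambda>k. norm (\<phi> (z k))) \<longlonglongrightarrow> 1"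
    by simp
  obtain u where u: "strict_mono u" and x: "(\<lambda>k. of_real (1 - (norm (\<phi> (z (u k))))\<^sup>2) /
    (1 - cinner (\<psi> (z (u k))) (\<phi> (z (u k))))) \<longlonglongrightarrow> 1"
    using compact_difference_limit [OF H \<phi> \<psi> compact z(1) lim\<phi> K] .
  define w where "w k = \<phi> (z (u k))" for k
  define v where "v k = \<psi> (z (u k))" for k
  have w: "norm (w k) < 1" and v: "norm (v k) < 1" for k
    using in_ball [of "u k"] by (auto simp: w_def v_def)
  have limw: "(\<lambda>k. norm (w k)) \<longlonglongrightarrow> 1"
    using LIMSEQ_subseq_LIMSEQ [OF lim\<phi> u] by (simp add: o_def w_def)
  define y where "y k = cmod ((1 - cinner (v k) (w k)) / of_real (1 - (norm (w k))\<^sup>2))" for k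
  have y: "y \<longlonglongrightarrow> 1"
    using tendsto_norm [OF tendsto_inverse [OF x]] unfolding y_def w_def v_def by simp
  have y_eq: "cmod (1 - cinner (v k) (w k)) = y k * (1 - (norm (w k))\<^sup>2)" for k
  proof -
    have "(norm (w k))\<^sup>2 < 1"
      using w [of k] by (simp add: abs_square_less_1)
    then show ?thesis
      unfolding y_def norm_divide norm_of_real by simp
  qed
  have "(\<lambda>k. 2 * (y k * (1 - (norm (w k))\<^sup>2))) \<longlonglongrightarrow> 2 * (1 * (1 - 1\<^sup>2))"
    by (intro tendsto_intros y limw)
  moreover have "(norm (v k - w k))\<^sup>2 \<le> 2 * (y k * (1 - (norm (w k))\<^sup>2))" for k
    unfolding y_eq [symmetric] using v [of k] w [of k] by (intro dist_squared_le_one_minus_cinner) auto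
  ultimately have "(\<lambda>k. v k - w k) \<longlonglongrightarrow> 0"
    by (intro tendsto_of_dist_squared_le [where h = "\<lambda>k. 2 * (y k * (1 - (norm (w k))\<^sup>2))"]) auto
  \<comment> \<open>Obtained by writing 1 - |v| |w| = (1 - |w|) + |w| (1 - |v|) and solving the
    inequality for 1 - |v|.\<close>
  moreover define q where "q k = (y k * (1 + norm (w k)) - 1) / norm (w k)" for k
  have "q \<longlonglongrightarrow> (1 * (1 + 1) - 1) / 1"
    unfolding q_def by (intro tendsto_intros y limw) simp
  then have "q \<longlonglongrightarrow> 1"
    by simp
  moreover have evw: "\<forall>\<^sub>F k in sequentially. 0 < norm (w k)"
    using order_tendstoD(1) [OF limw, of 0] by simp
  have "\<forall>\<^sub>F k in sequentially. 1 - norm (v k) \<le> q k * (1 - norm (w k))"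
    using evw
  proof eventually_elim
    case pos: (elim k)
    have "1 - norm (v k) * norm (w k) \<le> y k * (1 - (norm (w k))\<^sup>2)"
      using norm_one_minus_cinner_ge [of "v k" "w k"] unfolding y_eq .
    then have "norm (w k) * (1 - norm (v k)) \<le> (y k * (1 + norm (w k)) - 1) * (1 - norm (w k))"
      by (simp add: algebra_simps power2_eq_square)
    then show ?case
      using pos by (simp add: q_def field_simps)
  qed
  ultimately show thesis
    using that [OF u, of q] by (simp add: v_def w_def)
qed

section \<open>Comparison of the dilation coefficients\<close>

text \<open>If the inequality failed, some sequence tending to \<zeta> would keep the quotient of
  \<phi> at most c and that of \<psi> above a larger c'. Along a subsequence the second quotient is
  at most q times the first with q tending to 1.\<close>

lemma dilation_coeff_le:
  fixes \<phi> \<psi> :: "complex ^ 'n::finite \<Rightarrow> complex ^ 'n"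
  assumes H: "admissible H" and \<phi>: "\<phi> ` unit_ball \<subseteq> unit_ball" and \<psi>: "\<psi> ` unit_ball \<subseteq> unit_ball"
    and compact: "compact_op H (\<lambda>f z. comp_op \<phi> f z - comp_op \<psi> f z)"
    and \<zeta>: "\<zeta> \<in> unit_sphere"
  shows "dilation_coeff \<psi> \<zeta> \<le> dilation_coeff \<phi> \<zeta>"
proof (rule ccontr)
  assume "\<not> dilation_coeff \<psi> \<zeta> \<le> dilation_coeff \<phi> \<zeta>"
  then have "dilation_coeff \<phi> \<zeta> < dilation_coeff \<psi> \<zeta>"
    by simp
  then obtain c where c: "dilation_coeff \<phi> \<zeta> < ereal c" "ereal c < dilation_coeff \<psi> \<zeta>"
    using ereal_dense2 by blast
  \<comment> \<open>A second number keeps a strict gap, because the limit argument ends with a weak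
    inequality.\<close>
  obtain c' where c': "ereal c < ereal c'" "ereal c' < dilation_coeff \<psi> \<zeta>"
    using ereal_dense2 [OF c(2)] by blast
  let ?F = "at \<zeta> within unit_ball"
  \<comment> \<open>Otherwise the quotient would eventually exceed c, and its lower limit would be
    at least c.\<close>
  have "\<exists>\<^sub>F z in ?F. (1 - norm (\<phi> z)) / (1 - norm z) \<le> c"
  proof (rule ccontr)
    assume "\<not> ?thesis"
    then have "\<forall>\<^sub>F z in ?F. ereal c \<le> ereal ((1 - norm (\<phi> z)) / (1 - norm z))"
      by (auto simp: not_frequently elim!: eventually_mono)
    then have "ereal c \<le> dilation_coeff \<phi> \<zeta>"
      unfolding dilation_coeff_def by (rule Liminf_bounded)
    with c(1) show False
      by simp
  qed
  moreover have "\<forall>\<^sub>F z in ?F. c' < (1 - norm (\<psi> z)) / (1 - norm z)"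
    using less_LiminfD [OF c'(2) [unfolded dilation_coeff_def]] by simp
  ultimately have freq: "\<exists>\<^sub>F z in ?F. (1 - norm (\<phi> z)) / (1 - norm z) \<le> c \<and> c' < (1 - norm (\<psi> z)) / (1 - norm z)"
    by (rule frequently_eventually_frequently)
  have "\<exists>z. z \<in> unit_ball \<and> dist z \<zeta> < 1 / real (Suc k) \<and>
      (1 - norm (\<phi> z)) / (1 - norm z) \<le> c \<and> c' < (1 - norm (\<psi> z)) / (1 - norm z)" for k
  proof -
    have "\<forall>\<^sub>F z in ?F. z \<in> unit_ball \<and> dist z \<zeta> < 1 / real (Suc k)"
      unfolding eventually_at by (intro exI [of _ "1 / real (Suc k)"]) auto
    from frequently_ex [OF frequently_eventually_conj [OF freq this]] show ?thesis
      by blast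
  qed
  then obtain z where z: "\<And>k. z k \<in> unit_ball" "\<And>k. dist (z k) \<zeta> < 1 / real (Suc k)"
    "\<And>k. (1 - norm (\<phi> (z k))) / (1 - norm (z k)) \<le> c" "\<And>k. c' < (1 - norm (\<psi> (z k))) / (1 - norm (z k))"
    by metis
  have pos: "0 < 1 - norm (z k)" "0 < 1 - norm (\<phi> (z k))" for k
    using z(1) [of k] \<phi> by (auto simp: image_subset_iff)
  have \<phi>c: "1 - norm (\<phi> (z k)) \<le> c * (1 - norm (z k))" for k
    using z(3) [of k] pos(1) [of k] by (simp add: divide_le_eq)
  \<comment> \<open>The quotients are positive, so c can serve as the constant
    \<open>K\<close>.\<close>
  have "0 < c"
    using z(3) [of 0] divide_pos_pos [OF pos(2) [of 0] pos(1) [of 0]] by linarith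
  have "(\<lambda>k. dist (z k) \<zeta>) \<longlonglongrightarrow> 0"
    using z(2) by (intro real_tendsto_sandwich [OF _ _ tendsto_const LIMSEQ_inverse_real_of_nat [unfolded inverse_eq_divide]])
      (auto simp: less_imp_le)
  then have "z \<longlonglongrightarrow> \<zeta>"
    by (simp add: tendsto_dist_iff [symmetric])
  from tendsto_norm [OF this] have norm_z: "(\<lambda>k. norm (z k)) \<longlonglongrightarrow> 1"
    using \<zeta> by simp
  have ev: "\<forall>\<^sub>F k in sequentially. 1 - norm (\<phi> (z k)) \<le> c * (1 - norm (z k))"
    using \<phi>c by simp
  obtain u q where u: "strict_mono u" and diff: "(\<lambda>k. \<psi> (z (u k)) - \<phi> (z (u k))) \<longlonglongrightarrow> 0"
    and q: "q \<longlonglongrightarrow> (1::real)"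
    and le: "\<forall>\<^sub>F k in sequentially. 1 - norm (\<psi> (z (u k))) \<le> q k * (1 - norm (\<phi> (z (u k))))"
    using compact_difference_asymptotics [OF H \<phi> \<psi> compact z(1) norm_z less_imp_le [OF \<open>0 < c\<close>] ev] .
  have "\<forall>\<^sub>F k in sequentially. c' \<le> q k * c"
    using le order_tendstoD(1) [OF q, of 0, simplified]
  proof eventually_elim
    case (elim k)
    have "c' * (1 - norm (z (u k))) < 1 - norm (\<psi> (z (u k)))"
      using z(4) [of "u k"] pos(1) [of "u k"] by (simp add: less_divide_eq)
    also have "\<dots> \<le> q k * (1 - norm (\<phi> (z (u k))))"
      by (rule elim)
    also have "\<dots> \<le> q k * (c * (1 - norm (z (u k))))"
      using elim \<phi>c by (intro mult_left_mono) auto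
    finally show ?case
      using pos(1) [of "u k"] by (simp flip: mult.assoc)
  qed
  then have "c' \<le> 1 * c"
    by (intro tendsto_lowerbound [OF tendsto_mult [OF q tendsto_const [of c]]]) auto
  with c'(1) show False
    by simp
qed

section \<open>Radial limits at points with finite angular derivative\<close>

text \<open>A radius coincides with its projection to the complex line of \<zeta>, so the first
  quotient vanishes; the second equals 1, whence M = 1.\<close>

lemma radial_curve_restricted:
  fixes \<zeta> :: "complex ^ 'n::finite"
  assumes "\<zeta> \<in> unit_sphere"
  shows "restricted_curve (\<lambda>t. t *\<^sub>R \<zeta>) \<zeta>"
proof -
  have "norm \<zeta> = 1"
    using assms by simp
  then have "cinner (t *\<^sub>R \<zeta>) \<zeta> *s \<zeta> = t *\<^sub>R \<zeta>" for t
    by (simp add: cinner_scaleR_left cinner_self vec_eq_iff scaleR_conv_of_real [where 'a = complex])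
  moreover have "norm (t *\<^sub>R \<zeta> - \<zeta>) / (1 - norm (t *\<^sub>R \<zeta>)) \<le> 1" if "t \<in> {0..<1}" for t
  proof -
    have "t *\<^sub>R \<zeta> - \<zeta> = (t - 1) *\<^sub>R \<zeta>"
      by (simp add: algebra_simps)
    then show ?thesis
      using that \<open>norm \<zeta> = 1\<close> by simp
  qed
  moreover have "((\<lambda>t. t *\<^sub>R \<zeta>) \<longlongrightarrow> 1 *\<^sub>R \<zeta>) (at_left 1)"
    by (intro tendsto_intros)
  ultimately show ?thesis
    unfolding restricted_curve_def Let_def using \<open>norm \<zeta> = 1\<close>
    by (auto intro!: continuous_intros exI [of _ 1])
qed

text \<open>On the radius the denominator is 1 - r. Convergence of the quotient therefore bounds the
  modulus of 1 - <\<phi>(r \<zeta>),\<eta>> by (|L| + 1) (1 - r) close to 1, and this single bound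
  controls both the distance from \<eta> and 1 - |\<phi>(r \<zeta>)|.\<close>

lemma angular_derivative_radial:
  fixes \<phi> :: "complex ^ 'n::finite \<Rightarrow> complex ^ 'n"
  assumes \<phi>: "\<phi> ` unit_ball \<subseteq> unit_ball" and \<zeta>: "\<zeta> \<in> unit_sphere" and "finite_angular_derivative \<phi> \<zeta>"
  obtains \<eta> K where "has_radial_limit \<phi> \<zeta> \<eta>" "0 \<le> K"
    "\<forall>\<^sub>F r in at_left 1. 1 - norm (\<phi> (r *\<^sub>R \<zeta>)) \<le> K * (1 - norm (r *\<^sub>R \<zeta>))"
proof -
  obtain \<eta> L where \<eta>: "norm \<eta> = 1"
    and L: "has_restricted_limit (\<lambda>z. cinner (\<eta> - \<phi> z) \<eta> / cinner (\<zeta> - z) \<zeta>) \<zeta> L"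
    using assms(3) by (auto simp: finite_angular_derivative_def)
  have \<zeta>1: "norm \<zeta> = 1"
    using \<zeta> by simp
  have "((\<lambda>r. cinner (\<eta> - \<phi> (r *\<^sub>R \<zeta>)) \<eta> / cinner (\<zeta> - r *\<^sub>R \<zeta>) \<zeta>) \<longlongrightarrow> L) (at_left 1)"
    using L radial_curve_restricted [OF \<zeta>] by (auto simp: has_restricted_limit_def)
  from order_tendstoD(2) [OF tendsto_norm [OF this], of "cmod L + 1"]
  have ev: "\<forall>\<^sub>F r in at_left 1. cmod (cinner (\<eta> - \<phi> (r *\<^sub>R \<zeta>)) \<eta> / cinner (\<zeta> - r *\<^sub>R \<zeta>) \<zeta>) < cmod L + 1"
    by simp
  have ev01: "\<forall>\<^sub>F r :: real in at_left 1. r \<in> {0<..<1}"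
    by (rule eventually_at_leftI [of 0]) auto
  have bound: "\<forall>\<^sub>F r in at_left 1. norm (\<phi> (r *\<^sub>R \<zeta>)) < 1 \<and>
    cmod (1 - cinner (\<phi> (r *\<^sub>R \<zeta>)) \<eta>) \<le> (cmod L + 1) * (1 - norm (r *\<^sub>R \<zeta>))"
    using ev ev01
  proof eventually_elim
    case (elim r)
    have "r *\<^sub>R \<zeta> \<in> unit_ball"
      using elim(2) \<zeta>1 by simp
    then have "\<phi> (r *\<^sub>R \<zeta>) \<in> unit_ball"
      using \<phi> by blast
    moreover have "cinner (\<zeta> - r *\<^sub>R \<zeta>) \<zeta> = of_real (1 - r)"
      by (simp add: cinner_diff_left cinner_scaleR_left cinner_self \<zeta>1)
    moreover have "cinner (\<eta> - \<phi> (r *\<^sub>R \<zeta>)) \<eta> = 1 - cinner (\<phi> (r *\<^sub>R \<zeta>)) \<eta>"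
      by (simp add: cinner_diff_left cinner_self \<eta>)
    ultimately show ?case
      using elim \<zeta>1 by (simp add: norm_divide divide_less_eq less_imp_le del: of_real_diff)
  qed
  have lim: "((\<lambda>r. 2 * ((cmod L + 1) * (1 - norm (r *\<^sub>R \<zeta>)))) \<longlongrightarrow> 2 * ((cmod L + 1) * (1 - norm (1 *\<^sub>R \<zeta>)))) (at_left 1)"
    by (intro tendsto_intros)
  have "((\<lambda>r. \<phi> (r *\<^sub>R \<zeta>) - \<eta>) \<longlongrightarrow> 0) (at_left 1)"
  proof (rule tendsto_of_dist_squared_le)
    show "\<forall>\<^sub>F r in at_left 1. (norm (\<phi> (r *\<^sub>R \<zeta>) - \<eta>))\<^sup>2 \<le> 2 * ((cmod L + 1) * (1 - norm (r *\<^sub>R \<zeta>)))"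
      using bound
    proof eventually_elim
      case (elim r)
      then have "(norm (\<phi> (r *\<^sub>R \<zeta>) - \<eta>))\<^sup>2 \<le> 2 * cmod (1 - cinner (\<phi> (r *\<^sub>R \<zeta>)) \<eta>)"
        using \<eta> by (intro dist_squared_le_one_minus_cinner) auto
      also have "\<dots> \<le> 2 * ((cmod L + 1) * (1 - norm (r *\<^sub>R \<zeta>)))"
        using elim by (intro mult_left_mono) auto
      finally show ?case .
    qed
  qed (use lim \<zeta>1 in simp)
  then have "has_radial_limit \<phi> \<zeta> \<eta>"
    unfolding has_radial_limit_def by (simp add: LIM_zero_iff)
  moreover have "\<forall>\<^sub>F r in at_left 1. 1 - norm (\<phi> (r *\<^sub>R \<zeta>)) \<le> (cmod L + 1) * (1 - norm (r *\<^sub>R \<zeta>))"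
    using bound
  proof eventually_elim
    case (elim r)
    then show ?case
      using norm_one_minus_cinner_ge [of "\<phi> (r *\<^sub>R \<zeta>)" \<eta>] \<eta> by simp
  qed
  ultimately show thesis
    using that [of \<eta> "cmod L + 1"] by simp
qed

text \<open>The asymptotics hold along subsequences only. So a sequence of radii on which \<psi>
  stays away from \<eta> is assumed, and a subsequence of it on which \<psi> - \<phi> tends to 0
  gives the contradiction.\<close>

lemma radial_limit_transfer:
  fixes \<phi> \<psi> :: "complex ^ 'n::finite \<Rightarrow> complex ^ 'n"
  assumes H: "admissible H" and \<phi>: "\<phi> ` unit_ball \<subseteq> unit_ball" and \<psi>: "\<psi> ` unit_ball \<subseteq> unit_ball"
    and compact: "compact_op H (\<lambda>f z. comp_op \<phi> f z - comp_op \<psi> f z)"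
    and \<zeta>: "\<zeta> \<in> unit_sphere" and \<eta>: "has_radial_limit \<phi> \<zeta> \<eta>"
    and K: "0 \<le> K" "\<forall>\<^sub>F r in at_left 1. 1 - norm (\<phi> (r *\<^sub>R \<zeta>)) \<le> K * (1 - norm (r *\<^sub>R \<zeta>))"
  shows "has_radial_limit \<psi> \<zeta> \<eta>"
  unfolding has_radial_limit_def
proof (rule tendsto_at_left_sequentially [of 0])
  fix S :: "nat \<Rightarrow> real"
  assume S: "\<And>n. S n < 1" "\<And>n. 0 < S n" "S \<longlonglongrightarrow> 1"
  have S1: "filterlim S (at_left 1) sequentially"
    using S by (simp add: filterlim_at less_imp_neq)
  show "(\<lambda>n. \<psi> (S n *\<^sub>R \<zeta>)) \<longlonglongrightarrow> \<eta>"
  proof (rule ccontr)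
    assume "\<not> (\<lambda>n. \<psi> (S n *\<^sub>R \<zeta>)) \<longlonglongrightarrow> \<eta>"
    then obtain e where "0 < e" and "\<not> (\<forall>\<^sub>F n in sequentially. dist (\<psi> (S n *\<^sub>R \<zeta>)) \<eta> < e)"
      by (auto simp: tendsto_iff)
    then obtain r :: "nat \<Rightarrow> nat" where r: "strict_mono r" "\<And>n. \<not> dist (\<psi> (S (r n) *\<^sub>R \<zeta>)) \<eta> < e"
      using not_eventually_sequentiallyD by blast
    define z where "z n = S (r n) *\<^sub>R \<zeta>" for n
    have z: "z n \<in> unit_ball" for n
      using S(1,2) [of "r n"] \<zeta> by (simp add: z_def)
    have Sr: "filterlim (\<lambda>n. S (r n)) (at_left 1) sequentially"
      using filterlim_compose [OF S1 filterlim_subseq [OF r(1)]] .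
    have "(\<lambda>n. S (r n)) \<longlonglongrightarrow> 1"
      using LIMSEQ_subseq_LIMSEQ [OF S(3) r(1)] by (simp add: o_def)
    then have norm_z: "(\<lambda>n. norm (z n)) \<longlonglongrightarrow> 1"
      using S(2) \<zeta> by (simp add: z_def less_imp_le)
    have ev: "\<forall>\<^sub>F n in sequentially. 1 - norm (\<phi> (z n)) \<le> K * (1 - norm (z n))"
      unfolding z_def by (rule eventually_compose_filterlim [OF K(2) Sr])
    have \<phi>z: "(\<lambda>n. \<phi> (z n)) \<longlonglongrightarrow> \<eta>"
      unfolding z_def using filterlim_compose [OF \<eta> [unfolded has_radial_limit_def] Sr] .
    obtain u q where u: "strict_mono u" and diff: "(\<lambda>k. \<psi> (z (u k)) - \<phi> (z (u k))) \<longlonglongrightarrow> 0"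
      and "q \<longlonglongrightarrow> (1::real)"
      and "\<forall>\<^sub>F k in sequentially. 1 - norm (\<psi> (z (u k))) \<le> q k * (1 - norm (\<phi> (z (u k))))"
      using compact_difference_asymptotics [OF H \<phi> \<psi> compact z norm_z K(1) ev] .
    have "(\<lambda>k. \<phi> (z (u k))) \<longlonglongrightarrow> \<eta>"
      using LIMSEQ_subseq_LIMSEQ [OF \<phi>z u] by (simp add: o_def)
    from tendsto_add [OF diff this] have "(\<lambda>k. \<psi> (z (u k))) \<longlonglongrightarrow> \<eta>"
      by simp
    then have "\<forall>\<^sub>F k in sequentially. dist (\<psi> (z (u k))) \<eta> < e"
      using \<open>0 < e\<close> by (rule tendstoD)
    then show False
      using r(2) by (simp add: z_def)
  qed
qed simp

theorem corollary2p2: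
  fixes H :: space_kind
    and \<phi> \<psi> :: "complex ^ 'n::finite \<Rightarrow> complex ^ 'n"
  assumes "H = Hardy \<or> (\<exists>s>-1. H = Bergman s)"
    and "analytic_self_map \<phi>" and "analytic_self_map \<psi>"
    and "bounded_op H (comp_op \<phi>)" and "bounded_op H (comp_op \<psi>)"
    and "compact_op H (\<lambda>f z. comp_op \<phi> f z - comp_op \<psi> f z)"
  shows "\<forall>\<zeta>\<in>unit_sphere. finite_angular_derivative \<phi> \<zeta> \<longrightarrow>
           (\<exists>w. has_radial_limit \<phi> \<zeta> w \<and> has_radial_limit \<psi> \<zeta> w) \<and>
           dilation_coeff \<phi> \<zeta> = dilation_coeff \<psi> \<zeta>"
proof (intro ballI impI conjI)
  fix \<zeta> :: "complex ^ 'n"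
  assume \<zeta>: "\<zeta> \<in> unit_sphere" and fin: "finite_angular_derivative \<phi> \<zeta>"
  have H: "admissible H"
    using assms(1) by (simp add: admissible_def)
  have \<phi>: "\<phi> ` unit_ball \<subseteq> unit_ball" and \<psi>: "\<psi> ` unit_ball \<subseteq> unit_ball"
    using assms(2,3) unfolding analytic_self_map_def by blast+
  obtain \<eta> K where \<eta>: "has_radial_limit \<phi> \<zeta> \<eta>" and K: "0 \<le> K"
    "\<forall>\<^sub>F r in at_left 1. 1 - norm (\<phi> (r *\<^sub>R \<zeta>)) \<le> K * (1 - norm (r *\<^sub>R \<zeta>))"
    using angular_derivative_radial [OF \<phi> \<zeta> fin] .
  have "has_radial_limit \<psi> \<zeta> \<eta>"
    by (rule radial_limit_transfer [OF H \<phi> \<psi> assms(6) \<zeta> \<eta> K])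
  with \<eta> show "\<exists>w. has_radial_limit \<phi> \<zeta> w \<and> has_radial_limit \<psi> \<zeta> w"
    by blast
  \<comment> \<open>Compactness of the difference taken in the opposite order gives the inequality
    with \<phi> and \<psi> exchanged.\<close>
  show "dilation_coeff \<phi> \<zeta> = dilation_coeff \<psi> \<zeta>"
    by (intro antisym dilation_coeff_le [OF H \<psi> \<phi> compact_op_diff_commute [OF H assms(6)] \<zeta>]
        dilation_coeff_le [OF H \<phi> \<psi> assms(6) \<zeta>])
qed

end
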